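(* Let $n\geq 2$ and let $\mathcal F=(\mathbb D^n,\mathcal L,\{0\})$ be the singular holomorphic foliation on the unit polydisc $\mathbb D^n\subset\mathbb C^n$ whose leaves are the integral curves in $\mathbb D^n\setminus\{0\}$ of the linear vector field $\Phi(z)=\sum_{j=1}^n\lambda_j z_j\frac{\partial}{\partial z_j}$, where all $\lambda_j$ are nonzero complex numbers and there are some $1\leq l\neq k\leq n$ with $\lambda_k/\lambda_l\notin\mathbb R$. Let $\mathcal Z:=\mathbb D^n\cap\bigcup_{j=1}^n\{z_j=0\}$ and let $\check{\mathcal F}$ be the restriction of $\mathcal F$ to $\mathbb D^n\setminus\mathcal Z$. Let $T$ be a positive harmonic current on $\mathbb D^n\setminus\mathcal Z$ directed by $\check{\mathcal F}$ such that the mass of $T$ on $\mathbb D^n\setminus(r\mathbb D)^n$ is finite for some $r\in(0,1)$, where $(r\mathbb D)^n$ is the polydisc of polyradius $r$. Then: (1) the mass of $T$ on $\mathbb D^n$ is finite; (2) the Lelong number of $T$ at every point of $\mathcal Z$ vanishes.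
   Context: A holomorphic foliation by Riemann surfaces on a complex manifold $M$ of dimension $n$ is given by flow boxes $\mathbb U\simeq\mathbb B\times\mathbb T$ (biholomorphically) with $\mathbb B\subset\mathbb C$, $\mathbb T\subset\mathbb C^{n-1}$ domains and with coordinate changes of the form $(y,t)\mapsto(\Psi(y,t),\Lambda(t))$; plaques are the sets $\{t=\mathrm{const}\}$. Let $\mathcal D^{p,q}$, $0\leq p,q\leq1$, be the space of leafwise $(p,q)$-forms with compact support in $M$ which are smooth on plaques and whose coefficients, together with all their leafwise derivatives, depend continuously on the plaque. A directed current $T$ of bidimension $(1,1)$ is a continuous linear form on $\mathcal D^{1,1}$; it is positive if $T(f)\geq0$ for all $f$ positive on each plaque, and harmonic if $T(dd^cf)=0$ for all $f\in\mathcal D^{0,0}$. Here $M=\mathbb D^n\setminus\mathcal Z$. Restricting smooth compactly supported $(1,1)$-forms to the leaves, $T$ is regarded as a positive $dd^c$-closed current of bidimension $(1,1)$ on $\mathbb D^n\setminus\mathcal Z$. The mass of $T$ on a measurable set $A\subset\mathbb D^n$ is the mass of the positive measure $T\wedge\beta$ on $A\setminus\mathcal Z$, where $\beta$ is the standard Hermitian form on $\mathbb C^n$. The Lelong number of $T$ at a point $x\in\mathcal Z$ is $$\nu(T,x):=\limsup_{r\to0+}\frac1{\pi r^2}\int_{\mathbb B(x,r)\setminus\mathcal Z}T\wedge dd^c\|z\|^2\in[0,\infty],$$ where $\mathbb B(x,r)$ is the Euclidean ball of center $x$ and radius $r$; $dd^c$ is a fixed positive multiple of $i\partial\bar\partial$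 (the normalization is immaterial for vanishing). *)

theory Defs
  imports "HOL-Analysis.Analysis"
begin

subsection \<open>Holomorphic foliations by Riemann surfaces\<close>

definition holomorphic_map_on :: "((complex^'n) \<Rightarrow> (complex^'m)) \<Rightarrow> (complex^'n) set \<Rightarrow> bool"
  where "holomorphic_map_on f U \<longleftrightarrow>
    (\<forall>z\<in>U. f differentiable at z \<and>
      (\<forall>c v. frechet_derivative f (at z) (c *s v) = c *s frechet_derivative f (at z) v))"

text \<open>A flow box \<open>(U, \<phi>, k)\<close> on a domain of \<open>\<complex>\<^sup>n\<close> is a biholomorphic map \<open>\<phi>\<close> of \<open>U\<close> onto a product
  \<open>B \<times> T\<close>. The factor \<open>\<complex>\<close> containing \<open>B\<close> is the \<open>k\<close>-th coordinate of \<open>\<complex>\<^sup>n\<close>, and the factor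
  \<open>\<complex>\<^sup>n\<^sup>-\<^sup>1\<close> containing \<open>T\<close> is the hyperplane on which this coordinate is zero. The plaques are the
  sets where \<open>transversal_part k (\<phi> z)\<close> is constant.\<close>

type_synonym 'n flow_box = "(complex^'n) set \<times> ((complex^'n) \<Rightarrow> (complex^'n)) \<times> 'n"

definition transversal_part :: "'n \<Rightarrow> complex^'n \<Rightarrow> complex^'n"
  where "transversal_part k w = (\<chi> j. if j = k then 0 else w $ j)"

definition is_flow_box :: "(complex^'n) set \<Rightarrow> 'n::finite flow_box \<Rightarrow> bool"
  where "is_flow_box M = (\<lambda>(U, \<phi>, k).
    open U \<and> U \<subseteq> M \<and> inj_on \<phi> U \<and>
    holomorphic_map_on \<phi> U \<and> holomorphic_map_on (inv_into U \<phi>) (\<phi> ` U) \<and>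
    (\<exists>B T. open B \<and> connected B \<and> B \<noteq> {} \<and>
       openin (top_of_set {t. t $ k = 0}) T \<and> connected T \<and> T \<noteq> {} \<and>
       \<phi> ` U = {w. w $ k \<in> B \<and> transversal_part k w \<in> T}))"

text \<open>The coordinate changes have the form \<open>(y, t) \<mapsto> (\<Psi>(y, t), \<Lambda>(t))\<close> locally: the intersection of
  two flow boxes may meet a plaque in several components.\<close>

definition holomorphic_foliation :: "(complex^'n) set \<Rightarrow> 'n::finite flow_box set \<Rightarrow> bool"
  where "holomorphic_foliation M \<A> \<longleftrightarrow>
    (\<forall>b\<in>\<A>. is_flow_box M b) \<and> M = (\<Union>b\<in>\<A>. fst b) \<and>
    (\<forall>(U, \<phi>, k)\<in>\<A>. \<forall>(U', \<phi>', k')\<in>\<A>. \<forall>z\<in>U \<inter> U'.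
      \<exists>N. open N \<and> z \<in> N \<and> N \<subseteq> U \<inter> U' \<and>
        (\<forall>z1\<in>N. \<forall>z2\<in>N. transversal_part k (\<phi> z1) = transversal_part k (\<phi> z2) \<longrightarrow>
           transversal_part k' (\<phi>' z1) = transversal_part k' (\<phi>' z2)))"

text \<open>The foliation of \<open>M\<close> whose leaves are the integral curves of a nowhere vanishing holomorphic
  vector field \<open>X\<close>: its flow boxes are those of the flow-box theorem, in which \<open>X\<close> becomes
  \<open>\<partial>/\<partial>y\<close>, so that the plaques are exactly pieces of integral curves, parametrized by complex time.\<close>

definition foliation_of_field ::
    "(complex^'n) set \<Rightarrow> (complex^'n \<Rightarrow> complex^'n) \<Rightarrow> 'n::finite flow_box set"
  where "foliation_of_field M X = {(U, \<phi>, k). is_flow_box M (U, \<phi>, k) \<and>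
    (\<forall>z\<in>U. frechet_derivative \<phi> (at z) (X z) = axis k 1)}"

definition restrict_foliation :: "'n::finite flow_box set \<Rightarrow> (complex^'n) set \<Rightarrow> 'n flow_box set"
  where "restrict_foliation \<A> M = {b\<in>\<A>. fst b \<subseteq> M}"

definition linear_field :: "complex^'n \<Rightarrow> complex^'n \<Rightarrow> complex^'n"
  where "linear_field lam z = (\<chi> j. lam $ j * z $ j)"

definition leaf_tangent :: "'n::finite flow_box set \<Rightarrow> complex^'n \<Rightarrow> (complex^'n) set"
  where "leaf_tangent \<A> p =
    {v. \<exists>(U, \<phi>, k)\<in>\<A>. p \<in> U \<and> transversal_part k (frechet_derivative \<phi> (at p) v) = 0}"


subsection \<open>Leafwise functions and forms\<close>

text \<open>For \<open>y = x\<^sub>1 + i x\<^sub>2\<close> the plaque coordinate, the directions \<open>1\<close> and \<open>\<i>\<close> give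
  \<open>\<partial>/\<partial>x\<^sub>1\<close> and \<open>\<partial>/\<partial>x\<^sub>2\<close>.\<close>

definition plaque_deriv :: "'n \<Rightarrow> complex \<Rightarrow> (complex^'n \<Rightarrow> complex) \<Rightarrow> complex^'n \<Rightarrow> complex"
  where "plaque_deriv k d g w =
    vector_derivative (\<lambda>s::real. g (w + s *\<^sub>R axis k d)) (at 0)"

definition plaque_derivs ::
    "'n \<Rightarrow> complex list \<Rightarrow> (complex^'n \<Rightarrow> complex) \<Rightarrow> complex^'n \<Rightarrow> complex"
  where "plaque_derivs k ds g = foldr (plaque_deriv k) ds g"

definition plaque_smooth_on :: "'n \<Rightarrow> (complex^'n) set \<Rightarrow> (complex^'n \<Rightarrow> complex) \<Rightarrow> bool"
  where "plaque_smooth_on k W g \<longleftrightarrow>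
    (\<forall>ds\<in>lists {1, \<i>}. continuous_on W (plaque_derivs k ds g) \<and>
      (\<forall>d\<in>{1, \<i>}. \<forall>w\<in>W.
        (\<lambda>s::real. plaque_derivs k ds g (w + s *\<^sub>R axis k d)) differentiable at 0))"

text \<open>The space \<open>\<D>\<^sup>0\<^sup>,\<^sup>0\<close>; its elements are extended by zero to \<open>\<complex>\<^sup>n\<close>.\<close>

definition leaf_functions ::
    "'n::finite flow_box set \<Rightarrow> (complex^'n) set \<Rightarrow> (complex^'n \<Rightarrow> complex) set"
  where "leaf_functions \<A> M = {f.
    (\<exists>K. compact K \<and> K \<subseteq> M \<and> (\<forall>p. p \<notin> K \<longrightarrow> f p = 0)) \<and>
    (\<forall>(U, \<phi>, k)\<in>\<A>. plaque_smooth_on k (\<phi> ` U) (f \<circ> inv_into U \<phi>))}"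

type_synonym 'n two_form = "complex^'n \<Rightarrow> complex^'n \<Rightarrow> complex^'n \<Rightarrow> complex"

text \<open>The area form \<open>(i/2) dy \<and> cnj dy\<close> of the plaque coordinate, and the coefficient of a leafwise form
  with respect to it, i.e. its value on \<open>\<partial>/\<partial>x\<^sub>1\<close>, \<open>\<partial>/\<partial>x\<^sub>2\<close>.\<close>

definition plaque_area :: "'n::finite flow_box \<Rightarrow> 'n two_form"
  where "plaque_area = (\<lambda>(U, \<phi>, k) p u v.
    of_real (Im (cnj (frechet_derivative \<phi> (at p) u $ k) * (frechet_derivative \<phi> (at p) v $ k))))"

definition plaque_coeff :: "'n::finite flow_box \<Rightarrow> 'n two_form \<Rightarrow> complex^'n \<Rightarrow> complex"
  where "plaque_coeff = (\<lambda>(U, \<phi>, k) \<omega> w.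
    \<omega> (inv_into U \<phi> w)
      (frechet_derivative (inv_into U \<phi>) (at w) (axis k 1))
      (frechet_derivative (inv_into U \<phi>) (at w) (axis k \<i>)))"

text \<open>The space \<open>\<D>\<^sup>1\<^sup>,\<^sup>1\<close>. A leafwise form is only meaningful on vectors tangent to the leaves; it is
  given the value zero on all others.\<close>

definition leaf_forms :: "'n::finite flow_box set \<Rightarrow> (complex^'n) set \<Rightarrow> 'n two_form set"
  where "leaf_forms \<A> M = {\<omega>.
    (\<exists>K. compact K \<and> K \<subseteq> M \<and> (\<forall>p u v. p \<notin> K \<longrightarrow> \<omega> p u v = 0)) \<and>
    (\<forall>p u v. u \<notin> leaf_tangent \<A> p \<or> v \<notin> leaf_tangent \<A> p \<longrightarrow> \<omega> p u v = 0) \<and>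
    (\<forall>(U, \<phi>, k)\<in>\<A>. plaque_smooth_on k (\<phi> ` U) (plaque_coeff (U, \<phi>, k) \<omega>) \<and>
      (\<forall>p\<in>U. \<forall>u\<in>leaf_tangent \<A> p. \<forall>v\<in>leaf_tangent \<A> p.
        \<omega> p u v = plaque_coeff (U, \<phi>, k) \<omega> (\<phi> p) * plaque_area (U, \<phi>, k) p u v))}"

definition leaf_restrict :: "'n::finite flow_box set \<Rightarrow> 'n two_form \<Rightarrow> 'n two_form"
  where "leaf_restrict \<A> \<alpha> p u v =
    (if u \<in> leaf_tangent \<A> p \<and> v \<in> leaf_tangent \<A> p then \<alpha> p u v else 0)"

text \<open>The leafwise operator \<open>dd\<^sup>c = (i/\<pi>)\<partial>\<partial>*\<close>, where \<open>\<partial>*\<close> is the antiholomorphic part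
  of \<open>d\<close>. In the plaque coordinate
  \<open>i\<partial>\<partial>*f\<close> is half the Laplacian of \<open>f\<close> times \<open>(i/2) dy \<and> cnj dy\<close>, and the result does not
  depend on the flow box in which it is computed.\<close>

definition ddc :: "'n::finite flow_box set \<Rightarrow> (complex^'n \<Rightarrow> complex) \<Rightarrow> 'n two_form"
  where "ddc \<A> f = leaf_restrict \<A> (\<lambda>p u v.
    let (U, \<phi>, k) = (SOME b. b \<in> \<A> \<and> p \<in> fst b);
        g = f \<circ> inv_into U \<phi>
    in of_real (1 / (2 * pi)) *
       (plaque_derivs k [1, 1] g (\<phi> p) + plaque_derivs k [\<i>, \<i>] g (\<phi> p)) *
       plaque_area (U, \<phi>, k) p u v)"


subsection \<open>Directed currents\<close>

text \<open>Convergence to zero in \<open>\<D>\<^sup>1\<^sup>,\<^sup>1\<close>. This space is the inductive limit, over the compact sets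
  \<open>K \<subseteq> M\<close>, of the Frechet spaces of forms supported in \<open>K\<close>, so a linear form on it is continuous if
  and only if it is sequentially continuous at zero.\<close>

definition leaf_forms_null ::
    "'n::finite flow_box set \<Rightarrow> (complex^'n) set \<Rightarrow> (nat \<Rightarrow> 'n two_form) \<Rightarrow> bool"
  where "leaf_forms_null \<A> M \<omega> \<longleftrightarrow>
    (\<forall>i. \<omega> i \<in> leaf_forms \<A> M) \<and>
    (\<exists>K. compact K \<and> K \<subseteq> M \<and> (\<forall>i p u v. p \<notin> K \<longrightarrow> \<omega> i p u v = 0)) \<and>
    (\<forall>(U, \<phi>, k)\<in>\<A>. \<forall>L ds. compact L \<and> L \<subseteq> \<phi> ` U \<and> ds \<in> lists {1, \<i>} \<longrightarrow>
      uniform_limit L (\<lambda>i. plaque_derivs k ds (plaque_coeff (U, \<phi>, k) (\<omega> i))) (\<lambda>w. 0) sequentially)"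

definition directed_current ::
    "'n::finite flow_box set \<Rightarrow> (complex^'n) set \<Rightarrow> ('n two_form \<Rightarrow> complex) \<Rightarrow> bool"
  where "directed_current \<A> M T \<longleftrightarrow>
    (\<forall>\<omega>\<in>leaf_forms \<A> M. \<forall>\<omega>'\<in>leaf_forms \<A> M.
      T (\<lambda>p u v. \<omega> p u v + \<omega>' p u v) = T \<omega> + T \<omega>') \<and>
    (\<forall>c. \<forall>\<omega>\<in>leaf_forms \<A> M. T (\<lambda>p u v. c * \<omega> p u v) = c * T \<omega>) \<and>
    (\<forall>\<omega>. leaf_forms_null \<A> M \<omega> \<longrightarrow> (\<lambda>i. T (\<omega> i)) \<longlonglongrightarrow> 0)"

definition positive_leaf_form :: "'n::finite flow_box set \<Rightarrow> 'n two_form \<Rightarrow> bool"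
  where "positive_leaf_form \<A> \<omega> \<longleftrightarrow>
    (\<forall>(U, \<phi>, k)\<in>\<A>. \<forall>w\<in>\<phi> ` U. plaque_coeff (U, \<phi>, k) \<omega> w \<in> \<real>\<^sub>\<ge>\<^sub>0)"

definition positive_current ::
    "'n::finite flow_box set \<Rightarrow> (complex^'n) set \<Rightarrow> ('n two_form \<Rightarrow> complex) \<Rightarrow> bool"
  where "positive_current \<A> M T \<longleftrightarrow>
    (\<forall>\<omega>\<in>leaf_forms \<A> M. positive_leaf_form \<A> \<omega> \<longrightarrow> T \<omega> \<in> \<real>\<^sub>\<ge>\<^sub>0)"

definition harmonic_current ::
    "'n::finite flow_box set \<Rightarrow> (complex^'n) set \<Rightarrow> ('n two_form \<Rightarrow> complex) \<Rightarrow> bool"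
  where "harmonic_current \<A> M T \<longleftrightarrow> (\<forall>f\<in>leaf_functions \<A> M. T (ddc \<A> f) = 0)"


subsection \<open>Mass and Lelong number\<close>

text \<open>The positive measure \<open>T \<and> \<alpha>\<close> on \<open>M\<close>, for a positive form \<open>\<alpha>\<close>: the Radon measure that
  represents the positive linear form \<open>f \<mapsto> T(f\<alpha>)\<close>, given by the formulas of the Riesz representation
  theorem, namely the supremum over test functions \<open>0 \<le> f \<le> 1\<close> supported in \<open>V\<close> for an open set \<open>V\<close>,
  and outer regularity for other sets. The part of the set \<open>A\<close> outside \<open>M\<close> is disregarded.\<close>

definition wedge_measure_open :: "'n::finite flow_box set \<Rightarrow> ('n two_form \<Rightarrow> complex) \<Rightarrow> 'n two_form \<Rightarrow>
    (complex^'n) set \<Rightarrow> ennreal"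
  where "wedge_measure_open \<A> T \<alpha> V =
    (SUP f\<in>{f\<in>leaf_functions \<A> V. \<forall>z. f z \<in> of_real ` {0..1}}.
      ennreal (Re (T (\<lambda>p u v. f p * leaf_restrict \<A> \<alpha> p u v))))"

definition wedge_measure :: "'n::finite flow_box set \<Rightarrow> (complex^'n) set \<Rightarrow> ('n two_form \<Rightarrow> complex) \<Rightarrow>
    'n two_form \<Rightarrow> (complex^'n) set \<Rightarrow> ennreal"
  where "wedge_measure \<A> M T \<alpha> A =
    (INF V\<in>{V. open V \<and> A \<inter> M \<subseteq> V \<and> V \<subseteq> M}. wedge_measure_open \<A> T \<alpha> V)"

text \<open>\<open>\<beta> = (i/2) \<Sum>\<^sub>j dz\<^sub>j \<and> cnj dz\<^sub>j\<close>\<close>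

definition hermitian_form :: "'n::finite two_form"
  where "hermitian_form p u v = of_real (\<Sum>j\<in>UNIV. Im (cnj (u $ j) * v $ j))"

definition current_mass :: "'n::finite flow_box set \<Rightarrow> (complex^'n) set \<Rightarrow> ('n two_form \<Rightarrow> complex) \<Rightarrow>
    (complex^'n) set \<Rightarrow> ennreal"
  where "current_mass \<A> M T A = wedge_measure \<A> M T hermitian_form A"

text \<open>As the leaves are complex submanifolds, the restriction of \<open>dd\<^sup>c\<parallel>z\<parallel>\<^sup>2\<close> to the leaves is the
  leafwise \<open>dd\<^sup>c\<close> of the function \<open>\<parallel>z\<parallel>\<^sup>2\<close>.\<close>

definition lelong_number :: "'n::finite flow_box set \<Rightarrow> (complex^'n) set \<Rightarrow>
    ('n two_form \<Rightarrow> complex) \<Rightarrow> complex^'n \<Rightarrow> ennreal"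
  where "lelong_number \<A> M T x = Limsup (at_right 0) (\<lambda>r::real.
    wedge_measure \<A> M T (ddc \<A> (\<lambda>z. of_real ((norm z)\<^sup>2))) (ball x r) / ennreal (pi * r\<^sup>2))"


subsection \<open>The polydisc and the coordinate hyperplanes\<close>

definition polydisc :: "real \<Rightarrow> (complex^'n) set"
  where "polydisc r = {z. \<forall>j. cmod (z $ j) < r}"

definition coordinate_hyperplanes :: "(complex^'n) set"
  where "coordinate_hyperplanes = {z. \<exists>j. z $ j = 0}"


subsection \<open>The flow boxes of a linear vector field\<close>

lemma has_derivative_vecI:
  fixes f :: "'a::real_normed_vector \<Rightarrow> complex^'n"
  assumes "\<And>j. ((\<lambda>z. f z $ j) has_derivative (\<lambda>v. f' v $ j)) (at a within S)"
  shows "(f has_derivative f') (at a within S)"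
proof (subst has_derivative_componentwise_within, intro ballI)
  fix i :: "complex^'n" assume "i \<in> Basis"
  then obtain j b where i: "i = axis j b" "b \<in> Basis" by (auto simp: Basis_vec_def)
  have "((\<lambda>z. f z $ j \<bullet> b) has_derivative (\<lambda>v. f' v $ j \<bullet> b)) (at a within S)"
    by (intro has_derivative_inner_left assms)
  then show "((\<lambda>x. f x \<bullet> i) has_derivative (\<lambda>x. f' x \<bullet> i)) (at a within S)"
    by (simp add: i inner_axis)
qed

lemma transversal_part_linear:
  "bounded_linear (transversal_part k :: complex^'n \<Rightarrow> complex^'n)"
proof -
  have "linear (transversal_part k :: complex^'n \<Rightarrow> complex^'n)"
    by (rule linearI) (auto simp: transversal_part_def vec_eq_iff)
  then show ?thesis by (simp add: linear_linear)
qed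

lemma continuous_on_transversal_part [continuous_intros]:
  "continuous_on S f \<Longrightarrow> continuous_on S (\<lambda>x. transversal_part k (f x :: complex^'n))"
  by (rule bounded_linear.continuous_on[OF transversal_part_linear])

lemma open_flow_box_product:
  assumes "open B" "openin (top_of_set {t. t $ k = 0}) T"
  shows "open {w :: complex^'n. w $ k \<in> B \<and> transversal_part k w \<in> T}"
proof -
  obtain T' where T': "open T'" "T = {t. t $ k = 0} \<inter> T'"
    using assms(2) by (auto simp: openin_open)
  have "transversal_part k w $ k = 0" for w :: "complex^'n"
    by (simp add: transversal_part_def)
  then have eq: "{w. w $ k \<in> B \<and> transversal_part k w \<in> T} =
      (\<lambda>w. w $ k) -` B \<inter> (transversal_part k -` T')"
    by (auto simp: T')
  have "open ((\<lambda>w::complex^'n. w $ k) -` B)"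
    by (rule open_vimage[OF assms(1)]) (intro continuous_intros)
  moreover have "open (transversal_part k -` T' :: (complex^'n) set)"
    by (rule open_vimage[OF T'(1)]) (intro continuous_intros)
  ultimately show ?thesis unfolding eq by (rule open_Int)
qed

lemma is_flow_box_open_image: "is_flow_box M (U, \<phi>, k) \<Longrightarrow> open (\<phi> ` U)"
  unfolding is_flow_box_def prod.case by (elim conjE exE) (simp only: open_flow_box_product)

lemma holomorphic_map_on_has_derivative:
  "holomorphic_map_on f U \<Longrightarrow> z \<in> U \<Longrightarrow> (f has_derivative frechet_derivative f (at z)) (at z)"
  unfolding holomorphic_map_on_def using frechet_derivative_works by blast

lemma holomorphic_map_onI:
  assumes "\<And>z. z \<in> U \<Longrightarrow> (f has_derivative f' z) (at z)"
    and "\<And>z c v. z \<in> U \<Longrightarrow> f' z (c *s v) = c *s f' z v"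
  shows "holomorphic_map_on f U"
  unfolding holomorphic_map_on_def
proof (intro ballI conjI allI)
  fix z assume z: "z \<in> U"
  show "f differentiable at z" using assms(1)[OF z] by (auto simp: differentiable_def)
  have "frechet_derivative f (at z) = f' z" using assms(1)[OF z] frechet_derivative_at by metis
  then show "frechet_derivative f (at z) (c *s v) = c *s frechet_derivative f (at z) v" for c v
    using assms(2)[OF z] by simp
qed

lemma foliation_of_field_inverse_derivative:
  assumes "(U, \<phi>, k) \<in> foliation_of_field M X" "z \<in> U"
  shows "frechet_derivative (inv_into U \<phi>) (at (\<phi> z)) (axis k c) = c *s X z"
proof -
  let ?\<psi> = "inv_into U \<phi>"
  have b: "is_flow_box M (U, \<phi>, k)" and X: "frechet_derivative \<phi> (at z) (X z) = axis k 1"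
    using assms by (auto simp: foliation_of_field_def)
  then have U: "open U" "inj_on \<phi> U" and h: "holomorphic_map_on \<phi> U" "holomorphic_map_on ?\<psi> (\<phi> ` U)"
    by (auto simp: is_flow_box_def)
  have 1: "(\<phi> has_derivative frechet_derivative \<phi> (at z)) (at z)"
    using holomorphic_map_on_has_derivative[OF h(1)] assms by simp
  have 2: "(?\<psi> has_derivative frechet_derivative ?\<psi> (at (\<phi> z))) (at (\<phi> z))"
    using holomorphic_map_on_has_derivative[OF h(2)] assms by simp
  have "((\<lambda>z. z) has_derivative (\<lambda>v. frechet_derivative ?\<psi> (at (\<phi> z)) (frechet_derivative \<phi> (at z) v))) (at z)"
  proof (rule has_derivative_transform_within_open[OF _ U(1) assms(2)])
    show "((\<lambda>x. ?\<psi> (\<phi> x)) has_derivative (\<lambda>v. frechet_derivative ?\<psi> (at (\<phi> z)) (frechet_derivative \<phi> (at z) v))) (at z)"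
      using diff_chain_at[OF 1 2] by (simp add: o_def)
  qed (simp add: U(2))
  then have "(\<lambda>v. frechet_derivative ?\<psi> (at (\<phi> z)) (frechet_derivative \<phi> (at z) v)) = (\<lambda>v. v)"
    using has_derivative_unique has_derivative_ident by blast
  then have "frechet_derivative ?\<psi> (at (\<phi> z)) (axis k 1) = X z"
    using X by metis
  moreover have "axis k c = c *s axis k (1::complex)" by (simp add: vec_eq_iff axis_def)
  ultimately show ?thesis using h(2) assms(2) by (simp add: holomorphic_map_on_def)
qed

lemma foliation_of_field_transition:
  assumes b1: "(U, \<phi>, k) \<in> foliation_of_field M X" and b2: "(U', \<phi>', k') \<in> foliation_of_field M X"
    and z: "z \<in> U \<inter> U'"
  shows "\<exists>N. open N \<and> z \<in> N \<and> N \<subseteq> U \<inter> U' \<and>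
        (\<forall>z1\<in>N. \<forall>z2\<in>N. transversal_part k (\<phi> z1) = transversal_part k (\<phi> z2) \<longrightarrow>
           transversal_part k' (\<phi>' z1) = transversal_part k' (\<phi>' z2))"
proof -
  let ?\<psi> = "inv_into U \<phi>"
  from b1 b2 have fb: "is_flow_box M (U, \<phi>, k)" "is_flow_box M (U', \<phi>', k')"
    and X: "\<And>z. z \<in> U' \<Longrightarrow> frechet_derivative \<phi>' (at z) (X z) = axis k' 1"
    by (auto simp: foliation_of_field_def)
  then have U: "open U" "inj_on \<phi> U" "open U'" and h: "holomorphic_map_on \<phi> U" "holomorphic_map_on ?\<psi> (\<phi> ` U)"
      "holomorphic_map_on \<phi>' U'"
    by (auto simp: is_flow_box_def)
  have cont: "continuous_on (\<phi> ` U) ?\<psi>" "continuous_on U \<phi>"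
    using h by (auto intro!: continuous_at_imp_continuous_on differentiable_imp_continuous_within
        simp: holomorphic_map_on_def)
  have "open (?\<psi> -` U' \<inter> \<phi> ` U)"
    using cont(1) is_flow_box_open_image[OF fb(1)] U(3) by (simp add: continuous_on_open_vimage)
  moreover have "\<phi> z \<in> ?\<psi> -` U' \<inter> \<phi> ` U" using z U by auto
  ultimately obtain \<rho> where \<rho>: "\<rho> > 0" "ball (\<phi> z) \<rho> \<subseteq> ?\<psi> -` U' \<inter> \<phi> ` U"
    by (meson open_contains_ball)
  define N where "N = \<phi> -` ball (\<phi> z) \<rho> \<inter> U"
  have "open N" unfolding N_def using cont(2) U(1) by (simp add: continuous_on_open_vimage)
  moreover have "z \<in> N" using z \<rho> by (simp add: N_def)
  moreover have "N \<subseteq> U \<inter> U'"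
  proof
    fix x assume x: "x \<in> N"
    then have "\<phi> x \<in> ?\<psi> -` U'" using \<rho> by (auto simp: N_def)
    then show "x \<in> U \<inter> U'" using x U by (auto simp: N_def)
  qed
  moreover have "transversal_part k' (\<phi>' z1) = transversal_part k' (\<phi>' z2)"
    if zs: "z1 \<in> N" "z2 \<in> N" and eq: "transversal_part k (\<phi> z1) = transversal_part k (\<phi> z2)" for z1 z2
  proof -
    define c where "c = \<phi> z1 $ k - \<phi> z2 $ k"
    have d: "\<phi> z1 = \<phi> z2 + axis k c"
      using eq by (auto simp: vec_eq_iff transversal_part_def c_def axis_def) metis
    define p where "p s = \<phi> z2 + s *\<^sub>R axis k c" for s :: real
    have pin: "p s \<in> ball (\<phi> z) \<rho>" if "s \<in> {0..1}" for s
    proof -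
      have "p s = (1 - s) *\<^sub>R \<phi> z2 + s *\<^sub>R \<phi> z1"
        by (simp add: p_def d algebra_simps)
      moreover have "\<phi> z1 \<in> ball (\<phi> z) \<rho>" "\<phi> z2 \<in> ball (\<phi> z) \<rho>" using zs by (auto simp: N_def)
      ultimately show ?thesis using that convexD_alt[OF convex_ball] by (metis atLeastAtMost_iff)
    qed
    have "((\<lambda>s. transversal_part k' (\<phi>' (?\<psi> (p s)))) has_derivative (\<lambda>h. 0)) (at s within {0..1})"
      if s: "s \<in> {0..1}" for s
    proof -
      define x where "x = ?\<psi> (p s)"
      have ps: "p s \<in> \<phi> ` U" and xU': "x \<in> U'" using pin[OF s] \<rho> by (auto simp: x_def)
      then have x: "x \<in> U" "\<phi> x = p s" by (auto simp: x_def inv_into_into f_inv_into_f)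
      have 1: "(p has_derivative (\<lambda>h. h *\<^sub>R axis k c)) (at s)"
        unfolding p_def by (auto intro!: derivative_eq_intros)
      have 2: "(?\<psi> has_derivative frechet_derivative ?\<psi> (at (p s))) (at (p s))"
        using holomorphic_map_on_has_derivative[OF h(2)] ps by simp
      have 3: "(\<phi>' has_derivative frechet_derivative \<phi>' (at x)) (at (?\<psi> (p s)))"
        using holomorphic_map_on_has_derivative[OF h(3) xU'] by (simp add: x_def)
      have 4: "((\<lambda>s. \<phi>' (?\<psi> (p s))) has_derivative
          (\<lambda>h. frechet_derivative \<phi>' (at x) (frechet_derivative ?\<psi> (at (p s)) (h *\<^sub>R axis k c)))) (at s)"
        using diff_chain_at[OF diff_chain_at[OF 1 2], unfolded o_def, OF 3] by (simp add: o_def)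
      have "h *\<^sub>R axis k c = axis k (of_real h * c)" for h
        by (simp add: vec_eq_iff axis_def scaleR_conv_of_real[of _ c])
      then have "frechet_derivative \<phi>' (at x) (frechet_derivative ?\<psi> (at (p s)) (h *\<^sub>R axis k c)) =
          (of_real h * c) *s axis k' 1" for h
        using foliation_of_field_inverse_derivative[OF b1 x(1)] x(2) h(3) xU' X[OF xU']
        by (simp add: holomorphic_map_on_def)
      moreover have "transversal_part k' (a *s axis k' 1) = 0" for a
        by (simp add: transversal_part_def vec_eq_iff axis_def)
      ultimately show ?thesis
        using bounded_linear.has_derivative[OF transversal_part_linear 4, of k']
        by (auto intro: has_derivative_at_withinI)
    qed
    then obtain C where "\<And>s. s \<in> {0..1} \<Longrightarrow> transversal_part k' (\<phi>' (?\<psi> (p s))) = C"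
      using has_derivative_zero_constant[of "{0..1}" "\<lambda>s. transversal_part k' (\<phi>' (?\<psi> (p s)))",
          OF convex_real_interval(5)] by blast
    then have "transversal_part k' (\<phi>' (?\<psi> (p 0))) = transversal_part k' (\<phi>' (?\<psi> (p 1)))" by simp
    moreover have "p 0 = \<phi> z2" "p 1 = \<phi> z1" by (simp_all add: p_def d)
    ultimately show ?thesis using zs U by (simp add: N_def)
  qed
  ultimately show ?thesis by blast
qed

lemma foliation_of_field_covers:
  fixes lam p :: "complex^'n"
  assumes "open M" "p \<in> M" "\<And>z. z \<in> M \<Longrightarrow> \<forall>j. z $ j \<noteq> 0" "\<forall>j. lam $ j \<noteq> 0"
  shows "\<exists>b\<in>foliation_of_field M (linear_field lam). p \<in> fst b"
proof -
  fix k :: 'n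
  have p0: "p $ j \<noteq> 0" for j using assms by blast
  have l0: "lam $ k \<noteq> 0" using assms by blast
  define \<psi> :: "complex^'n \<Rightarrow> complex^'n" where
    "\<psi> w = (\<chi> j. if j = k then p $ k * exp (lam $ k * w $ k) else w $ j * exp (lam $ j * w $ k))" for w
  define y :: "complex^'n \<Rightarrow> complex" where "y z = Ln (z $ k / p $ k) / lam $ k" for z
  define \<phi> :: "complex^'n \<Rightarrow> complex^'n" where
    "\<phi> z = (\<chi> j. if j = k then y z else z $ j * exp (- (lam $ j * y z)))" for z
  define S where "S = {z :: complex^'n. z $ k / p $ k \<notin> \<real>\<^sub>\<le>\<^sub>0}"
  define \<psi>' :: "complex^'n \<Rightarrow> complex^'n \<Rightarrow> complex^'n" where
    "\<psi>' w v = (\<chi> j. if j = k then p $ k * (exp (lam $ k * w $ k) * (lam $ k * v $ k))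
       else v $ j * exp (lam $ j * w $ k) + w $ j * (exp (lam $ j * w $ k) * (lam $ j * v $ k)))" for w v
  define \<phi>' :: "complex^'n \<Rightarrow> complex^'n \<Rightarrow> complex^'n" where
    "\<phi>' z v = (\<chi> j. if j = k then v $ k / (z $ k * lam $ k)
       else v $ j * exp (- (lam $ j * y z)) -
         z $ j * (exp (- (lam $ j * y z)) * (lam $ j * (v $ k / (z $ k * lam $ k)))))" for z v
  have nth: "((\<lambda>z. z $ j) has_derivative (\<lambda>v. v $ j)) F" for j F
    by (rule bounded_linear_imp_has_derivative) (rule bounded_linear_vec_nth)
  have dexp: "(exp has_derivative (\<lambda>h. exp a * h)) (at a)" for a :: complex
    using DERIV_exp[of a] by (simp add: has_field_derivative_def)
  have d\<psi>: "(\<psi> has_derivative \<psi>' w) (at w)" for w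
  proof (rule has_derivative_vecI)
    fix j
    have "((\<lambda>w. exp (lam $ i * w $ k)) has_derivative (\<lambda>v. exp (lam $ i * w $ k) * (lam $ i * v $ k))) (at w)" for i
      using diff_chain_at[OF has_derivative_mult_right[OF nth[of k "at w"], of "lam $ i"] dexp]
      by (simp add: o_def)
    note e = this
    show "((\<lambda>z. \<psi> z $ j) has_derivative (\<lambda>v. \<psi>' w v $ j)) (at w)"
    proof (cases "j = k")
      case True
      then show ?thesis using has_derivative_mult_right[OF e[of k], of "p $ k"]
        by (simp add: \<psi>_def \<psi>'_def)
    next
      case False
      then show ?thesis using has_derivative_mult[OF nth[of j "at w"] e[of j]]
        by (simp add: \<psi>_def \<psi>'_def add.commute)
    qed
  qed
  have dy: "(y has_derivative (\<lambda>v. v $ k / (z $ k * lam $ k))) (at z)" if z: "z \<in> S" for z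
  proof -
    have zk: "z $ k / p $ k \<notin> \<real>\<^sub>\<le>\<^sub>0" using z by (simp add: S_def)
    then have zk0: "z $ k \<noteq> 0" by auto
    have "((\<lambda>z. z $ k / p $ k) has_derivative (\<lambda>v. v $ k / p $ k)) (at z)"
      using has_derivative_mult_right[OF nth[of k "at z"], of "1 / p $ k"] by simp
    moreover have "(Ln has_derivative (\<lambda>h. inverse (z $ k / p $ k) * h)) (at (z $ k / p $ k))"
      using has_field_derivative_Ln[OF zk] by (simp only: has_field_derivative_def)
    ultimately have "((\<lambda>z. Ln (z $ k / p $ k)) has_derivative
        (\<lambda>v. inverse (z $ k / p $ k) * (v $ k / p $ k))) (at z)"
      using diff_chain_at[of "\<lambda>z. z $ k / p $ k" _ z Ln] by (simp only: o_def)
    then have "((\<lambda>z. Ln (z $ k / p $ k)) has_derivative (\<lambda>v. v $ k / z $ k)) (at z)"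
      using p0[of k] zk0 by (simp add: field_simps)
    from has_derivative_mult_right[OF this, of "1 / lam $ k"]
    show ?thesis unfolding y_def by (simp add: field_simps)
  qed
  have d\<phi>: "(\<phi> has_derivative \<phi>' z) (at z)" if z: "z \<in> S" for z
  proof (rule has_derivative_vecI)
    fix j
    have "((\<lambda>z. - (lam $ i * y z)) has_derivative (\<lambda>v. - (lam $ i * (v $ k / (z $ k * lam $ k))))) (at z)" for i
      by (intro has_derivative_minus has_derivative_mult_right dy z)
    from diff_chain_at[OF this dexp]
    have e: "((\<lambda>z. exp (- (lam $ i * y z))) has_derivative
        (\<lambda>v. exp (- (lam $ i * y z)) * - (lam $ i * (v $ k / (z $ k * lam $ k))))) (at z)" for i
      by (simp add: o_def)
    show "((\<lambda>z. \<phi> z $ j) has_derivative (\<lambda>v. \<phi>' z v $ j)) (at z)"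
    proof (cases "j = k")
      case True then show ?thesis using dy[OF z] by (simp add: \<phi>_def \<phi>'_def)
    next
      case False
      then show ?thesis using has_derivative_mult[OF nth[of j "at z"] e[of j]]
        by (simp add: \<phi>_def \<phi>'_def algebra_simps)
    qed
  qed
  have oS: "open S"
  proof -
    have "S = (\<lambda>z. z $ k / p $ k) -` (- \<real>\<^sub>\<le>\<^sub>0)" by (auto simp: S_def)
    moreover have "open \<dots>"
      by (rule open_vimage) (auto simp: p0 intro!: continuous_intros)
    ultimately show ?thesis by simp
  qed
  define t0 where "t0 = transversal_part k p"
  have t0: "t0 $ k = 0" "\<psi> t0 = p" by (auto simp: t0_def transversal_part_def \<psi>_def vec_eq_iff)
  have c\<psi>: "continuous_on A \<psi>" for A
    using d\<psi> by (meson continuous_at_imp_continuous_on has_derivative_continuous)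
  have "open (\<psi> -` M)" using assms(1) c\<psi> by (rule open_vimage)
  then obtain \<rho> where \<rho>: "\<rho> > 0" "ball t0 \<rho> \<subseteq> \<psi> -` M"
    using t0 assms(2) by (metis open_contains_ball vimageI)
  define \<epsilon> where "\<epsilon> = min (\<rho> / 2) (pi / cmod (lam $ k))"
  have \<epsilon>: "\<epsilon> > 0" "\<epsilon> \<le> \<rho> / 2" "\<epsilon> * cmod (lam $ k) \<le> pi"
  proof -
    show "\<epsilon> > 0" using \<rho> l0 by (simp add: \<epsilon>_def)
    show "\<epsilon> \<le> \<rho> / 2" unfolding \<epsilon>_def by (rule min.cobounded1)
    have "\<epsilon> \<le> pi / cmod (lam $ k)" unfolding \<epsilon>_def by (rule min.cobounded2)
    then show "\<epsilon> * cmod (lam $ k) \<le> pi" using l0 by (simp add: field_simps)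
  qed
  define B where "B = ball (0::complex) \<epsilon>"
  define T where "T = {t. t $ k = 0} \<inter> ball t0 (\<rho> / 2)"
  define W where "W = {w. w $ k \<in> B \<and> transversal_part k w \<in> T}"
  have Wb: "W \<subseteq> \<psi> -` M"
  proof
    fix w assume w: "w \<in> W"
    have *: "w - transversal_part k w = axis k (w $ k)"
      by (simp add: vec_eq_iff transversal_part_def axis_def)
    have "dist (transversal_part k w) w = norm (axis k (w $ k))"
      by (simp only: dist_norm norm_minus_commute *[symmetric])
    also have "\<dots> = norm (w $ k)" by (simp add: norm_eq_sqrt_inner inner_axis_axis)
    finally have "dist t0 w \<le> dist t0 (transversal_part k w) + norm (w $ k)"
      using dist_triangle[of t0 w "transversal_part k w"] by simp
    also have "\<dots> < \<rho>" using w \<epsilon> by (auto simp: W_def T_def B_def)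
    finally show "w \<in> \<psi> -` M" using \<rho> by auto
  qed
  have left: "\<phi> (\<psi> w) = w \<and> \<psi> w \<in> S" if w: "w \<in> W" for w
  proof -
    have "cmod (lam $ k * w $ k) < pi"
    proof -
      have "cmod (lam $ k) * cmod (w $ k) < cmod (lam $ k) * \<epsilon>"
        using w l0 by (auto simp: W_def B_def)
      then show ?thesis using \<epsilon>(3) by (simp add: norm_mult mult.commute)
    qed
    then have im: "\<bar>Im (lam $ k * w $ k)\<bar> < pi" using abs_Im_le_cmod le_less_trans by blast
    then have yk: "y (\<psi> w) = w $ k"
      using p0[of k] l0 by (auto simp: y_def \<psi>_def intro!: Ln_exp)
    have "\<phi> (\<psi> w) = w"
      unfolding vec_eq_iff
    proof
      fix j show "\<phi> (\<psi> w) $ j = w $ j"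
        using yk by (cases "j = k") (simp_all add: \<phi>_def \<psi>_def exp_minus)
    qed
    moreover have "exp (lam $ k * w $ k) \<notin> \<real>\<^sub>\<le>\<^sub>0"
    proof
      assume *: "exp (lam $ k * w $ k) \<in> \<real>\<^sub>\<le>\<^sub>0"
      have "Ln (exp (lam $ k * w $ k)) = lam $ k * w $ k" using im by (intro Ln_exp) auto
      moreover have "exp (lam $ k * w $ k) \<noteq> 0" by simp
      ultimately have "Im (lam $ k * w $ k) = pi"
        using * Im_Ln_eq_pi[of "exp (lam $ k * w $ k)"]
        by (auto simp: complex_nonpos_Reals_iff complex_eq_iff)
      then show False using im by simp
    qed
    ultimately show ?thesis using p0[of k] by (simp add: S_def \<psi>_def)
  qed
  have right: "\<psi> (\<phi> z) = z" if z: "z \<in> S" for z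
  proof -
    have zk: "z $ k \<noteq> 0" using z by (auto simp: S_def)
    have "exp (lam $ k * y z) = z $ k / p $ k" using l0 zk p0[of k] by (simp add: y_def)
    then show ?thesis using p0[of k] by (simp add: \<phi>_def \<psi>_def vec_eq_iff exp_minus)
  qed
  define U where "U = \<phi> -` W \<inter> S"
  have oW: "open W" unfolding W_def
    by (rule open_flow_box_product) (auto simp: B_def T_def)
  have U: "open U"
  proof -
    have "continuous_on S \<phi>"
      using d\<phi> by (meson continuous_at_imp_continuous_on has_derivative_continuous)
    then show ?thesis unfolding U_def using oS oW by (simp add: continuous_on_open_vimage)
  qed
  have inj: "inj_on \<phi> U" using right by (metis U_def IntD2 inj_onI)
  have im: "\<phi> ` U = W" using left right by (force simp: U_def)
  have inv: "inv_into U \<phi> w = \<psi> w" if "w \<in> W" for w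
    using that left[OF that] by (intro inv_into_f_eq[OF inj]) (auto simp: U_def)
  have "holomorphic_map_on \<phi> U"
    by (rule holomorphic_map_onI[of _ _ \<phi>'])
       (auto simp: U_def d\<phi> \<phi>'_def vec_eq_iff algebra_simps)
  moreover have "holomorphic_map_on (inv_into U \<phi>) W"
  proof (rule holomorphic_map_onI[of _ _ \<psi>'])
    fix w assume w: "w \<in> W"
    show "(inv_into U \<phi> has_derivative \<psi>' w) (at w)"
      by (rule has_derivative_transform_within_open[OF d\<psi> oW w]) (simp add: inv)
  qed (auto simp: \<psi>'_def vec_eq_iff algebra_simps)
  moreover have "U \<subseteq> M" using Wb right by (force simp: U_def)
  moreover have "convex T" unfolding T_def
    by (intro convex_Int convex_ball) (auto simp: convex_def)
  moreover have "B \<noteq> {}" "t0 \<in> T" using \<epsilon> \<rho> t0 by (auto simp: B_def T_def)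
  moreover have "openin (top_of_set {t. t $ k = 0}) T" by (auto simp: T_def openin_open)
  ultimately have fb: "is_flow_box M (U, \<phi>, k)"
    using U inj im unfolding is_flow_box_def W_def
    by (auto intro!: exI[of _ B] exI[of _ T] convex_connected simp: B_def)
  have "frechet_derivative \<phi> (at z) (linear_field lam z) = axis k 1" if "z \<in> U" for z
  proof -
    have z: "z \<in> S" using that by (simp add: U_def)
    then have "z $ k \<noteq> 0" by (auto simp: S_def)
    then have "\<phi>' z (linear_field lam z) = axis k 1"
      using l0 by (simp add: \<phi>'_def linear_field_def vec_eq_iff axis_def)
    then show ?thesis using frechet_derivative_at[OF d\<phi>[OF z]] by simp
  qed
  then have "(U, \<phi>, k) \<in> foliation_of_field M (linear_field lam)"
    using fb by (simp add: foliation_of_field_def)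
  moreover have "p \<in> U"
  proof -
    have "transversal_part k t0 = t0" by (simp add: t0_def transversal_part_def vec_eq_iff)
    then have "t0 \<in> W" using t0(1) \<epsilon> \<rho> by (simp add: W_def B_def T_def)
    then show ?thesis using left[of t0] t0 by (auto simp: U_def)
  qed
  ultimately show ?thesis by force
qed

text \<open>The flow boxes used for the linear vector field do cover the complement of the coordinate
  hyperplanes and define a foliation on it.\<close>

lemma holomorphic_foliation_linear_field:
  fixes lam :: "complex^'n"
  assumes "\<forall>j. lam $ j \<noteq> 0"
  defines "M \<equiv> polydisc 1 - coordinate_hyperplanes"
  shows "holomorphic_foliation M
    (restrict_foliation (foliation_of_field (polydisc 1 - {0}) (linear_field lam)) M)"
proof -
  have "0 \<in> (coordinate_hyperplanes :: (complex^'n) set)" by (simp add: coordinate_hyperplanes_def)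
  then have "M \<subseteq> polydisc 1 - {0}" by (auto simp: M_def)
  then have eq: "restrict_foliation (foliation_of_field (polydisc 1 - {0}) (linear_field lam)) M =
      foliation_of_field M (linear_field lam)"
    by (auto simp: restrict_foliation_def foliation_of_field_def is_flow_box_def)
  have "M = (\<Inter>j. {z. cmod (z $ j) < 1} \<inter> {z. z $ j \<noteq> 0})"
    by (auto simp: M_def polydisc_def coordinate_hyperplanes_def)
  moreover have "open \<dots>"
    by (intro open_INT open_Int open_Collect_less open_Collect_neq ballI continuous_intros) auto
  ultimately have oM: "open M" by simp
  have nz: "\<forall>j. z $ j \<noteq> 0" if "z \<in> M" for z
    using that by (simp add: M_def coordinate_hyperplanes_def)
  let ?A = "foliation_of_field M (linear_field lam)"
  have fb: "is_flow_box M b" if "b \<in> ?A" for b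
    using that by (cases b) (simp add: foliation_of_field_def)
  have sub: "fst b \<subseteq> M" if "b \<in> ?A" for b
    using fb[OF that] by (cases b) (simp add: is_flow_box_def)
  have "M = (\<Union>b\<in>?A. fst b)"
  proof (rule equalityI; rule subsetI)
    fix p assume p: "p \<in> M"
    obtain b where "b \<in> ?A" "p \<in> fst b"
      using foliation_of_field_covers[OF oM p nz assms(1)] by blast
    then show "p \<in> (\<Union>b\<in>?A. fst b)" by blast
  next
    fix p assume "p \<in> (\<Union>b\<in>?A. fst b)"
    then show "p \<in> M" using sub by blast
  qed
  then show ?thesis unfolding eq holomorphic_foliation_def
    using fb
    by (intro conjI) (blast, assumption, (rule ballI, clarify, rule foliation_of_field_transition, auto))
qed

end

theory Submission
  imports Defs
begin

text \<open>
  Write X for the linear field and L for the Laplacian along the leaves in complex time. A positive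
  harmonic directed current T amounts to the positive functional I(u) = T(u dA), where dA is the area
  form of complex time, and I(Lu) = 0 for compactly supported u. The mass of T is the integral of
  |X|^2, and both statements follow from a suitable choice of u.

  (1) The functions log |z_j| are harmonic and |z|^2 is subharmonic on the leaves, with
  L |z|^2 = 4 |X|^2. Let u be a convex increasing function, zero on the negative numbers, of
  |z|^2 + eps (log |z_1| + ... + log |z_n|) minus a cutoff near the boundary of the polydisc. Then u has
  compact support outside the hyperplanes, and I(Lu) = 0 bounds the mass inside by the mass near the
  boundary, uniformly in eps.

  (2) Let U = log (B / (|z - x|^2 + rho^2)) / 2, so that - LU is at least a multiple of |X|^2 / rho^2 on the
  ball of radius rho. Let H be the harmonic mean of U and of a superharmonic function W that is at
  least log (1 / rho) on this ball but tends to 0 locally uniformly outside the hyperplanes as rho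
  tends to 0. Testing I against H bounds the mass of the ball divided by rho^2 by the integral of |X|^2
  times a bounded function that also tends to 0 locally uniformly; as the mass is finite, this
  integral tends to 0. At the origin one takes W = R^(1 - 2a) (log |z_k| log |z_l|)^a with
  R = log (1 / rho), which is superharmonic for some a > 1/2 precisely because the ratio of the two
  eigenvalues is not real.
\<close>

subsection \<open>Smooth functions of one real variable\<close>

text \<open>Only |X|^2 dA is known to have finite mass; the area dA may be infinite near the origin,
  where X vanishes. This shapes part (2). A cutoff with compact support off the hyperplanes contains
  eps times the sum of the - log |z_j|, whose gradient has constant length, so it costs eps^2 times
  an area that is only known to be O(eps^-2): bounded, but not small. Hence H involves a third
  function V, at least 1 on the support of the given test function and at most kappa + C |X|^2 near
  x. Small kappa controls the area part, then small eps the rest. At the origin V is the real part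
  of a leafwise holomorphic function that decays at the hyperplanes. At other points |X| is bounded
  below, V = 1 suffices, and W is (log |z_i|)^2 corrected by a multiple of |z - x|^2 and divided by
  R. The product of H with a cutoff also creates a mixed gradient term. Testing with H + sqrt H
  instead of H lets the concavity of the root absorb it. Locally uniform convergence is used without
  measure theory: some test function u0 almost attains the supremum of the mass, and W becomes small
  on its support.\<close>

definition real_smooth_on :: "real set \<Rightarrow> (real \<Rightarrow> real) \<Rightarrow> bool" where
  "real_smooth_on A h \<longleftrightarrow>
    (\<exists>H. H 0 = h \<and> (\<forall>n. \<forall>x\<in>A. (H n has_real_derivative H (Suc n) x) (at x)))"

lemma real_smooth_on_ln: "real_smooth_on {0<..} ln"
proof -
  define H :: "nat \<Rightarrow> real \<Rightarrow> real" where
    "H n x = (case n of 0 \<Rightarrow> ln x | Suc m \<Rightarrow> (- 1) ^ m * fact m * inverse (x ^ Suc m))" for n x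
  have "(H n has_real_derivative H (Suc n) x) (at x)" if "x > 0" for n x
  proof (cases n)
    case 0
    then have "H n = ln" by (simp add: H_def fun_eq_iff)
    then show ?thesis using that 0 DERIV_ln_divide[of x] by (simp add: H_def inverse_eq_divide)
  next
    case (Suc m)
    have "((\<lambda>x. x ^ Suc m) has_real_derivative real (Suc m) * x ^ m) (at x)"
      using DERIV_pow[of "Suc m" x] by simp
    from DERIV_cmult[OF DERIV_inverse_fun[OF this], of "(- 1) ^ m * fact m"]
    have "((\<lambda>x. (- 1) ^ m * fact m * inverse (x ^ Suc m)) has_real_derivative
        (- 1) ^ m * fact m * - (real (Suc m) * x ^ m * inverse ((x ^ Suc m) ^ Suc (Suc 0)))) (at x)"
      using that by simp
    moreover have "(- 1) ^ m * fact m * - (real (Suc m) * x ^ m * inverse ((x ^ Suc m) ^ Suc (Suc 0))) = H (Suc n) x"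
      using that by (simp add: Suc H_def field_simps)
    moreover have "H n = (\<lambda>x. (- 1) ^ m * fact m * inverse (x ^ Suc m))"
      by (simp add: Suc H_def fun_eq_iff)
    ultimately show ?thesis by metis
  qed
  moreover have "H 0 = ln" by (simp add: H_def fun_eq_iff)
  ultimately show ?thesis unfolding real_smooth_on_def by (intro exI[of _ H]) auto
qed

lemma real_smooth_on_powr: "real_smooth_on {0<..} (\<lambda>x. x powr a)"
proof -
  define H :: "nat \<Rightarrow> real \<Rightarrow> real" where "H n x = (\<Prod>i<n. a - real i) * x powr (a - real n)" for n x
  have "(H n has_real_derivative H (Suc n) x) (at x)" if "x > 0" for n x
    unfolding H_def using that
    by (auto intro!: derivative_eq_intros simp: field_simps)
  moreover have "H 0 = (\<lambda>x. x powr a)" by (simp add: H_def fun_eq_iff)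
  ultimately show ?thesis unfolding real_smooth_on_def by (intro exI[of _ H]) auto
qed

section \<open>Smooth functions vanishing on the negative axis\<close>

definition flat_exp :: "real poly \<Rightarrow> real \<Rightarrow> real" where
  "flat_exp p x = (if x \<le> 0 then 0 else x * poly p (1 / x) * exp (- (1 / x)))"

text \<open>With \<open>t = 1 / x\<close> the class \<open>x * p(t) * exp (- t)\<close> is stable
  under d/dx, since dt/dx = - t^2: the new polynomial is t p - t^2 p' + t^2 p. Smoothness at 0 then
  reduces to one limit, that of \<open>p(t) * exp (- t)\<close> at infinity, for all
  \<open>p\<close> at once.\<close>

definition flat_exp_deriv :: "real poly \<Rightarrow> real poly" where
  "flat_exp_deriv p = pCons 0 p - pCons 0 (pCons 0 (pderiv p)) + pCons 0 (pCons 0 p)"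

lemma poly_times_exp_tendsto_0: "((\<lambda>t::real. poly p t * exp (- t)) \<longlongrightarrow> 0) at_top"
proof -
  have "((\<lambda>t. \<Sum>i\<le>degree p. coeff p i * (t ^ i / exp t)) \<longlongrightarrow> (\<Sum>i\<le>degree p. coeff p i * 0)) at_top"
    by (intro tendsto_sum tendsto_mult tendsto_const tendsto_power_div_exp_0)
  then show ?thesis
    by (simp add: poly_altdef exp_minus divide_inverse sum_distrib_right mult.assoc)
qed

lemma flat_exp_has_derivative:
  "(flat_exp p has_real_derivative flat_exp (flat_exp_deriv p) x) (at x)"
proof -
  consider "x < 0" | "x = 0" | "x > 0" by linarith
  then show ?thesis
  proof cases
    case 1
    have "((\<lambda>x. 0) has_real_derivative flat_exp (flat_exp_deriv p) x) (at x)"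
      using 1 by (simp add: flat_exp_def)
    then show ?thesis
      by (rule has_field_derivative_transform_within_open[of _ _ _ "{..<0}"])
         (use 1 in \<open>auto simp: flat_exp_def\<close>)
  next
    case 2
    have "((\<lambda>h. poly p (inverse h) * exp (- inverse h)) \<longlongrightarrow> 0) (at_right 0)"
      by (rule filterlim_compose[OF poly_times_exp_tendsto_0 filterlim_inverse_at_top_right])
    then have "((\<lambda>h. (flat_exp p (0 + h) - flat_exp p 0) / h) \<longlongrightarrow> 0) (at_right 0)"
      by (rule Lim_transform_eventually)
         (auto simp: eventually_at_right_field flat_exp_def inverse_eq_divide intro!: exI[of _ 1])
    moreover have "((\<lambda>h. (flat_exp p (0 + h) - flat_exp p 0) / h) \<longlongrightarrow> 0) (at_left 0)"
      by (rule Lim_transform_eventually[OF tendsto_const])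
         (auto simp: eventually_at_left_field flat_exp_def intro!: exI[of _ "-1"])
    ultimately show ?thesis
      using 2 by (auto simp: DERIV_def flat_exp_def filterlim_split_at_real)
  next
    case 3
    have p: "((\<lambda>x. poly p (1 / x)) has_real_derivative poly (pderiv p) (1 / x) * (- (1 / x\<^sup>2))) (at x)"
      using 3 by (auto intro!: derivative_eq_intros DERIV_chain'[OF _ poly_DERIV] simp: power2_eq_square)
    have e: "((\<lambda>x. exp (- (1 / x))) has_real_derivative exp (- (1 / x)) * (1 / x\<^sup>2)) (at x)"
      using 3 by (auto intro!: derivative_eq_intros simp: power2_eq_square)
    have "((\<lambda>x. x * poly p (1 / x) * exp (- (1 / x))) has_real_derivative
        (1 * poly p (1 / x) + poly (pderiv p) (1 / x) * (- (1 / x\<^sup>2)) * x) * exp (- (1 / x)) +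
        exp (- (1 / x)) * (1 / x\<^sup>2) * (x * poly p (1 / x))) (at x)"
      by (rule DERIV_mult[OF DERIV_mult[OF DERIV_ident p] e])
    moreover have "(1 * poly p (1 / x) + poly (pderiv p) (1 / x) * (- (1 / x\<^sup>2)) * x) * exp (- (1 / x)) +
        exp (- (1 / x)) * (1 / x\<^sup>2) * (x * poly p (1 / x)) = flat_exp (flat_exp_deriv p) x"
      using 3 by (simp add: flat_exp_def flat_exp_deriv_def field_simps power2_eq_square)
    ultimately have "((\<lambda>x. x * poly p (1 / x) * exp (- (1 / x))) has_real_derivative
        flat_exp (flat_exp_deriv p) x) (at x)"
      by simp
    then show ?thesis
      by (rule has_field_derivative_transform_within_open[of _ _ _ "{0<..}"])
         (use 3 in \<open>auto simp: flat_exp_def\<close>)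
  qed
qed

lemma real_smooth_on_flat_exp: "real_smooth_on A (flat_exp p)"
  unfolding real_smooth_on_def
  by (rule exI[of _ "\<lambda>n. flat_exp ((flat_exp_deriv ^^ n) p)"])
     (simp add: flat_exp_has_derivative)

text \<open>A smooth convex version of the positive part, with slope at most 1. As it vanishes on
  the negative axis, composing it with a smooth function that is positive only on a compact set
  gives a test function.\<close>

definition hinge :: "real \<Rightarrow> real" where "hinge x = flat_exp 1 x"
definition hinge' :: "real \<Rightarrow> real" where "hinge' x = flat_exp [:0, 1, 1:] x"
definition hinge'' :: "real \<Rightarrow> real" where "hinge'' x = flat_exp [:0, 0, 0, 0, 1:] x"

lemma hinge_DERIV: "(hinge has_real_derivative hinge' x) (at x)"
  and hinge'_DERIV: "(hinge' has_real_derivative hinge'' x) (at x)"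
proof -
  have 1: "flat_exp_deriv 1 = [:0, 1, 1:]"
    by (simp add: flat_exp_deriv_def one_pCons pderiv_pCons)
  have 2: "flat_exp_deriv [:0, 1, 1:] = [:0, 0, 0, 0, 1:]"
    by (simp add: flat_exp_deriv_def pderiv_pCons)
  show "(hinge has_real_derivative hinge' x) (at x)"
    using flat_exp_has_derivative[of 1 x] unfolding hinge'_def 1
    by (simp add: hinge_def[abs_def])
  show "(hinge' has_real_derivative hinge'' x) (at x)"
    using flat_exp_has_derivative[of "[:0, 1, 1:]" x] unfolding hinge''_def 2
    by (simp add: hinge'_def[abs_def])
qed

lemma real_smooth_on_hinge: "real_smooth_on A hinge" "real_smooth_on A hinge'" "real_smooth_on A hinge''"
  unfolding hinge_def[abs_def] hinge'_def[abs_def] hinge''_def[abs_def]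
  by (rule real_smooth_on_flat_exp)+

lemma hinge_nonpos [simp]: "x \<le> 0 \<Longrightarrow> hinge x = 0" "x \<le> 0 \<Longrightarrow> hinge' x = 0" "x \<le> 0 \<Longrightarrow> hinge'' x = 0"
  by (simp_all add: hinge_def hinge'_def hinge''_def flat_exp_def)

lemma hinge_pos:
  assumes "x > 0"
  shows "hinge x = x * exp (- (1 / x))" "hinge' x = (1 + 1 / x) * exp (- (1 / x))"
    "hinge'' x = exp (- (1 / x)) / x ^ 3"
  using assms by (simp_all add: hinge_def hinge'_def hinge''_def flat_exp_def field_simps power3_eq_cube)

lemma hinge_ge_0 [simp]: "0 \<le> hinge x" "0 \<le> hinge' x" "0 \<le> hinge'' x"
  by (cases "x > 0"; simp add: hinge_pos)+

lemma hinge_mono: "x \<le> y \<Longrightarrow> hinge x \<le> hinge y" "x \<le> y \<Longrightarrow> hinge' x \<le> hinge' y"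
  using DERIV_nonneg_imp_nondecreasing hinge_DERIV hinge'_DERIV hinge_ge_0 by (metis)+

lemma hinge_le: "x \<ge> 0 \<Longrightarrow> hinge x \<le> x"
  by (cases "x > 0") (simp_all add: hinge_pos)

lemma hinge_gt_0: "x > 0 \<Longrightarrow> hinge x > 0" "x > 0 \<Longrightarrow> hinge' x > 0" "x > 0 \<Longrightarrow> hinge'' x > 0"
  by (simp_all add: hinge_pos add_pos_pos)

lemma hinge'_le_1: "hinge' x \<le> 1"
proof (cases "x > 0")
  case True
  have "1 + 1 / x \<le> exp (1 / x)" by (rule exp_ge_add_one_self)
  then show ?thesis using True by (simp add: hinge_pos exp_minus field_simps)
qed simp

subsection \<open>Leafwise differential calculus\<close>

definition punctured_polydisc :: "(complex^'n) set" where
  "punctured_polydisc = {z. \<forall>j. 0 < cmod (z $ j) \<and> cmod (z $ j) < 1}"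

lemma open_punctured_polydisc: "open (punctured_polydisc :: (complex^'n) set)"
proof -
  have "punctured_polydisc = (\<Inter>j. {z::complex^'n. 0 < cmod (z $ j)} \<inter> {z. cmod (z $ j) < 1})"
    by (auto simp: punctured_polydisc_def)
  moreover have "open \<dots>"
    by (intro open_INT open_Int open_Collect_less ballI continuous_intros) auto
  ultimately show ?thesis by (simp only:)
qed

locale linear_foliation =
  fixes lam :: "complex^'n"
  assumes lam_nz: "lam $ j \<noteq> 0"
begin

abbreviation M :: "(complex^'n) set" where "M \<equiv> punctured_polydisc"

definition flow :: "complex \<Rightarrow> complex^'n \<Rightarrow> complex^'n" where
  "flow t z = (\<chi> j. z $ j * exp (lam $ j * t))"

text \<open>The directions \<open>d = 1\<close> and \<open>d = \<i>\<close> give the partial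
  derivatives in complex time, which is a coordinate common to all leaves. No flow box enters the
  calculus until currents are translated into functionals.\<close>

definition leaf_deriv :: "complex \<Rightarrow> (complex^'n \<Rightarrow> real) \<Rightarrow> complex^'n \<Rightarrow> real" where
  "leaf_deriv d u z = deriv (\<lambda>s::real. u (flow (of_real s * d) z)) 0"

abbreviation has_leaf_deriv :: "complex \<Rightarrow> (complex^'n \<Rightarrow> real) \<Rightarrow> real \<Rightarrow> complex^'n \<Rightarrow> bool" where
  "has_leaf_deriv d u a z \<equiv> ((\<lambda>s::real. u (flow (of_real s * d) z)) has_real_derivative a) (at 0)"

definition leaf_smooth :: "(complex^'n \<Rightarrow> real) \<Rightarrow> bool" where
  "leaf_smooth u \<longleftrightarrow> (\<forall>ds\<in>lists {1, \<i>}. continuous_on M (foldr leaf_deriv ds u) \<and>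
    (\<forall>d\<in>{1, \<i>}. \<forall>z\<in>M. \<exists>a. has_leaf_deriv d (foldr leaf_deriv ds u) a z))"

lemma flow_0 [simp]: "flow 0 z = z"
  by (simp add: flow_def vec_eq_iff)

lemma isCont_flow: "isCont (\<lambda>s::real. flow (of_real s * d) z) s"
  unfolding isCont_def flow_def by (rule vec_tendstoI) (auto intro!: tendsto_intros)

lemma eventually_flow_in:
  assumes "open V" "z \<in> V"
  shows "eventually (\<lambda>s::real. flow (of_real s * d) z \<in> V) (nhds 0)"
proof -
  have "((\<lambda>s::real. flow (of_real s * d) z) \<longlongrightarrow> flow (of_real (0::real) * d) z) (nhds 0)"
    using isCont_flow[where d = d and z = z and s = 0] unfolding isCont_def
    by (rule tendsto_at_iff_tendsto_nhds[where g = "\<lambda>s::real. flow (of_real s * d) z", THEN iffD1])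
  then show ?thesis using assms by (auto dest: topological_tendstoD)
qed

text \<open>\<open>M\<close> is open, so the flow from a point of \<open>M\<close> stays in
  \<open>M\<close> for small times, and derivatives see only the values on \<open>M\<close>. All
  later identities can therefore be restricted to \<open>M\<close>, whatever the logarithms are
  elsewhere.\<close>

lemma has_leaf_deriv_cong:
  assumes "\<And>z. z \<in> M \<Longrightarrow> u z = v z" "z \<in> M"
  shows "has_leaf_deriv d u a z \<longleftrightarrow> has_leaf_deriv d v a z"
proof (rule DERIV_cong_ev)
  show "\<forall>\<^sub>F s in nhds 0. u (flow (of_real s * d) z) = v (flow (of_real s * d) z)"
    using eventually_flow_in[OF open_punctured_polydisc assms(2), of d]
    by eventually_elim (simp add: assms(1))
qed simp_all

lemma leaf_derivI: "has_leaf_deriv d u a z \<Longrightarrow> leaf_deriv d u z = a"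
  unfolding leaf_deriv_def by (rule DERIV_imp_deriv)

lemma leaf_deriv_cong:
  assumes "\<And>z. z \<in> M \<Longrightarrow> u z = v z" "z \<in> M"
  shows "leaf_deriv d u z = leaf_deriv d v z"
  unfolding leaf_deriv_def deriv_def using has_leaf_deriv_cong[of u v, OF assms] by simp

lemma foldr_leaf_deriv_cong:
  assumes "\<And>z. z \<in> M \<Longrightarrow> u z = v z" "z \<in> M"
  shows "foldr leaf_deriv ds u z = foldr leaf_deriv ds v z"
  using assms(2)
proof (induction ds arbitrary: z)
  case (Cons d ds)
  then show ?case using leaf_deriv_cong[of "foldr leaf_deriv ds u" "foldr leaf_deriv ds v" z d] by simp
qed (use assms in simp)

lemma leaf_smooth_cong:
  assumes "\<And>z. z \<in> M \<Longrightarrow> u z = v z" "leaf_smooth v"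
  shows "leaf_smooth u"
proof -
  have eq: "foldr leaf_deriv ds u z = foldr leaf_deriv ds v z" if "z \<in> M" for ds z
    using foldr_leaf_deriv_cong[of u v] assms(1) that by blast
  have "continuous_on M (foldr leaf_deriv ds u) \<longleftrightarrow> continuous_on M (foldr leaf_deriv ds v)" for ds
    by (rule continuous_on_cong) (simp_all add: eq)
  moreover have "has_leaf_deriv d (foldr leaf_deriv ds u) a z \<longleftrightarrow> has_leaf_deriv d (foldr leaf_deriv ds v) a z"
    if "z \<in> M" for d ds a z
    by (rule has_leaf_deriv_cong[OF eq that])
  ultimately show ?thesis using assms(2) unfolding leaf_smooth_def by simp
qed

text \<open>By induction on the list of directions, every iterated derivative agrees on
  \<open>M\<close> with a member of \<open>S\<close>. Smoothness thus needs one derivative step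
  inside a stable class and no formula for higher derivatives.\<close>

lemma leaf_smooth_coinduct:
  assumes "S u"
    and "\<And>u. S u \<Longrightarrow> continuous_on M u"
    and "\<And>u d. S u \<Longrightarrow> d \<in> {1, \<i>} \<Longrightarrow> \<exists>u'. S u' \<and> (\<forall>z\<in>M. has_leaf_deriv d u (u' z) z)"
  shows "leaf_smooth u"
proof -
  have ex: "\<exists>v. S v \<and> (\<forall>z\<in>M. foldr leaf_deriv ds u z = v z)" if "ds \<in> lists {1, \<i>}" for ds
    using that
  proof induction
    case Nil
    then show ?case using assms(1) by auto
  next
    case (Cons d ds)
    then obtain v v' where v: "S v" "\<forall>z\<in>M. foldr leaf_deriv ds u z = v z"
      "S v'" "\<forall>z\<in>M. has_leaf_deriv d v (v' z) z"
      using assms(3) by metis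
    have "foldr leaf_deriv (d # ds) u z = v' z" if "z \<in> M" for z
      using leaf_deriv_cong[of "foldr leaf_deriv ds u" v z d] leaf_derivI v that by simp
    then show ?case using v by blast
  qed
  show ?thesis unfolding leaf_smooth_def
  proof (intro ballI conjI)
    fix ds :: "complex list" assume "ds \<in> lists {1, \<i>}"
    from ex[OF this] obtain v where "S v" "\<forall>z\<in>M. foldr leaf_deriv ds u z = v z" by blast
    then have v: "S v" "\<And>z. z \<in> M \<Longrightarrow> foldr leaf_deriv ds u z = v z" by simp_all
    show "continuous_on M (foldr leaf_deriv ds u)"
      using assms(2)[OF v(1)] by (rule continuous_on_cong[THEN iffD1, rotated 2]) (simp_all add: v(2))
    fix d z assume d: "d \<in> {1, \<i>}" and z: "z \<in> M"
    obtain v' where "\<forall>z\<in>M. has_leaf_deriv d v (v' z) z" using assms(3)[OF v(1) d] by blast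
    then show "\<exists>a. has_leaf_deriv d (foldr leaf_deriv ds u) a z"
      using has_leaf_deriv_cong[of "foldr leaf_deriv ds u" v, OF v(2) z] z by blast
  qed
qed

lemma leaf_smooth_has_leaf_deriv:
  assumes "leaf_smooth u" "d \<in> {1, \<i>}" "z \<in> M"
  shows "has_leaf_deriv d u (leaf_deriv d u z) z"
proof -
  have "\<exists>a. has_leaf_deriv d (foldr leaf_deriv [] u) a z"
    using assms unfolding leaf_smooth_def by blast
  then show ?thesis using leaf_derivI by auto
qed

lemma leaf_smooth_continuous_on: "leaf_smooth u \<Longrightarrow> continuous_on M u"
  unfolding leaf_smooth_def using lists.Nil by fastforce

lemma leaf_smooth_leaf_deriv:
  assumes "leaf_smooth u" "d \<in> {1, \<i>}"
  shows "leaf_smooth (leaf_deriv d u)"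
  unfolding leaf_smooth_def
proof
  fix ds :: "complex list" assume "ds \<in> lists {1, \<i>}"
  then have "ds @ [d] \<in> lists {1, \<i>}" using assms by auto
  from assms(1)[unfolded leaf_smooth_def, rule_format, OF this] show "continuous_on M (foldr leaf_deriv ds (leaf_deriv d u)) \<and>
    (\<forall>d'\<in>{1, \<i>}. \<forall>z\<in>M. \<exists>a. has_leaf_deriv d' (foldr leaf_deriv ds (leaf_deriv d u)) a z)"
    by simp
qed

text \<open>The closure properties of the leafwise smooth functions follow by coinduction from those of
  this class, which is visibly stable under leafwise differentiation.\<close>

inductive leaf_smooth_gen :: "(complex^'n \<Rightarrow> real) \<Rightarrow> bool" where
  base: "leaf_smooth u \<Longrightarrow> leaf_smooth_gen u"
| const: "leaf_smooth_gen (\<lambda>z. c)"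
| add: "leaf_smooth_gen u \<Longrightarrow> leaf_smooth_gen v \<Longrightarrow> leaf_smooth_gen (\<lambda>z. u z + v z)"
| mult: "leaf_smooth_gen u \<Longrightarrow> leaf_smooth_gen v \<Longrightarrow> leaf_smooth_gen (\<lambda>z. u z * v z)"
| comp: "leaf_smooth_gen u \<Longrightarrow> (\<And>n z. z \<in> M \<Longrightarrow> (H n has_real_derivative H (Suc n) (u z)) (at (u z))) \<Longrightarrow>
    leaf_smooth_gen (\<lambda>z. H (0::nat) (u z))"

lemma leaf_smooth_gen_continuous: "leaf_smooth_gen u \<Longrightarrow> continuous_on M u"
proof (induction rule: leaf_smooth_gen.induct)
  case (comp u H)
  have "continuous_on (u ` M) (H 0)"
    using comp.hyps(2) by (auto intro!: continuous_at_imp_continuous_on DERIV_isCont)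
  then show ?case using continuous_on_compose[OF comp.IH, of "H 0"] by (simp add: o_def)
qed (auto intro: leaf_smooth_continuous_on continuous_intros)

lemma leaf_smooth_gen_deriv:
  "leaf_smooth_gen u \<Longrightarrow> d \<in> {1, \<i>} \<Longrightarrow>
    \<exists>u'. leaf_smooth_gen u' \<and> (\<forall>z\<in>M. has_leaf_deriv d u (u' z) z)"
proof (induction rule: leaf_smooth_gen.induct)
  case (base u)
  then show ?case
    using leaf_smooth_has_leaf_deriv leaf_smooth_leaf_deriv leaf_smooth_gen.base by blast
next
  case (const c)
  show ?case by (rule exI[of _ "\<lambda>z. 0"]) (simp add: leaf_smooth_gen.const)
next
  case (add u v)
  then obtain u' v' where "leaf_smooth_gen u'" "\<forall>z\<in>M. has_leaf_deriv d u (u' z) z"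
    "leaf_smooth_gen v'" "\<forall>z\<in>M. has_leaf_deriv d v (v' z) z" by blast
  then show ?case
    by (intro exI[of _ "\<lambda>z. u' z + v' z"]) (auto intro: leaf_smooth_gen.add DERIV_add)
next
  case (mult u v)
  then obtain u' v' where *: "leaf_smooth_gen u'" "\<forall>z\<in>M. has_leaf_deriv d u (u' z) z"
    "leaf_smooth_gen v'" "\<forall>z\<in>M. has_leaf_deriv d v (v' z) z" by blast
  have "has_leaf_deriv d (\<lambda>z. u z * v z) (u' z * v z + v' z * u z) z" if "z \<in> M" for z
    using DERIV_mult[of "\<lambda>s. u (flow (of_real s * d) z)" "u' z" 0 UNIV
        "\<lambda>s. v (flow (of_real s * d) z)" "v' z"] * that by simp
  then show ?case using * mult.hyps
    by (intro exI[of _ "\<lambda>z. u' z * v z + v' z * u z"])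
       (auto intro: leaf_smooth_gen.add leaf_smooth_gen.mult)
next
  case (comp u H)
  then obtain u' where *: "leaf_smooth_gen u'" "\<forall>z\<in>M. has_leaf_deriv d u (u' z) z" by blast
  have "has_leaf_deriv d (\<lambda>z. H 0 (u z)) (H 1 (u z) * u' z) z" if "z \<in> M" for z
    using DERIV_chain2[of "H 0" "H 1 (u z)" "\<lambda>s. u (flow (of_real s * d) z)" 0 "u' z"] * that
      comp.hyps(2)[of z 0] by simp
  moreover have "leaf_smooth_gen (\<lambda>z. H 1 (u z))"
    using leaf_smooth_gen.comp[of u "\<lambda>n. H (Suc n)"] comp.hyps by simp
  ultimately show ?case using *
    by (intro exI[of _ "\<lambda>z. H 1 (u z) * u' z"]) (auto intro: leaf_smooth_gen.mult)
qed

lemma leaf_smooth_gen_iff: "leaf_smooth_gen u \<longleftrightarrow> leaf_smooth u"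
proof
  assume "leaf_smooth_gen u"
  then show "leaf_smooth u"
    by (rule leaf_smooth_coinduct[of leaf_smooth_gen])
       (simp_all only: leaf_smooth_gen_continuous leaf_smooth_gen_deriv)
qed (rule leaf_smooth_gen.base)

lemma leaf_smooth_const [simp]: "leaf_smooth (\<lambda>z. c)"
  and leaf_smooth_add: "leaf_smooth u \<Longrightarrow> leaf_smooth v \<Longrightarrow> leaf_smooth (\<lambda>z. u z + v z)"
  and leaf_smooth_mult: "leaf_smooth u \<Longrightarrow> leaf_smooth v \<Longrightarrow> leaf_smooth (\<lambda>z. u z * v z)"
  using leaf_smooth_gen.const[of c] leaf_smooth_gen.add[of u v] leaf_smooth_gen.mult[of u v]
  unfolding leaf_smooth_gen_iff by blast+

lemma leaf_smooth_compose:
  assumes "real_smooth_on A h" "leaf_smooth u" "\<And>z. z \<in> M \<Longrightarrow> u z \<in> A"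
  shows "leaf_smooth (\<lambda>z. h (u z))"
proof -
  obtain H where H: "H 0 = h" "\<And>n x. x \<in> A \<Longrightarrow> (H n has_real_derivative H (Suc n) x) (at x)"
    using assms(1) unfolding real_smooth_on_def by blast
  show ?thesis
    using leaf_smooth_gen.comp[of u H, unfolded leaf_smooth_gen_iff, OF assms(2) H(2)[OF assms(3)]]
    by (simp add: H(1))
qed

lemma leaf_smooth_minus: "leaf_smooth u \<Longrightarrow> leaf_smooth (\<lambda>z. - u z)"
  using leaf_smooth_mult[OF leaf_smooth_const[of "-1"], of u] by simp

lemma leaf_smooth_diff: "leaf_smooth u \<Longrightarrow> leaf_smooth v \<Longrightarrow> leaf_smooth (\<lambda>z. u z - v z)"
  using leaf_smooth_add[OF _ leaf_smooth_minus, of u v] by simp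

lemma leaf_smooth_sum:
  "(\<And>i. i \<in> A \<Longrightarrow> leaf_smooth (u i)) \<Longrightarrow> leaf_smooth (\<lambda>z. \<Sum>i\<in>A. u i z)"
  by (induction A rule: infinite_finite_induct) (simp_all add: leaf_smooth_add)

lemma leaf_smooth_ln: "leaf_smooth u \<Longrightarrow> (\<And>z. z \<in> M \<Longrightarrow> u z > 0) \<Longrightarrow> leaf_smooth (\<lambda>z. ln (u z))"
  by (rule leaf_smooth_compose[OF real_smooth_on_ln]) auto

lemma leaf_smooth_powr:
  "leaf_smooth u \<Longrightarrow> (\<And>z. z \<in> M \<Longrightarrow> u z > 0) \<Longrightarrow> leaf_smooth (\<lambda>z. u z powr a)"
  by (rule leaf_smooth_compose[OF real_smooth_on_powr]) auto

lemma leaf_smooth_inverse: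
  assumes "leaf_smooth u" "\<And>z. z \<in> M \<Longrightarrow> u z > 0"
  shows "leaf_smooth (\<lambda>z. inverse (u z))"
proof (rule leaf_smooth_cong)
  show "leaf_smooth (\<lambda>z. u z powr - 1)" by (rule leaf_smooth_powr[OF assms])
  show "inverse (u z) = u z powr - 1" if "z \<in> M" for z
    using assms(2)[OF that] by (simp add: powr_minus)
qed

lemma leaf_smooth_hinge:
  "leaf_smooth u \<Longrightarrow> leaf_smooth (\<lambda>z. hinge (u z))"
  "leaf_smooth u \<Longrightarrow> leaf_smooth (\<lambda>z. hinge' (u z))"
  "leaf_smooth u \<Longrightarrow> leaf_smooth (\<lambda>z. hinge'' (u z))"
  using leaf_smooth_compose[OF real_smooth_on_hinge(1)[of UNIV], of u]
    leaf_smooth_compose[OF real_smooth_on_hinge(2)[of UNIV], of u]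
    leaf_smooth_compose[OF real_smooth_on_hinge(3)[of UNIV], of u] by simp_all

lemmas leaf_smooth_intros = leaf_smooth_const leaf_smooth_add leaf_smooth_mult leaf_smooth_minus
  leaf_smooth_diff leaf_smooth_sum leaf_smooth_hinge leaf_smooth_leaf_deriv

lemma has_leaf_deriv_linear: "has_leaf_deriv d (\<lambda>z. Re (c * z $ j)) (Re (c * d * lam $ j * z $ j)) z"
proof -
  have "((\<lambda>x. c * (z $ j * exp (lam $ j * (x * d)))) has_field_derivative c * d * lam $ j * z $ j) (at (of_real 0))"
    by (rule derivative_eq_intros refl | simp)+
  then have "((\<lambda>s::real. c * (z $ j * exp (lam $ j * (of_real s * d)))) has_vector_derivative c * d * lam $ j * z $ j) (at 0)"
    by (rule has_vector_derivative_real_field)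
  from bounded_linear.has_vector_derivative[OF bounded_linear_Re this]
  show ?thesis
    by (simp add: flow_def has_real_derivative_iff_has_vector_derivative)
qed

text \<open>A derivative in direction \<open>d\<close> only multiplies \<open>c\<close> by
  \<open>d * lam $ j\<close>, so the functions of this shape, with varying \<open>c\<close>, form a
  stable class.\<close>

lemma leaf_smooth_linear: "leaf_smooth (\<lambda>z. Re (c * z $ j))"
proof (rule leaf_smooth_coinduct[of "\<lambda>u. \<exists>c. u = (\<lambda>z. Re (c * z $ j))"])
  fix u d assume "\<exists>c. u = (\<lambda>z. Re (c * z $ j))"
  then obtain c where "u = (\<lambda>z. Re (c * z $ j))" by blast
  then show "\<exists>u'. (\<exists>c. u' = (\<lambda>z. Re (c * z $ j))) \<and> (\<forall>z\<in>M. has_leaf_deriv d u (u' z) z)"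
    using has_leaf_deriv_linear[where c = c and d = d]
    by (intro exI[of _ "\<lambda>z. Re (c * d * lam $ j * z $ j)"] exI[of _ "c * d * lam $ j"] conjI refl)
       (simp only: simp_thms Ball_def)
qed (auto intro!: continuous_intros)

text \<open>Along the flow log |z_j| is affine in time, with a slope that is the same on all
  leaves.\<close>

lemma has_leaf_deriv_ln_cmod:
  assumes "z \<in> M"
  shows "has_leaf_deriv d (\<lambda>z. ln (cmod (z $ j))) (Re (lam $ j * d)) z"
proof -
  have "z $ j \<noteq> 0" using assms by (auto simp: punctured_polydisc_def)
  then have "(\<lambda>s::real. ln (cmod (flow (of_real s * d) z $ j))) = (\<lambda>s. ln (cmod (z $ j)) + s * Re (lam $ j * d))"
    by (simp add: flow_def norm_mult ln_mult fun_eq_iff algebra_simps)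
  moreover have "((\<lambda>s. ln (cmod (z $ j)) + s * Re (lam $ j * d)) has_real_derivative Re (lam $ j * d)) (at 0)"
    by (auto intro!: derivative_eq_intros)
  ultimately show ?thesis by simp
qed

lemma leaf_smooth_ln_cmod: "leaf_smooth (\<lambda>z. ln (cmod (z $ j)))"
proof (rule leaf_smooth_coinduct[of "\<lambda>u. u = (\<lambda>z. ln (cmod (z $ j))) \<or> (\<exists>c. u = (\<lambda>z. c))"])
  fix u d assume "u = (\<lambda>z. ln (cmod (z $ j))) \<or> (\<exists>c. u = (\<lambda>z. c))"
  then show "\<exists>u'. (u' = (\<lambda>z. ln (cmod (z $ j))) \<or> (\<exists>c. u' = (\<lambda>z. c))) \<and> (\<forall>z\<in>M. has_leaf_deriv d u (u' z) z)"
  proof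
    assume u: "u = (\<lambda>z. ln (cmod (z $ j)))"
    show ?thesis unfolding u
      by (rule exI[of _ "\<lambda>z. Re (lam $ j * d)"], rule conjI[OF disjI2[OF exI[of _ "Re (lam $ j * d)"]]])
         (rule refl, rule ballI, rule has_leaf_deriv_ln_cmod)
  next
    assume "\<exists>c. u = (\<lambda>z. c)"
    then show ?thesis by (intro exI[of _ "\<lambda>z. 0"]) auto
  qed
next
  fix u :: "complex^'n \<Rightarrow> real" assume "u = (\<lambda>z. ln (cmod (z $ j))) \<or> (\<exists>c. u = (\<lambda>z. c))"
  then show "continuous_on M u"
    by (auto intro!: continuous_intros simp: punctured_polydisc_def)
qed simp

end

section \<open>The leafwise Laplacian and gradient\<close>

context linear_foliation
begin

definition lap :: "(complex^'n \<Rightarrow> real) \<Rightarrow> complex^'n \<Rightarrow> real" where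
  "lap u z = leaf_deriv 1 (leaf_deriv 1 u) z + leaf_deriv \<i> (leaf_deriv \<i> u) z"

definition grad_prod :: "(complex^'n \<Rightarrow> real) \<Rightarrow> (complex^'n \<Rightarrow> real) \<Rightarrow> complex^'n \<Rightarrow> real" where
  "grad_prod u v z = leaf_deriv 1 u z * leaf_deriv 1 v z + leaf_deriv \<i> u z * leaf_deriv \<i> v z"

lemma leaf_smooth_lap: "leaf_smooth u \<Longrightarrow> leaf_smooth (lap u)"
  unfolding lap_def by (intro leaf_smooth_intros) auto

lemma leaf_smooth_grad_prod: "leaf_smooth u \<Longrightarrow> leaf_smooth v \<Longrightarrow> leaf_smooth (grad_prod u v)"
  unfolding grad_prod_def by (intro leaf_smooth_intros) auto

context
  fixes u v :: "complex^'n \<Rightarrow> real" and d :: complex and z :: "complex^'n"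
  assumes uv: "leaf_smooth u" "leaf_smooth v" and d: "d \<in> {1, \<i>}" and z: "z \<in> M"
begin

lemma leaf_deriv_const [simp]: "leaf_deriv d (\<lambda>z. c) z = 0"
  by (rule leaf_derivI) simp

lemma leaf_deriv_add: "leaf_deriv d (\<lambda>z. u z + v z) z = leaf_deriv d u z + leaf_deriv d v z"
  by (intro leaf_derivI DERIV_add leaf_smooth_has_leaf_deriv uv d z)

lemma leaf_deriv_mult:
  "leaf_deriv d (\<lambda>z. u z * v z) z = leaf_deriv d u z * v z + leaf_deriv d v z * u z"
  using DERIV_mult[OF leaf_smooth_has_leaf_deriv[OF uv(1) d z] leaf_smooth_has_leaf_deriv[OF uv(2) d z]]
  by (intro leaf_derivI) simp

lemma leaf_deriv_compose:
  assumes "(h has_real_derivative h') (at (u z))"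
  shows "leaf_deriv d (\<lambda>z. h (u z)) z = h' * leaf_deriv d u z"
proof (rule leaf_derivI)
  have "(h has_real_derivative h') (at (u (flow (of_real 0 * d) z)))" using assms by simp
  from DERIV_chain2[OF this leaf_smooth_has_leaf_deriv[OF uv(1) d z]]
  show "has_leaf_deriv d (\<lambda>z. h (u z)) (h' * leaf_deriv d u z) z" .
qed

end

lemma leaf_deriv_sum:
  assumes "\<And>i. i \<in> A \<Longrightarrow> leaf_smooth (u i)" "d \<in> {1, \<i>}" "z \<in> M"
  shows "leaf_deriv d (\<lambda>z. \<Sum>i\<in>A. u i z) z = (\<Sum>i\<in>A. leaf_deriv d (u i) z)"
  by (intro leaf_derivI DERIV_sum leaf_smooth_has_leaf_deriv assms)

lemma leaf_deriv_cmult: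
  assumes "leaf_smooth u" "d \<in> {1, \<i>}" "z \<in> M"
  shows "leaf_deriv d (\<lambda>z. c * u z) z = c * leaf_deriv d u z"
  by (intro leaf_derivI DERIV_cmult leaf_smooth_has_leaf_deriv assms)

lemma leaf_deriv_linear: "leaf_deriv d (\<lambda>z. Re (c * z $ j)) z = Re (c * d * lam $ j * z $ j)"
  by (rule leaf_derivI[OF has_leaf_deriv_linear])

lemma leaf_deriv_ln_cmod: "z \<in> M \<Longrightarrow> leaf_deriv d (\<lambda>z. ln (cmod (z $ j))) z = Re (lam $ j * d)"
  by (rule leaf_derivI[OF has_leaf_deriv_ln_cmod])

lemma lap_const [simp]: "z \<in> M \<Longrightarrow> lap (\<lambda>z. c) z = 0"
  unfolding lap_def
  using leaf_deriv_cong[of "leaf_deriv d (\<lambda>z. c)" "\<lambda>z. 0" z d for d]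
  by (simp add: leaf_deriv_const[OF leaf_smooth_const leaf_smooth_const])

lemma lap_add:
  assumes "leaf_smooth u" "leaf_smooth v" "z \<in> M"
  shows "lap (\<lambda>z. u z + v z) z = lap u z + lap v z"
proof -
  have "leaf_deriv d (leaf_deriv d (\<lambda>z. u z + v z)) z =
      leaf_deriv d (leaf_deriv d u) z + leaf_deriv d (leaf_deriv d v) z" if d: "d \<in> {1, \<i>}" for d
    using leaf_deriv_cong[of "leaf_deriv d (\<lambda>z. u z + v z)" "\<lambda>z. leaf_deriv d u z + leaf_deriv d v z" z d]
      leaf_deriv_add[OF leaf_smooth_leaf_deriv[OF assms(1) d] leaf_smooth_leaf_deriv[OF assms(2) d] d assms(3)]
      leaf_deriv_add[OF assms(1,2) d] assms(3) by simp
  then show ?thesis by (simp add: lap_def)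
qed

lemma lap_cmult:
  assumes "leaf_smooth u" "z \<in> M"
  shows "lap (\<lambda>z. c * u z) z = c * lap u z"
proof -
  have "leaf_deriv d (leaf_deriv d (\<lambda>z. c * u z)) z = c * leaf_deriv d (leaf_deriv d u) z"
    if d: "d \<in> {1, \<i>}" for d
    using leaf_deriv_cong[of "leaf_deriv d (\<lambda>z. c * u z)" "\<lambda>z. c * leaf_deriv d u z" z d]
      leaf_deriv_cmult[OF leaf_smooth_leaf_deriv[OF assms(1) d] d assms(2)]
      leaf_deriv_cmult[OF assms(1) d] assms(2) by simp
  then show ?thesis by (simp add: lap_def distrib_left)
qed

lemma lap_mult:
  assumes "leaf_smooth u" "leaf_smooth v" "z \<in> M"
  shows "lap (\<lambda>z. u z * v z) z = u z * lap v z + v z * lap u z + 2 * grad_prod u v z"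
proof -
  have "leaf_deriv d (leaf_deriv d (\<lambda>z. u z * v z)) z =
      u z * leaf_deriv d (leaf_deriv d v) z + v z * leaf_deriv d (leaf_deriv d u) z +
      2 * (leaf_deriv d u z * leaf_deriv d v z)" if d: "d \<in> {1, \<i>}" for d
  proof -
    note u' = leaf_smooth_leaf_deriv[OF assms(1) d] and v' = leaf_smooth_leaf_deriv[OF assms(2) d]
    have "leaf_deriv d (leaf_deriv d (\<lambda>z. u z * v z)) z =
        leaf_deriv d (\<lambda>z. leaf_deriv d u z * v z + leaf_deriv d v z * u z) z"
      by (rule leaf_deriv_cong[OF _ assms(3)]) (rule leaf_deriv_mult[OF assms(1,2) d])
    also have "\<dots> = leaf_deriv d (\<lambda>z. leaf_deriv d u z * v z) z + leaf_deriv d (\<lambda>z. leaf_deriv d v z * u z) z"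
      by (rule leaf_deriv_add) (intro leaf_smooth_mult assms u' v' d)+
    finally show ?thesis
      by (simp add: leaf_deriv_mult[OF u' assms(2) d assms(3)] leaf_deriv_mult[OF v' assms(1) d assms(3)])
  qed
  then show ?thesis by (simp add: lap_def grad_prod_def algebra_simps)
qed

lemma lap_compose:
  assumes "leaf_smooth u" "z \<in> M"
    and "\<And>z. z \<in> M \<Longrightarrow> (h has_real_derivative h' (u z)) (at (u z))"
    and "(h' has_real_derivative h'') (at (u z))"
  shows "lap (\<lambda>z. h (u z)) z = h' (u z) * lap u z + h'' * grad_prod u u z"
proof -
  have "leaf_deriv d (leaf_deriv d (\<lambda>z. h (u z))) z =
      h' (u z) * leaf_deriv d (leaf_deriv d u) z + h'' * (leaf_deriv d u z * leaf_deriv d u z)"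
    if d: "d \<in> {1, \<i>}" for d
  proof -
    note u' = leaf_smooth_leaf_deriv[OF assms(1) d]
    have "leaf_deriv d (leaf_deriv d (\<lambda>z. h (u z))) z = leaf_deriv d (\<lambda>z. h' (u z) * leaf_deriv d u z) z"
      by (rule leaf_deriv_cong[OF _ assms(2)]) (rule leaf_deriv_compose[OF assms(1) assms(1) d _ assms(3)])
    also have "\<dots> = h' (u z) * leaf_deriv d (leaf_deriv d u) z + h'' * (leaf_deriv d u z * leaf_deriv d u z)"
    proof (rule leaf_derivI)
      have "(h' has_real_derivative h'') (at (u (flow (of_real 0 * d) z)))" using assms(4) by simp
      from DERIV_mult[OF DERIV_chain2[OF this leaf_smooth_has_leaf_deriv[OF assms(1) d assms(2)]]
          leaf_smooth_has_leaf_deriv[OF u' d assms(2)]]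
      show "has_leaf_deriv d (\<lambda>z. h' (u z) * leaf_deriv d u z)
        (h' (u z) * leaf_deriv d (leaf_deriv d u) z + h'' * (leaf_deriv d u z * leaf_deriv d u z)) z"
        by (simp add: algebra_simps)
    qed
    finally show ?thesis .
  qed
  then show ?thesis by (simp add: lap_def grad_prod_def algebra_simps)
qed

lemma lap_sum:
  assumes "\<And>i. i \<in> A \<Longrightarrow> leaf_smooth (u i)" "z \<in> M" "finite A"
  shows "lap (\<lambda>z. \<Sum>i\<in>A. u i z) z = (\<Sum>i\<in>A. lap (u i) z)"
  using assms(3,1)
  by (induction A rule: finite_induct) (simp_all add: assms(2) lap_add leaf_smooth_sum)

lemma lap_ln_cmod: "z \<in> M \<Longrightarrow> lap (\<lambda>z. ln (cmod (z $ j))) z = 0"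
proof -
  assume z: "z \<in> M"
  have "leaf_deriv d (leaf_deriv d (\<lambda>z. ln (cmod (z $ j)))) z = 0" if "d \<in> {1, \<i>}" for d
    using leaf_deriv_cong[of "leaf_deriv d (\<lambda>z. ln (cmod (z $ j)))" "\<lambda>z. Re (lam $ j * d)" z d]
      leaf_deriv_ln_cmod[of _ d j] leaf_deriv_const[OF leaf_smooth_const leaf_smooth_const that z] z by simp
  then show ?thesis by (simp add: lap_def)
qed

lemma lap_linear: "lap (\<lambda>z. Re (c * z $ j)) z = 0"
proof -
  have e: "leaf_deriv d (\<lambda>z. Re (c * z $ j)) = (\<lambda>z. Re ((c * d * lam $ j) * z $ j))" for c d
    by (rule ext) (rule leaf_deriv_linear)
  show ?thesis unfolding lap_def e by (simp add: algebra_simps)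
qed

lemma grad_prod_ge_0: "0 \<le> grad_prod u u z"
  by (simp add: grad_prod_def)

lemma leaf_deriv_diff_const:
  assumes "leaf_smooth u" "d \<in> {1, \<i>}" "z \<in> M"
  shows "leaf_deriv d (\<lambda>z. u z - c) z = leaf_deriv d u z"
  using leaf_deriv_add[OF assms(1) leaf_smooth_const[of "- c"] assms(2,3)]
    leaf_deriv_const[OF leaf_smooth_const leaf_smooth_const assms(2,3)] by simp

lemma lap_diff_const:
  assumes "leaf_smooth u" "z \<in> M"
  shows "lap (\<lambda>z. u z - c) z = lap u z"
  using lap_add[OF assms(1) leaf_smooth_const[of "- c"] assms(2)] assms(2) by simp

definition sq_dist :: "complex^'n \<Rightarrow> 'n \<Rightarrow> complex^'n \<Rightarrow> real" where
  "sq_dist x j z = (cmod (z $ j - x $ j))\<^sup>2"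

text \<open>The squares of the real and the imaginary part, both written as
  \<open>Re (c * z $ j)\<close> with \<open>c = 1\<close> and \<open>c = - \<i>\<close>, so that the
  product rule and the rules for linear functions apply.\<close>

lemma sq_dist_eq:
  "sq_dist x j = (\<lambda>z. (Re (1 * z $ j) - Re (x $ j)) * (Re (1 * z $ j) - Re (x $ j)) +
     (Re (- \<i> * z $ j) - Im (x $ j)) * (Re (- \<i> * z $ j) - Im (x $ j)))"
  by (simp add: sq_dist_def fun_eq_iff cmod_power2 flip: power2_eq_square)

lemma leaf_smooth_sq_dist: "leaf_smooth (sq_dist x j)"
  unfolding sq_dist_eq by (intro leaf_smooth_intros leaf_smooth_linear)

lemma leaf_deriv_sq_dist:
  assumes "d \<in> {1, \<i>}" "z \<in> M"
  shows "leaf_deriv d (sq_dist x j) z = 2 * Re (cnj (z $ j - x $ j) * (d * lam $ j * z $ j))"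
  unfolding sq_dist_eq
  by (subst leaf_deriv_add leaf_deriv_mult leaf_deriv_diff_const leaf_deriv_linear;
      (intro leaf_smooth_intros leaf_smooth_linear assms)?)+
     (simp add: algebra_simps)

lemma lap_sq_dist:
  assumes "z \<in> M"
  shows "lap (sq_dist x j) z = 4 * (cmod (lam $ j * z $ j))\<^sup>2"
proof -
  have *: "lap (\<lambda>z. (Re (c * z $ j) - a) * (Re (c * z $ j) - a)) z = 2 * (cmod (c * lam $ j * z $ j))\<^sup>2" for c a
  proof -
    have s: "leaf_smooth (\<lambda>z. Re (c * z $ j) - a)" by (intro leaf_smooth_intros leaf_smooth_linear)
    define w where "w = c * lam $ j * z $ j"
    have D: "leaf_deriv d (\<lambda>z. Re (c * z $ j) - a) z = Re (d * w)" if "d \<in> {1, \<i>}" for d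
      by (subst leaf_deriv_diff_const[OF leaf_smooth_linear that assms])
         (simp only: leaf_deriv_linear w_def mult_ac)
    have "leaf_deriv 1 (\<lambda>z. Re (c * z $ j) - a) z = Re w" "leaf_deriv \<i> (\<lambda>z. Re (c * z $ j) - a) z = - Im w"
      using D[of 1] D[of \<i>] by simp_all
    then show ?thesis
      unfolding lap_mult[OF s s assms] lap_diff_const[OF leaf_smooth_linear assms] lap_linear
        grad_prod_def cmod_power2 w_def[symmetric] by (simp add: power2_eq_square)
  qed
  have "lap (sq_dist x j) z = 2 * (cmod (1 * lam $ j * z $ j))\<^sup>2 + 2 * (cmod (- \<i> * lam $ j * z $ j))\<^sup>2"
    unfolding sq_dist_eq by (subst lap_add, (intro leaf_smooth_intros leaf_smooth_linear assms)+) (simp only: *)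
  then show ?thesis by (simp add: norm_mult)
qed

end

subsection \<open>Superharmonic functions\<close>

context linear_foliation
begin

definition hmean :: "(complex^'n \<Rightarrow> real) \<Rightarrow> (complex^'n \<Rightarrow> real) \<Rightarrow> complex^'n \<Rightarrow> real" where
  "hmean u v z = inverse (inverse (u z) + inverse (v z))"

lemma lap_inverse:
  assumes "leaf_smooth u" "\<And>z. z \<in> M \<Longrightarrow> u z > 0" "z \<in> M"
  shows "lap (\<lambda>z. inverse (u z)) z = - lap u z / (u z)\<^sup>2 + 2 * grad_prod u u z / (u z) ^ 3"
proof -
  have 1: "(inverse has_real_derivative - (inverse (u z ^ 2))) (at (u z))" if "z \<in> M" for z
    using DERIV_inverse[of "u z"] assms(2)[OF that] by (simp add: power2_eq_square numeral_2_eq_2)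
  have "((\<lambda>x. - inverse (x ^ 2)) has_real_derivative 2 / u z ^ 3) (at (u z))"
    using assms(2)[OF assms(3)]
    by (auto intro!: derivative_eq_intros simp: field_simps power2_eq_square power3_eq_cube)
  from lap_compose[of u z inverse, OF assms(1,3) 1 this]
  show ?thesis by (simp add: divide_inverse mult_ac)
qed

lemma leaf_deriv_inverse:
  assumes "leaf_smooth u" "\<And>z. z \<in> M \<Longrightarrow> u z > 0" "z \<in> M" "d \<in> {1, \<i>}"
  shows "leaf_deriv d (\<lambda>z. inverse (u z)) z = - leaf_deriv d u z / (u z)\<^sup>2"
proof -
  have 1: "(inverse has_real_derivative - (inverse (u z ^ 2))) (at (u z))"
    using DERIV_inverse[of "u z"] assms(2)[OF assms(3)] by (simp add: power2_eq_square numeral_2_eq_2)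
  show ?thesis
    using leaf_deriv_compose[OF assms(1,1,4,3) 1] by (simp add: divide_inverse mult_ac)
qed

lemma hmean_pos: "u z > 0 \<Longrightarrow> v z > 0 \<Longrightarrow> hmean u v z > 0"
  by (simp add: hmean_def add_pos_pos)

lemma hmean_le: "u z > 0 \<Longrightarrow> v z > 0 \<Longrightarrow> hmean u v z \<le> u z" "u z > 0 \<Longrightarrow> v z > 0 \<Longrightarrow> hmean u v z \<le> v z"
  unfolding hmean_def by (simp_all add: field_simps)

lemma leaf_smooth_hmean:
  assumes "leaf_smooth u" "leaf_smooth v" "\<And>z. z \<in> M \<Longrightarrow> u z > 0" "\<And>z. z \<in> M \<Longrightarrow> v z > 0"
  shows "leaf_smooth (hmean u v)"
  unfolding hmean_def
  by (intro leaf_smooth_inverse leaf_smooth_add assms) (simp_all add: add_pos_pos assms)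

text \<open>Cauchy-Schwarz for the vectors (a / x^(3/2), b / y^(3/2)) and (x^(-1/2), y^(-1/2)); the
  defect is computed explicitly.\<close>

lemma weighted_square_le:
  fixes a b x y :: real
  assumes "x > 0" "y > 0"
  shows "(a / x\<^sup>2 + b / y\<^sup>2)\<^sup>2 \<le> (a\<^sup>2 / x ^ 3 + b\<^sup>2 / y ^ 3) * (inverse x + inverse y)"
proof -
  have "(a\<^sup>2 / x ^ 3 + b\<^sup>2 / y ^ 3) * (inverse x + inverse y) - (a / x\<^sup>2 + b / y\<^sup>2)\<^sup>2 =
      (a * y - b * x)\<^sup>2 / (x * y) ^ 3"
    using assms by (simp add: field_simps power2_eq_square power3_eq_cube)
  moreover have "\<dots> \<ge> 0" using assms by simp
  ultimately show ?thesis by linarith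
qed

text \<open>The harmonic mean is a smooth substitute for the minimum: being concave and increasing in both
  arguments, it preserves superharmonicity.\<close>

lemma lap_hmean_le:
  assumes u: "leaf_smooth u" "\<And>z. z \<in> M \<Longrightarrow> u z > 0"
    and v: "leaf_smooth v" "\<And>z. z \<in> M \<Longrightarrow> v z > 0" and z: "z \<in> M"
  shows "lap (hmean u v) z \<le> (hmean u v z / u z)\<^sup>2 * lap u z + (hmean u v z / v z)\<^sup>2 * lap v z"
proof -
  define J where "J z = inverse (u z) + inverse (v z)" for z
  have pos: "u z > 0" "v z > 0" using u v z by auto
  have iu: "leaf_smooth (\<lambda>z. inverse (u z))" and iv: "leaf_smooth (\<lambda>z. inverse (v z))"
    by (intro leaf_smooth_inverse u v; assumption)+
  have J: "leaf_smooth J" "\<And>z. z \<in> M \<Longrightarrow> J z > 0" "J z > 0"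
    using u v pos unfolding J_def by (auto intro!: leaf_smooth_add iu iv add_pos_pos)
  have lapJ: "lap J z = - lap u z / (u z)\<^sup>2 + 2 * grad_prod u u z / (u z) ^ 3 +
      (- lap v z / (v z)\<^sup>2 + 2 * grad_prod v v z / (v z) ^ 3)"
    using lap_add[OF iu iv z] lap_inverse[OF u z] lap_inverse[OF v z] by (simp add: J_def[abs_def])
  have dJ: "(leaf_deriv d J z)\<^sup>2 \<le> ((leaf_deriv d u z)\<^sup>2 / u z ^ 3 + (leaf_deriv d v z)\<^sup>2 / v z ^ 3) * J z"
    if d: "d \<in> {1, \<i>}" for d
  proof -
    have "leaf_deriv d J z = - (leaf_deriv d u z / (u z)\<^sup>2 + leaf_deriv d v z / (v z)\<^sup>2)"
      using leaf_deriv_add[OF iu iv d z] leaf_deriv_inverse[OF u z d] leaf_deriv_inverse[OF v z d]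
      by (simp add: J_def[abs_def])
    then show ?thesis
      using weighted_square_le[OF pos, of "leaf_deriv d u z" "leaf_deriv d v z"] by (simp only: power2_minus J_def)
  qed
  have "grad_prod J J z \<le> (grad_prod u u z / u z ^ 3 + grad_prod v v z / v z ^ 3) * J z"
    using dJ[of 1] dJ[of \<i>] unfolding grad_prod_def
    by (simp add: algebra_simps add_divide_distrib flip: power2_eq_square)
  then have "2 * grad_prod J J z / J z ^ 3 \<le>
      2 * ((grad_prod u u z / u z ^ 3 + grad_prod v v z / v z ^ 3) * J z) / J z ^ 3"
    using J(3) by (intro divide_right_mono mult_left_mono) auto
  also have "\<dots> = 2 * (grad_prod u u z / u z ^ 3 + grad_prod v v z / v z ^ 3) / (J z)\<^sup>2"
    using J(3) by (simp add: power2_eq_square power3_eq_cube)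
  finally have G: "2 * grad_prod J J z / J z ^ 3 \<le>
      2 * (grad_prod u u z / u z ^ 3 + grad_prod v v z / v z ^ 3) / (J z)\<^sup>2" .
  have H: "hmean u v = (\<lambda>z. inverse (J z))" by (simp add: fun_eq_iff hmean_def J_def)
  have "lap (hmean u v) z = - lap J z / (J z)\<^sup>2 + 2 * grad_prod J J z / J z ^ 3"
    unfolding H by (rule lap_inverse[OF J(1,2) z])
  also have "\<dots> \<le> - lap J z / (J z)\<^sup>2 + 2 * (grad_prod u u z / u z ^ 3 + grad_prod v v z / v z ^ 3) / (J z)\<^sup>2"
    using G by simp
  \<comment> \<open>The gradient terms inside \<open>lap J\<close> cancel exactly against the
    Cauchy-Schwarz bound, and only the two Laplacians remain.\<close>
  also have "\<dots> = (lap u z / (u z)\<^sup>2 + lap v z / (v z)\<^sup>2) / (J z)\<^sup>2"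
    unfolding lapJ by (simp add: diff_divide_distrib add_divide_distrib algebra_simps)
  also have "\<dots> = (hmean u v z / u z)\<^sup>2 * lap u z + (hmean u v z / v z)\<^sup>2 * lap v z"
    unfolding H by (simp add: divide_inverse power_mult_distrib power_inverse algebra_simps)
  finally show ?thesis .
qed

definition leaf_density :: "complex^'n \<Rightarrow> real" where
  "leaf_density z = (\<Sum>j\<in>UNIV. (cmod (lam $ j * z $ j))\<^sup>2)"

definition dist2 :: "complex^'n \<Rightarrow> complex^'n \<Rightarrow> real" where
  "dist2 x z = (\<Sum>j\<in>UNIV. sq_dist x j z)"

text \<open>It tends to infinity at the hyperplanes while being harmonic on the leaves, so
  subtracting a multiple of it localizes a test function off the hyperplanes without changing its
  Laplacian.\<close>

definition height :: "complex^'n \<Rightarrow> real" where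
  "height z = - (\<Sum>j\<in>UNIV. ln (cmod (z $ j)))"

lemma dist2_eq: "dist2 x z = (norm (z - x))\<^sup>2"
  by (simp add: dist2_def sq_dist_def norm_vec_def L2_set_def sum_nonneg)

lemma dist2_ge_0: "0 \<le> dist2 x z"
  by (simp add: dist2_eq)

lemma leaf_density_pos: "z \<in> M \<Longrightarrow> leaf_density z > 0"
  unfolding leaf_density_def
  by (rule sum_pos) (auto simp: punctured_polydisc_def lam_nz norm_mult)

lemma leaf_smooth_dist2: "leaf_smooth (dist2 x)"
  unfolding dist2_def by (intro leaf_smooth_sum leaf_smooth_sq_dist)

lemma lap_dist2: "z \<in> M \<Longrightarrow> lap (dist2 x) z = 4 * leaf_density z"
  unfolding dist2_def leaf_density_def
  by (subst lap_sum) (simp_all add: leaf_smooth_sq_dist lap_sq_dist sum_distrib_left)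

lemma leaf_smooth_density: "leaf_smooth leaf_density"
  by (rule leaf_smooth_cong[OF _ leaf_smooth_mult[OF leaf_smooth_const[of "1/4"] leaf_smooth_lap[OF leaf_smooth_dist2[of 0]]]])
     (simp add: lap_dist2)

lemma leaf_smooth_height: "leaf_smooth height"
  unfolding height_def by (intro leaf_smooth_minus leaf_smooth_sum leaf_smooth_ln_cmod)

lemma lap_minus: "leaf_smooth u \<Longrightarrow> z \<in> M \<Longrightarrow> lap (\<lambda>z. - u z) z = - lap u z"
  using lap_cmult[of u z "-1"] by simp

lemma lap_height: "z \<in> M \<Longrightarrow> lap height z = 0"
  unfolding height_def
  by (subst lap_minus, intro leaf_smooth_sum leaf_smooth_ln_cmod, assumption, subst lap_sum)
     (simp_all add: leaf_smooth_ln_cmod lap_ln_cmod)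

lemma height_pos: "z \<in> M \<Longrightarrow> height z > 0"
  unfolding height_def sum_negf[symmetric]
  by (rule sum_pos) (auto simp: punctured_polydisc_def)

text \<open>On a leaf \<open>height\<close> is affine in time. The resulting constant is not
  dominated by \<open>leaf_density\<close> near the origin, which is the obstacle for the Lelong
  number there.\<close>

lemma grad_height: "z \<in> M \<Longrightarrow> grad_prod height height z = (cmod (\<Sum>j\<in>UNIV. lam $ j))\<^sup>2"
proof -
  assume z: "z \<in> M"
  have "leaf_deriv d height z = - Re ((\<Sum>j\<in>UNIV. lam $ j) * d)" if d: "d \<in> {1, \<i>}" for d
  proof -
    have "leaf_deriv d height z = leaf_deriv d (\<lambda>z. (-1) * (\<Sum>j\<in>UNIV. ln (cmod (z $ j)))) z"
      by (simp add: height_def[abs_def])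
    also have "\<dots> = - (\<Sum>j\<in>UNIV. Re (lam $ j * d))"
      by (subst leaf_deriv_cmult[OF leaf_smooth_sum[OF leaf_smooth_ln_cmod] d z],
          subst leaf_deriv_sum[OF leaf_smooth_ln_cmod d z])
         (simp add: leaf_deriv_ln_cmod[OF z] del: times_complex.simps)
    finally show ?thesis by (simp only: sum_distrib_right Re_sum)
  qed
  from this[of 1] this[of \<i>] show ?thesis
    by (simp add: grad_prod_def cmod_power2 flip: power2_eq_square)
qed

text \<open>The derivative of |z - x|^2 along the leaf is 2 Re of the Hermitian product of z - x
  with a multiple of X; Cauchy-Schwarz bounds it by the distance times |X|.\<close>

lemma grad_dist2: "z \<in> M \<Longrightarrow> grad_prod (dist2 x) (dist2 x) z \<le> 4 * leaf_density z * dist2 x z"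
proof -
  assume z: "z \<in> M"
  define a where "a = (\<Sum>j\<in>UNIV. cnj (z $ j - x $ j) * (lam $ j * z $ j))"
  have D: "leaf_deriv d (dist2 x) z = 2 * Re (d * a)" if d: "d \<in> {1, \<i>}" for d
    unfolding dist2_def
    by (subst leaf_deriv_sum[OF leaf_smooth_sq_dist d z])
       (simp only: leaf_deriv_sq_dist[OF d z] a_def sum_distrib_left Re_sum mult_ac)
  have "grad_prod (dist2 x) (dist2 x) z = 4 * (cmod a)\<^sup>2"
    using D[of 1] D[of \<i>] by (simp add: grad_prod_def cmod_power2) (simp add: power2_eq_square)
  moreover have "cmod a \<le> (\<Sum>j\<in>UNIV. cmod (z $ j - x $ j) * cmod (lam $ j * z $ j))"
    unfolding a_def by (rule order_trans[OF norm_sum]) (simp add: norm_mult complex_mod_cnj flip: complex_cnj_diff)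
  then have "(cmod a)\<^sup>2 \<le> (\<Sum>j\<in>UNIV. cmod (z $ j - x $ j) * cmod (lam $ j * z $ j))\<^sup>2"
    by (simp add: power_mono)
  moreover have "\<dots> \<le> (\<Sum>j\<in>UNIV. (cmod (z $ j - x $ j))\<^sup>2) * (\<Sum>j\<in>UNIV. (cmod (lam $ j * z $ j))\<^sup>2)"
    by (rule Cauchy_Schwarz_ineq_sum)
  ultimately show ?thesis by (simp add: leaf_density_def dist2_def sq_dist_def mult_ac)
qed

end

subsection \<open>Harmonic functionals\<close>

text \<open>The cube of \<open>1 + t \<le> 3 * exp (t / 3)\<close>. With \<open>t = 1 / x\<close> it
  bounds \<open>hinge''\<close> and \<open>hinge_weight\<close> by constants.\<close>

lemma one_plus_cubed_le_exp:
  fixes t :: real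
  assumes "t \<ge> 0"
  shows "(1 + t) ^ 3 \<le> 27 * exp t"
proof -
  have "1 + t \<le> 3 * exp (t / 3)" using exp_ge_add_one_self[of "t / 3"] assms by linarith
  then have "(1 + t) ^ 3 \<le> (3 * exp (t / 3)) ^ 3" using assms by (intro power_mono) auto
  also have "\<dots> = 27 * exp t" by (simp add: power_mult_distrib flip: exp_of_nat_mult)
  finally show ?thesis .
qed

lemma hinge''_le: "hinge'' x \<le> 27"
proof (cases "x > 0")
  case True
  have "(1 / x) ^ 3 \<le> (1 + 1 / x) ^ 3" using True by (intro power_mono) auto
  also have "\<dots> \<le> 27 * exp (1 / x)" using True by (intro one_plus_cubed_le_exp) auto
  finally show ?thesis using True by (simp add: hinge_pos exp_minus field_simps)
qed simp

text \<open>For positive arguments this is \<open>hinge'' + hinge'\<^sup>2 / hinge\<close>, the weight produced by absorbing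
  a mixed gradient term.\<close>

definition hinge_weight :: "real \<Rightarrow> real" where
  "hinge_weight = flat_exp [:0, 0, 1, 2, 2:]"

lemma hinge_weight_nonpos [simp]: "x \<le> 0 \<Longrightarrow> hinge_weight x = 0"
  by (simp add: hinge_weight_def flat_exp_def)

lemma hinge_weight_pos: "x > 0 \<Longrightarrow> hinge_weight x = hinge'' x + (hinge' x)\<^sup>2 / hinge x"
  by (simp add: hinge_weight_def flat_exp_def hinge_pos field_simps power2_eq_square power3_eq_cube)

lemma hinge_weight_ge_0 [simp]: "0 \<le> hinge_weight x"
  by (cases "x > 0") (simp_all add: hinge_weight_pos)

lemma hinge_weight_le: "hinge_weight x \<le> 54"
proof (cases "x > 0")
  case True
  define t where "t = 1 / x"
  have t: "t > 0" using True by (simp add: t_def)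
  have "hinge_weight x = (t + 2 * t\<^sup>2 + 2 * t ^ 3) * exp (- t)"
    using True by (simp add: hinge_weight_def flat_exp_def t_def field_simps power2_eq_square power3_eq_cube)
  also have "t + 2 * t\<^sup>2 + 2 * t ^ 3 \<le> 2 * (1 + t) ^ 3"
    using t by (simp add: power2_eq_square power3_eq_cube algebra_simps)
  also have "\<dots> \<le> 54 * exp t" using one_plus_cubed_le_exp[of t] t by simp
  finally show ?thesis by (simp add: exp_minus field_simps)
qed simp

section \<open>Test functions\<close>

context linear_foliation
begin

lemma leaf_smooth_hinge_weight: "leaf_smooth u \<Longrightarrow> leaf_smooth (\<lambda>z. hinge_weight (u z))"
  unfolding hinge_weight_def by (rule leaf_smooth_compose[OF real_smooth_on_flat_exp[of UNIV]]) auto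

text \<open>Vanishing is asked only on \<open>M\<close>, because the logarithms and their
  compositions carry no meaning outside.\<close>

definition supported_in :: "(complex^'n) set \<Rightarrow> (complex^'n \<Rightarrow> real) \<Rightarrow> bool" where
  "supported_in V u \<longleftrightarrow> (\<exists>K. compact K \<and> K \<subseteq> V \<and> (\<forall>z\<in>M - K. u z = 0))"

definition test_fun :: "(complex^'n \<Rightarrow> real) \<Rightarrow> bool" where
  "test_fun u \<longleftrightarrow> leaf_smooth u \<and> supported_in M u"

lemma supported_in_mono:
  "supported_in V u \<Longrightarrow> (\<And>z. z \<in> M \<Longrightarrow> u z = 0 \<Longrightarrow> v z = 0) \<Longrightarrow> V \<subseteq> V' \<Longrightarrow> supported_in V' v"
  unfolding supported_in_def by (meson DiffD1 subset_trans)

lemma supported_in_add: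
  assumes "supported_in V u" "supported_in V v"
  shows "supported_in V (\<lambda>z. u z + v z)"
proof -
  obtain K L where "compact K" "K \<subseteq> V" "\<forall>z\<in>M - K. u z = 0" "compact L" "L \<subseteq> V" "\<forall>z\<in>M - L. v z = 0"
    using assms unfolding supported_in_def by blast
  then show ?thesis unfolding supported_in_def by (intro exI[of _ "K \<union> L"]) auto
qed

lemma test_fun_leaf_smooth: "test_fun u \<Longrightarrow> leaf_smooth u"
  by (simp add: test_fun_def)

lemma test_fun_add: "test_fun u \<Longrightarrow> test_fun v \<Longrightarrow> test_fun (\<lambda>z. u z + v z)"
  unfolding test_fun_def by (simp add: leaf_smooth_add supported_in_add)

lemma test_fun_mult: "test_fun u \<Longrightarrow> leaf_smooth v \<Longrightarrow> test_fun (\<lambda>z. u z * v z)"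
  unfolding test_fun_def by (auto intro: leaf_smooth_mult supported_in_mono[of M u])

lemma test_fun_mult2: "leaf_smooth v \<Longrightarrow> test_fun u \<Longrightarrow> test_fun (\<lambda>z. v z * u z)"
  using test_fun_mult[of u v] by (simp add: mult.commute)

lemma test_fun_cmult: "test_fun u \<Longrightarrow> test_fun (\<lambda>z. c * u z)"
  by (rule test_fun_mult2) simp

lemma test_fun_minus: "test_fun u \<Longrightarrow> test_fun (\<lambda>z. - u z)"
  using test_fun_cmult[of u "-1"] by simp

lemma test_fun_diff: "test_fun u \<Longrightarrow> test_fun v \<Longrightarrow> test_fun (\<lambda>z. u z - v z)"
  using test_fun_add[of u "\<lambda>z. - v z"] test_fun_minus by simp

lemma test_fun_0: "test_fun (\<lambda>z. 0)"
  unfolding test_fun_def supported_in_def by (auto intro!: exI[of _ "{}"])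

lemma test_fun_sum: "(\<And>i. i \<in> A \<Longrightarrow> test_fun (u i)) \<Longrightarrow> test_fun (\<lambda>z. \<Sum>i\<in>A. u i z)"
  by (induction A rule: infinite_finite_induct) (simp_all add: test_fun_add test_fun_0)

lemma leaf_deriv_eq_0:
  assumes "open V" "\<And>z. z \<in> V \<Longrightarrow> u z = 0" "z \<in> V"
  shows "leaf_deriv d u z = 0"
proof (rule leaf_derivI)
  have "has_leaf_deriv d u 0 z \<longleftrightarrow> ((\<lambda>s::real. 0::real) has_real_derivative 0) (at 0)"
  proof (rule DERIV_cong_ev)
    show "\<forall>\<^sub>F s in nhds 0. u (flow (of_real s * d) z) = 0"
      using eventually_flow_in[OF assms(1,3), of d] by eventually_elim (simp add: assms(2))
  qed simp_all
  then show "has_leaf_deriv d u 0 z" by simp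
qed

lemma test_fun_lap: "test_fun u \<Longrightarrow> test_fun (lap u)"
proof -
  assume u: "test_fun u"
  then obtain K where K: "compact K" "K \<subseteq> M" "\<And>z. z \<in> M - K \<Longrightarrow> u z = 0"
    unfolding test_fun_def supported_in_def by blast
  have o: "open (M - K)" by (intro open_Diff open_punctured_polydisc compact_imp_closed K(1))
  have "lap u z = 0" if "z \<in> M - K" for z
    unfolding lap_def using leaf_deriv_eq_0[OF o leaf_deriv_eq_0[OF o K(3)] that] by simp
  then show ?thesis using u K unfolding test_fun_def supported_in_def
    by (auto intro: leaf_smooth_lap)
qed

end

text \<open>The functional u -> T(u dA) is the only form in which a current enters the estimates.
  All integrals are values on test functions, so limits have to be replaced by explicit
  inequalities.\<close>

locale harmonic_functional = linear_foliation lam for lam :: "complex^'n" +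
  fixes I :: "(complex^'n \<Rightarrow> real) \<Rightarrow> real"
  assumes I_add: "test_fun u \<Longrightarrow> test_fun v \<Longrightarrow> I (\<lambda>z. u z + v z) = I u + I v"
    and I_cmult: "test_fun u \<Longrightarrow> I (\<lambda>z. c * u z) = c * I u"
    and I_nonneg: "test_fun u \<Longrightarrow> (\<And>z. z \<in> M \<Longrightarrow> 0 \<le> u z) \<Longrightarrow> 0 \<le> I u"
    and I_lap: "test_fun u \<Longrightarrow> I (lap u) = 0"
begin

lemma I_diff: "test_fun u \<Longrightarrow> test_fun v \<Longrightarrow> I (\<lambda>z. u z - v z) = I u - I v"
  using I_add[of u "\<lambda>z. - 1 * v z"] I_cmult[of v "-1"] test_fun_cmult[of v "-1"] by simp

lemma I_mono:
  assumes "test_fun u" "test_fun v" "\<And>z. z \<in> M \<Longrightarrow> u z \<le> v z"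
  shows "I u \<le> I v"
proof -
  have "0 \<le> I (\<lambda>z. v z - u z)" by (rule I_nonneg) (simp_all add: assms test_fun_diff)
  then show ?thesis by (simp add: I_diff assms)
qed

lemma I_0: "I (\<lambda>z. 0) = 0"
  using I_cmult[OF test_fun_0, of 0] by simp

lemma I_sum:
  assumes "finite A" "\<And>i. i \<in> A \<Longrightarrow> test_fun (u i)"
  shows "I (\<lambda>z. \<Sum>i\<in>A. u i z) = (\<Sum>i\<in>A. I (u i))"
  using assms by (induction A rule: finite_induct) (simp_all add: I_0 I_add test_fun_sum)

lemma I_density_le:
  assumes mass: "\<And>u. leaf_smooth u \<Longrightarrow> supported_in V u \<Longrightarrow> (\<And>z. z \<in> M \<Longrightarrow> 0 \<le> u z \<and> u z \<le> 1) \<Longrightarrow>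
      I (\<lambda>z. u z * leaf_density z) \<le> \<mu>"
    and "V \<subseteq> M" "leaf_smooth u" "supported_in V u" "c > 0" "\<And>z. z \<in> M \<Longrightarrow> 0 \<le> u z \<and> u z \<le> c"
  shows "I (\<lambda>z. u z * leaf_density z) \<le> c * \<mu>"
proof -
  have u: "test_fun (\<lambda>z. u z * leaf_density z)"
    using assms by (intro test_fun_mult leaf_smooth_density) (auto simp: test_fun_def intro: supported_in_mono)
  have "I (\<lambda>z. (1 / c * u z) * leaf_density z) \<le> \<mu>"
  proof (rule mass)
    show "leaf_smooth (\<lambda>z. 1 / c * u z)" by (intro leaf_smooth_intros assms)
    show "supported_in V (\<lambda>z. 1 / c * u z)" by (rule supported_in_mono[OF assms(4)]) auto
  qed (use assms in auto)
  then have "1 / c * I (\<lambda>z. u z * leaf_density z) \<le> \<mu>"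
    using I_cmult[OF u, of "1 / c"] by (simp add: mult.assoc)
  then show ?thesis using \<open>c > 0\<close> by (simp add: field_simps)
qed

end

context linear_foliation
begin

lemma leaf_deriv_hinge:
  assumes "leaf_smooth p" "z \<in> M" "d \<in> {1, \<i>}"
  shows "leaf_deriv d (\<lambda>z. hinge (p z)) z = hinge' (p z) * leaf_deriv d p z"
  using leaf_deriv_compose[OF assms(1,1,3,2) hinge_DERIV] .

lemma lap_hinge:
  assumes "leaf_smooth p" "z \<in> M"
  shows "lap (\<lambda>z. hinge (p z)) z = hinge' (p z) * lap p z + hinge'' (p z) * grad_prod p p z"
  by (rule lap_compose[OF assms hinge_DERIV hinge'_DERIV])

lemma lap_hinge_ge:
  assumes "leaf_smooth p" "z \<in> M"
  shows "hinge' (p z) * lap p z \<le> lap (\<lambda>z. hinge (p z)) z"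
  unfolding lap_hinge[OF assms] by (simp add: grad_prod_ge_0)

lemma height_ge_ln:
  assumes "z \<in> M"
  shows "- ln (cmod (z $ j)) \<le> height z"
proof -
  have "- ln (cmod (z $ j)) \<le> (\<Sum>j\<in>UNIV. - ln (cmod (z $ j)))"
    using assms by (intro member_le_sum) (auto simp: punctured_polydisc_def less_imp_le)
  then show ?thesis by (simp add: height_def sum_negf)
qed

lemma cmod_ge_exp_height:
  assumes "z \<in> M" "height z \<le> h"
  shows "exp (- h) \<le> cmod (z $ j)"
proof -
  have "- h \<le> ln (cmod (z $ j))" using height_ge_ln[OF assms(1), of j] assms(2) by simp
  moreover have "0 < cmod (z $ j)" using assms(1) by (auto simp: punctured_polydisc_def)
  ultimately show ?thesis using exp_le_cancel_iff[of "- h" "ln (cmod (z $ j))"] by simp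
qed

lemma compact_box: "compact {z::complex^'n. \<forall>j. a \<le> cmod (z $ j) \<and> cmod (z $ j) \<le> b}"
proof -
  have "{z::complex^'n. \<forall>j. a \<le> cmod (z $ j) \<and> cmod (z $ j) \<le> b} =
      (\<Inter>j. {z. a \<le> cmod (z $ j)} \<inter> {z. cmod (z $ j) \<le> b})" by auto
  moreover have "closed \<dots>"
    by (intro closed_INT closed_Int closed_Collect_le ballI continuous_intros)
  moreover have "bounded {z::complex^'n. \<forall>j. a \<le> cmod (z $ j) \<and> cmod (z $ j) \<le> b}"
  proof (rule boundedI)
    fix z :: "complex^'n" assume "z \<in> {z. \<forall>j. a \<le> cmod (z $ j) \<and> cmod (z $ j) \<le> b}"
    then have "(\<Sum>j\<in>UNIV. cmod (z $ j)) \<le> (\<Sum>j\<in>(UNIV::'n set). b)" by (intro sum_mono) auto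
    then show "norm z \<le> (\<Sum>j\<in>(UNIV::'n set). b)" 
      using L2_set_le_sum[of UNIV "\<lambda>j. cmod (z $ j)"] by (simp add: norm_vec_def)
  qed
  ultimately show ?thesis by (simp add: compact_eq_bounded_closed)
qed

end

subsection \<open>Finiteness of the mass\<close>

context linear_foliation
begin

lemma grad_sq_dist_0:
  assumes "z \<in> M"
  shows "grad_prod (sq_dist 0 j) (sq_dist 0 j) z = 4 * (cmod (lam $ j * z $ j))\<^sup>2 * sq_dist 0 j z"
proof -
  have D: "leaf_deriv d (sq_dist 0 j) z = 2 * Re (cnj (z $ j) * (d * lam $ j * z $ j))" if "d \<in> {1, \<i>}" for d
    using leaf_deriv_sq_dist[OF that assms, of 0 j] by simp
  define w where "w = cnj (z $ j) * (lam $ j * z $ j)"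
  have "leaf_deriv 1 (sq_dist 0 j) z = 2 * Re w" "leaf_deriv \<i> (sq_dist 0 j) z = - 2 * Im w"
    using D[of 1] D[of \<i>] by (simp_all add: w_def algebra_simps)
  then have "grad_prod (sq_dist 0 j) (sq_dist 0 j) z = 4 * (cmod w)\<^sup>2"
    by (simp add: grad_prod_def cmod_power2) (simp add: power2_eq_square)
  then show ?thesis by (simp add: w_def norm_mult power_mult_distrib sq_dist_def)
qed

end

context harmonic_functional
begin

text \<open>The test functions are convex functions of plurisubharmonic ones: the term
  \<open>- \<epsilon> height\<close> is leafwise harmonic and makes the support compact, and the terms
  \<open>hinge (sq_dist 0 i - r\<^sup>2)\<close> cut off inside the region where the mass is known to be finite.\<close>

lemma mass_finite:
  assumes r: "0 < r" "r < 1" and V: "V \<subseteq> M" "\<And>z j. z \<in> M \<Longrightarrow> r \<le> cmod (z $ j) \<Longrightarrow> z \<in> V"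
    and mass: "\<And>u. leaf_smooth u \<Longrightarrow> supported_in V u \<Longrightarrow> (\<And>z. z \<in> M \<Longrightarrow> 0 \<le> u z \<and> u z \<le> 1) \<Longrightarrow>
      I (\<lambda>z. u z * leaf_density z) \<le> m"
  shows "\<exists>C. \<forall>u. test_fun u \<longrightarrow> (\<forall>z\<in>M. 0 \<le> u z \<and> u z \<le> 1) \<longrightarrow> I (\<lambda>z. u z * leaf_density z) \<le> C"
proof -
  define n where "n = real CARD('n)"
  have n: "n > 0" by (simp add: n_def)
  define S where "S i z = sq_dist 0 i z - r\<^sup>2" for i and z :: "complex^'n"
  have r2: "0 < r\<^sup>2" "r\<^sup>2 < 1" using r by (simp_all add: power_less_one_iff)
  define \<delta> where "\<delta> = (1 - r\<^sup>2) / 2"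
  have \<delta>: "\<delta> > 0" using r2 by (simp add: \<delta>_def)
  \<comment> \<open>On \<open>M\<close> the function \<open>dist2 0\<close> is at most
    \<open>n\<close>. As \<open>A * hinge \<delta> = n + 1\<close>, a single
    \<open>S i z \<ge> \<delta>\<close> makes \<open>p\<close> negative, which keeps its positive
    part in a polydisc of radius less than 1.\<close>
  define A where "A = (n + 1) / hinge \<delta>"
  have A: "A > 0" "A * hinge \<delta> = n + 1" using hinge_gt_0(1)[OF \<delta>] n by (simp_all add: A_def)
  \<comment> \<open>If \<open>S i z \<le> \<eta>\<close>, the i-th cutoff term costs at most
    \<open>A * \<eta> = r\<^sup>2 / 2\<close>, hence at most half of \<open>sq_dist 0 i z\<close>
    whenever it is nonzero.\<close>
  define \<eta> where "\<eta> = r\<^sup>2 / (2 * A)"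
  have \<eta>: "\<eta> > 0" "A * \<eta> = r\<^sup>2 / 2" using A r by (simp_all add: \<eta>_def)
  define c where "c = min (hinge' 1) (hinge' \<eta>)"
  have c: "c > 0" "c \<le> hinge' 1" "c \<le> hinge' \<eta>" using hinge_gt_0(2) \<eta> by (auto simp: c_def)
  have S: "leaf_smooth (S i)" for i
    unfolding S_def by (intro leaf_smooth_intros leaf_smooth_sq_dist)
  have lapS: "lap (S i) z = 4 * (cmod (lam $ i * z $ i))\<^sup>2" if "z \<in> M" for i z
    using lap_diff_const[OF leaf_smooth_sq_dist that] lap_sq_dist[OF that] by (simp add: S_def[abs_def])
  have gradS: "grad_prod (S i) (S i) z = 4 * (cmod (lam $ i * z $ i))\<^sup>2 * sq_dist 0 i z" if "z \<in> M" for i z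
    using grad_sq_dist_0[OF that, of i] leaf_deriv_diff_const[OF leaf_smooth_sq_dist _ that]
    by (simp add: S_def[abs_def] grad_prod_def)
  have sq1: "0 \<le> sq_dist 0 i z" "sq_dist 0 i z < 1" if "z \<in> M" for i z
    using that by (auto simp: sq_dist_def punctured_polydisc_def power_less_one_iff)
  have SrV: "r \<le> cmod (z $ i)" if "S i z > 0" for i z
    using that r by (simp add: S_def sq_dist_def) (metis less_eq_real_def norm_ge_zero power_less_imp_less_base)
  \<comment> \<open>\<open>lap (hinge (S i))\<close> is \<open>4 * q i z\<close> times |lam_i
    z_i|^2. Since \<open>q i\<close> vanishes where |z_i| is at most \<open>r\<close>, these error
    terms live in the region of known mass.\<close>
  define q where "q i z = hinge' (S i z) + sq_dist 0 i z * hinge'' (S i z)" for i z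
  have q: "leaf_smooth (q i)" for i unfolding q_def by (intro leaf_smooth_intros leaf_smooth_sq_dist S)
  have q0: "0 \<le> q i z" "q i z \<le> 28" if "z \<in> M" for i z
  proof -
    show "0 \<le> q i z" using sq1[OF that] by (simp add: q_def)
    have "sq_dist 0 i z * hinge'' (S i z) \<le> 1 * 27"
      using sq1[OF that, of i] hinge''_le by (intro mult_mono) auto
    then show "q i z \<le> 28" using hinge'_le_1[of "S i z"] by (simp add: q_def)
  qed
  have lapq: "lap (\<lambda>z. hinge (S i z)) z \<le> 4 * (q i z * leaf_density z)" if z: "z \<in> M" for i z
  proof -
    have "lap (\<lambda>z. hinge (S i z)) z = 4 * ((cmod (lam $ i * z $ i))\<^sup>2 * q i z)"
      unfolding lap_hinge[OF S z] lapS[OF z] gradS[OF z] q_def by (simp add: algebra_simps)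
    moreover have "(cmod (lam $ i * z $ i))\<^sup>2 \<le> leaf_density z"
      unfolding leaf_density_def by (rule member_le_sum) auto
    ultimately show ?thesis
      using mult_right_mono[OF _ q0(1)[OF z, of i]] by (simp only: mult.commute[of "q i z"]) simp
  qed
  \<comment> \<open>The factor \<open>1 / \<epsilon>\<close> cancels in the inequality obtained from
    \<open>I_lap\<close>, but it makes \<open>p\<close> at least 1 as soon as the bracket is at
    least \<open>\<epsilon>\<close>. Hence \<open>hinge' (p \<epsilon> z)\<close> has a lower bound
    there that does not depend on \<open>\<epsilon>\<close>.\<close>
  define p where "p \<epsilon> z = (1 / \<epsilon>) * (dist2 0 z - \<epsilon> * height z - A * (\<Sum>i\<in>UNIV. hinge (S i z)))"
    for \<epsilon> and z :: "complex^'n"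
  have p: "leaf_smooth (p \<epsilon>)" for \<epsilon>
    unfolding p_def by (intro leaf_smooth_intros leaf_smooth_dist2 leaf_smooth_height S)
  have d2: "dist2 0 z \<le> n" if "z \<in> M" for z
    unfolding dist2_def n_def using sum_mono[of UNIV "\<lambda>i. sq_dist 0 i z" "\<lambda>i. 1"] sq1[OF that]
    by (simp add: less_imp_le)
  have lapp: "4 / \<epsilon> * (leaf_density z - A * (\<Sum>i\<in>UNIV. q i z * leaf_density z)) \<le> lap (p \<epsilon>) z"
    if z: "z \<in> M" and \<epsilon>: "\<epsilon> > 0" for z \<epsilon>
  proof -
    have sm: "leaf_smooth (\<lambda>z. hinge (S i z))" for i by (intro leaf_smooth_intros S)
    have "p \<epsilon> = (\<lambda>z. (1 / \<epsilon>) * (dist2 0 z + ((- \<epsilon>) * height z + (- A) * (\<Sum>i\<in>UNIV. hinge (S i z)))))"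
      by (simp add: p_def fun_eq_iff)
    then have "lap (p \<epsilon>) z = 1 / \<epsilon> * (lap (dist2 0) z + ((- \<epsilon>) * lap height z + (- A) * (\<Sum>i\<in>UNIV. lap (\<lambda>z. hinge (S i z)) z)))"
      using z by (simp only: lap_cmult lap_add lap_sum leaf_smooth_add leaf_smooth_mult leaf_smooth_const
          leaf_smooth_dist2 leaf_smooth_height leaf_smooth_sum sm finite_class.finite)
    moreover have "(\<Sum>i\<in>UNIV. lap (\<lambda>z. hinge (S i z)) z) \<le> 4 * (\<Sum>i\<in>UNIV. q i z * leaf_density z)"
      unfolding sum_distrib_left by (intro sum_mono lapq z)
    then have "A * (\<Sum>i\<in>UNIV. lap (\<lambda>z. hinge (S i z)) z) \<le> A * (4 * (\<Sum>i\<in>UNIV. q i z * leaf_density z))"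
      using A by (intro mult_left_mono) auto
    then have "1 / \<epsilon> * (4 * leaf_density z - A * (4 * (\<Sum>i\<in>UNIV. q i z * leaf_density z))) \<le>
        1 / \<epsilon> * (4 * leaf_density z - A * (\<Sum>i\<in>UNIV. lap (\<lambda>z. hinge (S i z)) z))"
      using \<epsilon> by (intro mult_left_mono) auto
    ultimately show ?thesis
      by (simp add: lap_dist2[OF z] lap_height[OF z] right_diff_distrib mult.left_commute[of A 4])
  qed
  have supp: "supported_in M (\<lambda>z. hinge' (p \<epsilon> z))" "supported_in M (\<lambda>z. hinge (p \<epsilon> z))"
    and suppV: "supported_in V (\<lambda>z. hinge' (p \<epsilon> z) * q i z)" if \<epsilon>: "\<epsilon> > 0" for \<epsilon> i
  proof -
    define b where "b = sqrt (r\<^sup>2 + \<delta>)"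
    have b: "b < 1" "b \<ge> 0" "b\<^sup>2 = r\<^sup>2 + \<delta>"
    proof -
      have "2 * \<delta> = 1 - r\<^sup>2" by (simp add: \<delta>_def)
      then have "r\<^sup>2 + \<delta> < 1" using \<delta> by linarith
      then show "b < 1" by (simp add: b_def)
      show "b \<ge> 0" "b\<^sup>2 = r\<^sup>2 + \<delta>" using \<delta> by (simp_all add: b_def)
    qed
    define K where "K = {z::complex^'n. \<forall>j. exp (- (n / \<epsilon>)) \<le> cmod (z $ j) \<and> cmod (z $ j) \<le> b}"
    have KM: "K \<subseteq> M"
      unfolding K_def punctured_polydisc_def
      using b(1) le_less_trans[of _ b 1] less_le_trans[OF exp_gt_zero, of "- (n / \<epsilon>)"] by blast
    have K: "compact K" unfolding K_def by (rule compact_box)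
    have pK: "z \<in> K" if z: "z \<in> M" "p \<epsilon> z > 0" for z
    proof -
      have *: "\<epsilon> * height z + A * (\<Sum>i\<in>UNIV. hinge (S i z)) < n"
        using that \<epsilon> d2[OF z(1)] by (simp add: p_def zero_less_divide_iff)
      moreover have "A * (\<Sum>i\<in>UNIV. hinge (S i z)) \<ge> 0" using A by (simp add: sum_nonneg)
      moreover have "\<epsilon> * height z \<ge> 0" using height_pos[OF z(1)] \<epsilon> by simp
      ultimately have 1: "\<epsilon> * height z \<le> n" "A * (\<Sum>i\<in>UNIV. hinge (S i z)) < n" by auto
      have "height z \<le> n / \<epsilon>" using 1 \<epsilon> by (simp add: field_simps)
      then have "exp (- (n / \<epsilon>)) \<le> cmod (z $ j)" for j by (rule cmod_ge_exp_height[OF z(1)])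
      moreover have "cmod (z $ j) \<le> b" for j
      proof (rule ccontr)
        assume "\<not> cmod (z $ j) \<le> b"
        then have "b\<^sup>2 < (cmod (z $ j))\<^sup>2" using b by (intro power_strict_mono) auto
        then have "\<delta> \<le> S j z" using b by (simp add: S_def sq_dist_def)
        then have "hinge \<delta> \<le> hinge (S j z)" by (rule hinge_mono)
        also have "\<dots> \<le> (\<Sum>i\<in>UNIV. hinge (S i z))" by (rule member_le_sum) auto
        finally have "A * hinge \<delta> \<le> A * (\<Sum>i\<in>UNIV. hinge (S i z))"
          using A(1) by (simp only: mult_le_cancel_left_pos)
        then show False using 1 A by simp
      qed
      ultimately show ?thesis by (simp add: K_def)
    qed
    have "hinge' (p \<epsilon> z) = 0 \<and> hinge (p \<epsilon> z) = 0" if "z \<in> M - K" for z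
      using pK[of z] that by (cases "p \<epsilon> z > 0") auto
    then show "supported_in M (\<lambda>z. hinge' (p \<epsilon> z))" "supported_in M (\<lambda>z. hinge (p \<epsilon> z))"
      using K KM unfolding supported_in_def by blast+
    define K' where "K' = K \<inter> {z. r \<le> cmod (z $ i)}"
    have "closed {z::complex^'n. r \<le> cmod (z $ i)}" by (intro closed_Collect_le continuous_intros)
    then have "compact K'" unfolding K'_def using K by blast
    moreover have "K' \<subseteq> V" using KM V(2) by (auto simp: K'_def)
    moreover have "hinge' (p \<epsilon> z) * q i z = 0" if z: "z \<in> M - K'" for z
    proof (cases "p \<epsilon> z > 0 \<and> S i z > 0")
      case True
      then show ?thesis using pK[of z] SrV[of i z] z by (auto simp: K'_def)
    qed (auto simp: q_def)
    ultimately show "supported_in V (\<lambda>z. hinge' (p \<epsilon> z) * q i z)"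
      unfolding supported_in_def by blast
  qed
  have t: "test_fun (\<lambda>z. hinge' (p \<epsilon> z))" "test_fun (\<lambda>z. hinge (p \<epsilon> z))" if "\<epsilon> > 0" for \<epsilon>
    using supp[OF that] unfolding test_fun_def by (auto intro: leaf_smooth_hinge p)
  \<comment> \<open>As \<open>I (lap (\<lambda>z. hinge (p \<epsilon> z))) = 0\<close>, the positive
    density term is paid for by the terms with \<open>q\<close>, which are supported in
    \<open>V\<close>. The bound \<open>28 * m\<close> for each of them is uniform in
    \<open>\<epsilon>\<close>.\<close>
  have I1: "I (\<lambda>z. hinge' (p \<epsilon> z) * leaf_density z) \<le> A * (n * (28 * m))" if \<epsilon>: "\<epsilon> > 0" for \<epsilon>
  proof -
    have tq: "test_fun (\<lambda>z. hinge' (p \<epsilon> z) * q i z * leaf_density z)" for i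
      by (intro test_fun_mult t \<epsilon> q leaf_smooth_density)
    have td: "test_fun (\<lambda>z. hinge' (p \<epsilon> z) * leaf_density z)"
      by (intro test_fun_mult t \<epsilon> leaf_smooth_density)
    have ts: "test_fun (\<lambda>z. A * (\<Sum>i\<in>UNIV. hinge' (p \<epsilon> z) * q i z * leaf_density z))"
      by (intro test_fun_cmult test_fun_sum tq)
    have "I (\<lambda>z. 4 / \<epsilon> * (hinge' (p \<epsilon> z) * leaf_density z - A * (\<Sum>i\<in>UNIV. hinge' (p \<epsilon> z) * q i z * leaf_density z))) \<le>
        I (lap (\<lambda>z. hinge (p \<epsilon> z)))"
    proof (rule I_mono)
      show "test_fun (\<lambda>z. 4 / \<epsilon> * (hinge' (p \<epsilon> z) * leaf_density z - A * (\<Sum>i\<in>UNIV. hinge' (p \<epsilon> z) * q i z * leaf_density z)))"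
        by (intro test_fun_cmult test_fun_diff td ts)
      show "test_fun (lap (\<lambda>z. hinge (p \<epsilon> z)))" by (intro test_fun_lap t \<epsilon>)
      fix z assume z: "z \<in> M"
      have "4 / \<epsilon> * (hinge' (p \<epsilon> z) * leaf_density z - A * (\<Sum>i\<in>UNIV. hinge' (p \<epsilon> z) * q i z * leaf_density z)) =
          hinge' (p \<epsilon> z) * (4 / \<epsilon> * (leaf_density z - A * (\<Sum>i\<in>UNIV. q i z * leaf_density z)))"
        by (simp add: sum_distrib_left algebra_simps)
      also have "\<dots> \<le> hinge' (p \<epsilon> z) * lap (p \<epsilon>) z" by (intro mult_left_mono lapp z \<epsilon>) simp
      also have "\<dots> \<le> lap (\<lambda>z. hinge (p \<epsilon> z)) z" by (rule lap_hinge_ge[OF p z])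
      finally show "4 / \<epsilon> * (hinge' (p \<epsilon> z) * leaf_density z - A * (\<Sum>i\<in>UNIV. hinge' (p \<epsilon> z) * q i z * leaf_density z)) \<le>
          lap (\<lambda>z. hinge (p \<epsilon> z)) z" .
    qed
    then have "4 / \<epsilon> * (I (\<lambda>z. hinge' (p \<epsilon> z) * leaf_density z) -
        A * (\<Sum>i\<in>UNIV. I (\<lambda>z. hinge' (p \<epsilon> z) * q i z * leaf_density z))) \<le> 0"
      unfolding I_cmult[OF test_fun_diff[OF td ts]] I_diff[OF td ts] I_cmult[OF test_fun_sum[OF tq]]
        I_sum[OF finite_class.finite_UNIV tq] I_lap[OF t(2)[OF \<epsilon>]] .
    then have "I (\<lambda>z. hinge' (p \<epsilon> z) * leaf_density z) \<le> A * (\<Sum>i\<in>UNIV. I (\<lambda>z. hinge' (p \<epsilon> z) * q i z * leaf_density z))"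
      using \<epsilon> by (simp add: divide_le_0_iff)
    also have "(\<Sum>i\<in>UNIV. I (\<lambda>z. hinge' (p \<epsilon> z) * q i z * leaf_density z)) \<le> (\<Sum>i\<in>(UNIV::'n set). 28 * m)"
    proof (intro sum_mono I_density_le[OF mass V(1)])
      show "leaf_smooth (\<lambda>z. hinge' (p \<epsilon> z) * q i z)" for i by (intro leaf_smooth_intros p q)
      show "0 \<le> hinge' (p \<epsilon> z) * q i z \<and> hinge' (p \<epsilon> z) * q i z \<le> 28" if "z \<in> M" for i z
        using q0[OF that, of i] hinge'_le_1[of "p \<epsilon> z"] mult_mono[of "hinge' (p \<epsilon> z)" 1 "q i z" 28] by simp
    qed (simp_all add: suppV[OF \<epsilon>])
    finally show ?thesis using A by (simp add: n_def mult_left_mono)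
  qed
  have main: "I (\<lambda>z. u z * leaf_density z) \<le> 1 / c * (A * (n * (28 * m)) + n * m)"
    if u: "test_fun u" "\<And>z. z \<in> M \<Longrightarrow> 0 \<le> u z \<and> u z \<le> 1" for u
  proof -
    obtain K where K: "compact K" "K \<subseteq> M" "\<And>z. z \<in> M - K \<Longrightarrow> u z = 0"
      using u(1) unfolding test_fun_def supported_in_def by blast
    have cont: "continuous_on K height" "continuous_on K (dist2 0)"
      using K leaf_smooth_continuous_on[OF leaf_smooth_height] leaf_smooth_continuous_on[OF leaf_smooth_dist2]
      by (auto intro: continuous_on_subset)
    obtain h where h: "\<And>z. z \<in> K \<Longrightarrow> height z \<le> h" "h > 0"
    proof -
      have "bounded (height ` K)" by (intro compact_imp_bounded compact_continuous_image cont K)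
      then obtain h where "h > 0" "\<And>z. z \<in> K \<Longrightarrow> \<bar>height z\<bar> \<le> h" by (auto simp: bounded_pos)
      then show ?thesis using that by (meson abs_le_D1)
    qed
    have d2pos: "dist2 0 z > 0" if "z \<in> M" for z
      using that by (auto simp: dist2_eq punctured_polydisc_def)
    obtain d where d: "d > 0" "\<And>z. z \<in> K \<Longrightarrow> d \<le> dist2 0 z"
    proof (cases "K = {}")
      case False
      then obtain z0 where "z0 \<in> K" "\<And>z. z \<in> K \<Longrightarrow> dist2 0 z0 \<le> dist2 0 z"
        using continuous_attains_inf[OF K(1) _ cont(2)] by blast
      then show ?thesis using that[of "dist2 0 z0"] d2pos K by blast
    qed (use that[of 1] in auto)
    \<comment> \<open>It depends on \<open>u\<close> through the compact set \<open>K\<close>, which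
      is harmless because the bound \<open>I1\<close> is the same for all
      \<open>\<epsilon>\<close>.\<close>
    define \<epsilon> where "\<epsilon> = d / (2 * (h + 1))"
    have \<epsilon>: "\<epsilon> > 0" "d / 2 = \<epsilon> * (h + 1)" using d h by (simp_all add: \<epsilon>_def field_simps)
    \<comment> \<open>A dichotomy: either some coordinate is large and the point lies in the region
      of known mass, or all cutoff terms are small and then
      \<open>p \<epsilon> z \<ge> 1\<close>.\<close>
    have g: "c \<le> hinge' (p \<epsilon> z) + (\<Sum>i\<in>UNIV. hinge' (S i z))" if z: "z \<in> K" for z
    proof (cases "\<exists>i. S i z > \<eta>")
      case True
      then obtain i where "S i z > \<eta>" by blast
      then have "c \<le> hinge' (S i z)" using c(3) hinge_mono(2)[of \<eta> "S i z"] by simp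
      also have "\<dots> \<le> (\<Sum>i\<in>UNIV. hinge' (S i z))" by (rule member_le_sum) auto
      finally show ?thesis using hinge_ge_0(2)[of "p \<epsilon> z"] by linarith
    next
      case False
      have "A * hinge (S i z) \<le> sq_dist 0 i z / 2" for i
      proof (cases "S i z > 0")
        case True
        have "A * hinge (S i z) \<le> A * \<eta>"
          using A True False hinge_le[of "S i z"] by (intro mult_left_mono) (auto simp: not_less intro: order_trans)
        then show ?thesis using \<eta> True by (simp add: S_def)
      next
        case False
        then show ?thesis using sq1[of z i] z K by auto
      qed
      then have "A * (\<Sum>i\<in>UNIV. hinge (S i z)) \<le> dist2 0 z / 2"
        unfolding dist2_def sum_distrib_left sum_divide_distrib by (intro sum_mono)
      moreover have "\<epsilon> * height z \<le> \<epsilon> * h" using h(1)[OF z] \<epsilon> by simp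
      ultimately have "\<epsilon> \<le> dist2 0 z - \<epsilon> * height z - A * (\<Sum>i\<in>UNIV. hinge (S i z))"
        using d(2)[OF z] \<epsilon>(2) by (simp add: algebra_simps)
      then have "1 \<le> p \<epsilon> z" using \<epsilon>(1) by (simp add: p_def field_simps)
      then have "c \<le> hinge' (p \<epsilon> z)" using c(2) hinge_mono(2)[of 1 "p \<epsilon> z"] by simp
      then show ?thesis by (simp add: sum_nonneg add_increasing2)
    qed
    have tS: "test_fun (\<lambda>z. u z * hinge' (S i z) * leaf_density z)" for i
      by (intro test_fun_mult u leaf_smooth_intros S leaf_smooth_density)
    have td: "test_fun (\<lambda>z. hinge' (p \<epsilon> z) * leaf_density z)"
      by (intro test_fun_mult t \<epsilon> leaf_smooth_density)
    have tu: "test_fun (\<lambda>z. u z * leaf_density z)" by (intro test_fun_mult u leaf_smooth_density)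
    have "I (\<lambda>z. c * (u z * leaf_density z)) \<le>
        I (\<lambda>z. hinge' (p \<epsilon> z) * leaf_density z + (\<Sum>i\<in>UNIV. u z * hinge' (S i z) * leaf_density z))"
    proof (rule I_mono)
      fix z assume z: "z \<in> M"
      have "c * u z \<le> hinge' (p \<epsilon> z) + (\<Sum>i\<in>UNIV. u z * hinge' (S i z))"
      proof (cases "z \<in> K")
        case True
        have "c * u z \<le> (hinge' (p \<epsilon> z) + (\<Sum>i\<in>UNIV. hinge' (S i z))) * u z"
          using g[OF True] u(2)[OF z] by (intro mult_right_mono) auto
        also have "\<dots> = hinge' (p \<epsilon> z) * u z + (\<Sum>i\<in>UNIV. u z * hinge' (S i z))"
          by (simp only: distrib_right sum_distrib_right mult.commute[of "u z"])
        also have "hinge' (p \<epsilon> z) * u z \<le> hinge' (p \<epsilon> z)"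
          using u(2)[OF z] mult_left_le by fastforce
        finally show ?thesis by simp
      next
        case False
        then show ?thesis using K(3)[of z] z by simp
      qed
      then have "c * u z * leaf_density z \<le> (hinge' (p \<epsilon> z) + (\<Sum>i\<in>UNIV. u z * hinge' (S i z))) * leaf_density z"
        using leaf_density_pos[OF z] by (intro mult_right_mono) auto
      then show "c * (u z * leaf_density z) \<le> hinge' (p \<epsilon> z) * leaf_density z + (\<Sum>i\<in>UNIV. u z * hinge' (S i z) * leaf_density z)"
        by (simp add: distrib_right sum_distrib_right mult.assoc)
    qed (intro test_fun_cmult test_fun_add test_fun_sum td tu tS)+
    then have "c * I (\<lambda>z. u z * leaf_density z) \<le>
        I (\<lambda>z. hinge' (p \<epsilon> z) * leaf_density z) + (\<Sum>i\<in>UNIV. I (\<lambda>z. u z * hinge' (S i z) * leaf_density z))"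
      by (simp add: I_cmult I_add I_sum tu td tS test_fun_sum)
    also have "(\<Sum>i\<in>UNIV. I (\<lambda>z. u z * hinge' (S i z) * leaf_density z)) \<le> (\<Sum>i\<in>(UNIV::'n set). m)"
    proof (intro sum_mono mass)
      fix i
      show "leaf_smooth (\<lambda>z. u z * hinge' (S i z))" by (intro leaf_smooth_intros S test_fun_leaf_smooth u)
      show "0 \<le> u z * hinge' (S i z) \<and> u z * hinge' (S i z) \<le> 1" if "z \<in> M" for z
        using u(2)[OF that] hinge'_le_1[of "S i z"] mult_mono[of "u z" 1 "hinge' (S i z)" 1] by simp
      define K' where "K' = K \<inter> {z. r \<le> cmod (z $ i)}"
      have "closed {z::complex^'n. r \<le> cmod (z $ i)}" by (intro closed_Collect_le continuous_intros)
      then have "compact K'" unfolding K'_def using K by blast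
      moreover have "K' \<subseteq> V" using K V(2) by (auto simp: K'_def)
      moreover have "u z * hinge' (S i z) = 0" if z: "z \<in> M - K'" for z
        using K(3)[of z] SrV[of i z] z by (cases "S i z > 0") (auto simp: K'_def)
      ultimately show "supported_in V (\<lambda>z. u z * hinge' (S i z))" unfolding supported_in_def by blast
    qed
    also have "(\<Sum>i\<in>(UNIV::'n set). m) = n * m" by (simp add: n_def)
    finally show ?thesis using I1[OF \<epsilon>(1)] c(1) by (simp add: field_simps)
  qed
  then show ?thesis by blast
qed

end

subsection \<open>The Lelong number of a harmonic functional\<close>

text \<open>AM-GM with coefficients from \<open>\<Xi> h = h + sqrt h\<close> at
  \<open>h = s\<^sup>2\<close>: \<open>1 + 1 / (2 * s)\<close> is its first derivative and
  \<open>1 / (4 * s ^ 3)\<close> minus its second. \<open>\<theta>\<close> and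
  \<open>\<theta>'\<close> stand for \<open>hinge\<close> and \<open>hinge'\<close> of the cutoff,
  \<open>a\<close> and \<open>b\<close> for derivatives of \<open>H\<close> and of the
  cutoff.\<close>

lemma absorb_mixed_term:
  fixes a b s \<theta> \<theta>' :: real
  assumes "s > 0" "\<theta> > 0"
  shows "2 * ((1 + 1 / (2 * s)) * a * (\<theta>' * b)) \<le>
    \<theta> * (1 / (4 * s ^ 3)) * a\<^sup>2 + (\<theta>'\<^sup>2 / \<theta>) * (s * (2 * s + 1)\<^sup>2) * b\<^sup>2"
proof -
  define X where "X = sqrt \<theta> * a / (2 * s * sqrt s)"
  define Y where "Y = \<theta>' / sqrt \<theta> * (sqrt s * (2 * s + 1)) * b"
  have "2 * X * Y \<le> X\<^sup>2 + Y\<^sup>2" using sum_squares_bound[of X Y] by simp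
  moreover have "2 * X * Y = 2 * ((1 + 1 / (2 * s)) * a * (\<theta>' * b))"
    using assms by (simp add: X_def Y_def field_simps)
  moreover have "X\<^sup>2 = \<theta> * (1 / (4 * s ^ 3)) * a\<^sup>2"
    using assms by (simp add: X_def power_divide power_mult_distrib) (simp add: power3_eq_cube power2_eq_square)
  moreover have "Y\<^sup>2 = (\<theta>'\<^sup>2 / \<theta>) * (s * (2 * s + 1)\<^sup>2) * b\<^sup>2"
    using assms by (simp add: Y_def power_divide power_mult_distrib)
  ultimately show ?thesis by simp
qed

text \<open>For \<open>\<Xi> h = h + sqrt h\<close> this is the square of the first derivative
  divided by minus the second: the price of absorbing the mixed term. It also dominates
  \<open>\<Xi>\<close> and tends to 0 with \<open>h\<close>, so a small \<open>H\<close> gives a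
  small error.\<close>

definition weight :: "real \<Rightarrow> real" where "weight h = sqrt h * (2 * sqrt h + 1)\<^sup>2"

lemma weight_ge_0: "h \<ge> 0 \<Longrightarrow> 0 \<le> weight h"
  by (simp add: weight_def)

lemma weight_le_small: "0 \<le> h \<Longrightarrow> h \<le> \<omega> \<Longrightarrow> \<omega> \<le> 1 \<Longrightarrow> weight h \<le> 9 * sqrt \<omega>"
proof -
  assume h: "0 \<le> h" "h \<le> \<omega>" "\<omega> \<le> 1"
  have "(2 * sqrt h + 1)\<^sup>2 \<le> 3\<^sup>2" using h by (intro power_mono) auto
  then have "sqrt h * (2 * sqrt h + 1)\<^sup>2 \<le> sqrt \<omega> * 9" using h by (intro mult_mono) auto
  then show ?thesis by (simp add: weight_def)
qed

text \<open>Quadratic growth is what the potential \<open>U\<close> of a ball tolerates: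
  \<open>U\<close> reaches the size of log (1 / rho), but \<open>U\<^sup>2\<close> times the squared
  distance to the center stays bounded.\<close>

lemma weight_le: "0 \<le> h \<Longrightarrow> weight h \<le> 27 * (1 + h\<^sup>2)"
proof -
  assume h: "0 \<le> h"
  define s where "s = sqrt h"
  have s: "s \<ge> 0" "h = s\<^sup>2" using h by (auto simp: s_def)
  have "weight h \<le> (2 * s + 1) * (2 * s + 1)\<^sup>2"
    unfolding weight_def s_def[symmetric] using s by (intro mult_right_mono) auto
  also have "\<dots> = (2 * s + 1) ^ 3" by (simp add: power2_eq_square power3_eq_cube)
  also have "\<dots> \<le> 27 * (1 + s ^ 4)"
  proof (cases "s \<le> 1")
    case True
    have "(2 * s + 1) ^ 3 \<le> 3 ^ 3" using s True by (intro power_mono) auto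
    also have "(3::real) ^ 3 \<le> 27 * (1 + s ^ 4)" by simp
    finally show ?thesis .
  next
    case False
    have "(2 * s + 1) ^ 3 \<le> (3 * s) ^ 3" using s False by (intro power_mono) auto
    also have "\<dots> = 27 * s ^ 3" by (simp add: power_mult_distrib)
    also have "s ^ 3 \<le> s ^ 4" using False by (intro power_increasing) auto
    finally show ?thesis by simp
  qed
  also have "s ^ 4 = h\<^sup>2" by (simp add: s(2) flip: power_mult)
  finally show ?thesis .
qed

text \<open>Near 0 the weight behaves like a square root. AM-GM with parameter
  \<open>\<delta>\<close> makes it linear in \<open>h\<close> up to a small constant, so that a
  bound of \<open>h\<close> by a constant plus a multiple of the density can be inserted.\<close>

lemma weight_le_linear:
  assumes "0 \<le> h" "h \<le> m" "\<delta> > 0"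
  shows "weight h \<le> (2 * sqrt m + 1)\<^sup>2 * (\<delta> + h / (4 * \<delta>))"
proof -
  have "0 \<le> (sqrt h - 2 * \<delta>)\<^sup>2" by simp
  then have "sqrt h * (4 * \<delta>) \<le> h + 4 * \<delta>\<^sup>2" using assms by (simp add: power2_diff algebra_simps)
  then have "sqrt h \<le> \<delta> + h / (4 * \<delta>)" using assms by (simp add: field_simps power2_eq_square)
  moreover have "(2 * sqrt h + 1)\<^sup>2 \<le> (2 * sqrt m + 1)\<^sup>2" using assms by (intro power_mono) auto
  ultimately have "sqrt h * (2 * sqrt h + 1)\<^sup>2 \<le> (\<delta> + h / (4 * \<delta>)) * (2 * sqrt m + 1)\<^sup>2"
    using assms by (intro mult_mono) auto
  then show ?thesis by (simp add: weight_def mult.commute)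
qed

context linear_foliation
begin

lemma leaf_smooth_weight:
  assumes "leaf_smooth u" "\<And>z. z \<in> M \<Longrightarrow> u z > 0"
  shows "leaf_smooth (\<lambda>z. weight (u z))"
proof -
  have "leaf_smooth (\<lambda>z. sqrt (u z))"
  proof (rule leaf_smooth_cong)
    show "leaf_smooth (\<lambda>z. u z powr (1 / 2))" by (rule leaf_smooth_powr[OF assms])
    show "sqrt (u z) = u z powr (1 / 2)" if "z \<in> M" for z
      using assms(2)[OF that] by (simp add: powr_half_sqrt)
  qed
  then show ?thesis unfolding weight_def power2_eq_square by (intro leaf_smooth_intros)
qed

end

context harmonic_functional
begin

text \<open>The square root added to \<open>H\<close> makes the test function strictly superharmonic where \<open>H\<close> is
  small, which pays for the mixed gradient term created by the cutoff \<open>p\<close>.\<close>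

lemma superharmonic_test:
  assumes H: "leaf_smooth H" "\<And>z. z \<in> M \<Longrightarrow> H z > 0" and p: "leaf_smooth p"
    and supp: "supported_in M (\<lambda>z. max 0 (p z))"
    and sup: "\<And>z. z \<in> M \<Longrightarrow> p z > 0 \<Longrightarrow> lap H z \<le> 0" "\<And>z. z \<in> M \<Longrightarrow> p z > 0 \<Longrightarrow> lap p z \<le> 0"
  shows "I (\<lambda>z. hinge (p z) * - lap H z) \<le> I (\<lambda>z. hinge_weight (p z) * weight (H z) * grad_prod p p z)"
proof -
  define \<Xi> where "\<Xi> h = h + h powr (1 / 2)" for h :: real
  define \<Xi>' where "\<Xi>' h = 1 + (1 / 2) * h powr (- 1 / 2)" for h :: real
  define \<Xi>'' where "\<Xi>'' h = - (1 / 4) * h powr (- 3 / 2)" for h :: real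
  have D: "(\<Xi> has_real_derivative \<Xi>' h) (at h)" "(\<Xi>' has_real_derivative \<Xi>'' h) (at h)" if "h > 0" for h
    unfolding \<Xi>_def \<Xi>'_def \<Xi>''_def using that by (auto intro!: derivative_eq_intros)
  have \<Xi>H: "leaf_smooth (\<lambda>z. \<Xi> (H z))"
    unfolding \<Xi>_def by (intro leaf_smooth_add leaf_smooth_powr H) (use H in auto)
  have hp: "leaf_smooth (\<lambda>z. hinge (p z))" by (intro leaf_smooth_intros p)
  have tw: "test_fun (\<lambda>z. hinge (p z))" "test_fun (\<lambda>z. hinge_weight (p z))"
    unfolding test_fun_def using supp
    by (auto intro: leaf_smooth_hinge leaf_smooth_hinge_weight p supported_in_mono simp: max_def split: if_splits)
  have t: "test_fun (\<lambda>z. \<Xi> (H z) * hinge (p z))" by (intro test_fun_mult2 tw \<Xi>H)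
  have t1: "test_fun (\<lambda>z. hinge (p z) * - lap H z)"
    by (intro test_fun_mult tw leaf_smooth_minus leaf_smooth_lap H)
  have t2: "test_fun (\<lambda>z. hinge_weight (p z) * weight (H z) * grad_prod p p z)"
    by (intro test_fun_mult tw leaf_smooth_weight leaf_smooth_grad_prod H p) (use H in auto)
  have "I (lap (\<lambda>z. \<Xi> (H z) * hinge (p z))) \<le>
      I (\<lambda>z. hinge_weight (p z) * weight (H z) * grad_prod p p z - hinge (p z) * - lap H z)"
  proof (rule I_mono)
    fix z assume z: "z \<in> M"
    have Hz: "H z > 0" by (rule H(2)[OF z])
    define s where "s = sqrt (H z)"
    have s: "s > 0" "H z = s\<^sup>2" using Hz by (simp_all add: s_def)
    have \<Xi>s: "\<Xi> (H z) = s\<^sup>2 + s" "\<Xi>' (H z) = 1 + 1 / (2 * s)" "\<Xi>'' (H z) = - (1 / (4 * s ^ 3))"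
    proof -
      have pw: "H z powr (a / 2) = s powr a" for a
        using s by (simp add: powr_powr flip: powr_numeral)
      show "\<Xi> (H z) = s\<^sup>2 + s" using pw[of 1] s by (simp add: \<Xi>_def)
      show "\<Xi>' (H z) = 1 + 1 / (2 * s)" using pw[of "- 1"] s by (simp add: \<Xi>'_def powr_minus_divide)
      show "\<Xi>'' (H z) = - (1 / (4 * s ^ 3))" using pw[of "- 3"] s
        by (simp add: \<Xi>''_def powr_minus_divide powr_numeral)
    qed
    have lap: "lap (\<lambda>z. \<Xi> (H z) * hinge (p z)) z =
        \<Xi> (H z) * (hinge' (p z) * lap p z + hinge'' (p z) * grad_prod p p z) +
        hinge (p z) * (\<Xi>' (H z) * lap H z + \<Xi>'' (H z) * grad_prod H H z) +
        2 * (\<Xi>' (H z) * hinge' (p z) * grad_prod H p z)"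
    proof -
      have "grad_prod (\<lambda>z. \<Xi> (H z)) (\<lambda>z. hinge (p z)) z = \<Xi>' (H z) * hinge' (p z) * grad_prod H p z"
        unfolding grad_prod_def
        using leaf_deriv_compose[OF H(1) H(1) _ z D(1)[OF Hz]] leaf_deriv_hinge[OF p z]
        by (simp add: algebra_simps)
      then show ?thesis
        using lap_mult[OF \<Xi>H hp z] lap_hinge[OF p z] lap_compose[OF H(1) z D(1)[OF H(2)] D(2)[OF Hz]]
        by simp
    qed
    show "lap (\<lambda>z. \<Xi> (H z) * hinge (p z)) z \<le>
        hinge_weight (p z) * weight (H z) * grad_prod p p z - hinge (p z) * - lap H z"
    proof (cases "p z > 0")
      case True
      have \<theta>: "hinge (p z) > 0" using hinge_gt_0(1)[OF True] .
      have W: "weight (H z) = s * (2 * s + 1)\<^sup>2" by (simp add: weight_def s_def)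
      have "\<Xi> (H z) \<le> weight (H z)"
        using s(1) unfolding \<Xi>s W by (simp add: power2_eq_square algebra_simps)
      then have 1: "\<Xi> (H z) * (hinge'' (p z) * grad_prod p p z) \<le> weight (H z) * (hinge'' (p z) * grad_prod p p z)"
        by (intro mult_right_mono) (simp_all add: grad_prod_ge_0)
      have 2: "\<Xi> (H z) * (hinge' (p z) * lap p z) \<le> 0"
        using sup(2)[OF z True] s(1) unfolding \<Xi>s by (intro mult_nonneg_nonpos) auto
      have 3: "hinge (p z) * (\<Xi>' (H z) * lap H z) \<le> hinge (p z) * lap H z"
      proof -
        have "\<Xi>' (H z) * lap H z \<le> 1 * lap H z"
          using sup(1)[OF z True] s(1) unfolding \<Xi>s by (intro mult_right_mono_neg) auto
        then show ?thesis using \<theta> by simp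
      qed
      \<comment> \<open>Of the two summands, the first cancels against fact \<open>6\<close>, where
        \<open>\<Xi>''\<close> is negative; the second is the part
        \<open>hinge'\<^sup>2 / hinge\<close> of \<open>hinge_weight\<close>.\<close>
      have 4: "2 * (\<Xi>' (H z) * hinge' (p z) * grad_prod H p z) \<le>
          hinge (p z) * (1 / (4 * s ^ 3)) * grad_prod H H z +
          ((hinge' (p z))\<^sup>2 / hinge (p z)) * weight (H z) * grad_prod p p z"
      proof -
        have *: "2 * ((1 + 1 / (2 * s)) * leaf_deriv d H z * (hinge' (p z) * leaf_deriv d p z)) \<le>
            hinge (p z) * (1 / (4 * s ^ 3)) * (leaf_deriv d H z)\<^sup>2 +
            ((hinge' (p z))\<^sup>2 / hinge (p z)) * (s * (2 * s + 1)\<^sup>2) * (leaf_deriv d p z)\<^sup>2" for d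
          by (rule absorb_mixed_term[OF s(1) \<theta>])
        have "2 * (\<Xi>' (H z) * hinge' (p z) * grad_prod H p z) =
            2 * ((1 + 1 / (2 * s)) * leaf_deriv 1 H z * (hinge' (p z) * leaf_deriv 1 p z)) +
            2 * ((1 + 1 / (2 * s)) * leaf_deriv \<i> H z * (hinge' (p z) * leaf_deriv \<i> p z))"
          unfolding \<Xi>s grad_prod_def by (simp only: algebra_simps)
        also have "\<dots> \<le> hinge (p z) * (1 / (4 * s ^ 3)) * (leaf_deriv 1 H z)\<^sup>2 +
            ((hinge' (p z))\<^sup>2 / hinge (p z)) * (s * (2 * s + 1)\<^sup>2) * (leaf_deriv 1 p z)\<^sup>2 +
            (hinge (p z) * (1 / (4 * s ^ 3)) * (leaf_deriv \<i> H z)\<^sup>2 +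
            ((hinge' (p z))\<^sup>2 / hinge (p z)) * (s * (2 * s + 1)\<^sup>2) * (leaf_deriv \<i> p z)\<^sup>2)"
          by (rule add_mono[OF * *])
        also have "\<dots> = hinge (p z) * (1 / (4 * s ^ 3)) * grad_prod H H z +
          ((hinge' (p z))\<^sup>2 / hinge (p z)) * weight (H z) * grad_prod p p z"
          unfolding W grad_prod_def power2_eq_square[of "leaf_deriv _ _ _"] by (simp only: distrib_left add_ac)
        finally show ?thesis .
      qed
      have 5: "hinge_weight (p z) * weight (H z) * grad_prod p p z =
          weight (H z) * (hinge'' (p z) * grad_prod p p z) +
          ((hinge' (p z))\<^sup>2 / hinge (p z)) * weight (H z) * grad_prod p p z"
        unfolding hinge_weight_pos[OF True] by (simp only: algebra_simps)
      have 6: "hinge (p z) * (\<Xi>'' (H z) * grad_prod H H z) = - (hinge (p z) * (1 / (4 * s ^ 3)) * grad_prod H H z)"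
        unfolding \<Xi>s by simp
      show ?thesis unfolding lap 5 distrib_left 6 using 1 2 3 4 by simp
    next
      case False
      then show ?thesis unfolding lap by simp
    qed
  qed (intro test_fun_lap t test_fun_diff t1 t2)+
  then show ?thesis using I_lap[OF t] I_diff[OF t2 t1] by simp
qed

text \<open>A substitute for inner regularity. If \<open>u0\<close> comes within
  \<open>\<tau>\<close> of the supremum of the mass, then \<open>u0 + g * (1 - u0)\<close> still has
  values in [0, 1] and competes for the same supremum, so the mass missed by \<open>u0\<close> is at
  most \<open>\<tau>\<close>.\<close>

lemma near_maximal_test_fun:
  assumes mass: "\<And>u. test_fun u \<Longrightarrow> (\<And>z. z \<in> M \<Longrightarrow> 0 \<le> u z \<and> u z \<le> 1) \<Longrightarrow>
      I (\<lambda>z. u z * leaf_density z) \<le> \<mu>" and "\<tau> > 0"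
  obtains u0 where "test_fun u0" "\<And>z. z \<in> M \<Longrightarrow> 0 \<le> u0 z \<and> u0 z \<le> 1"
    "\<And>g. test_fun g \<Longrightarrow> (\<And>z. z \<in> M \<Longrightarrow> 0 \<le> g z \<and> g z \<le> 1) \<Longrightarrow>
      I (\<lambda>z. g z * (1 - u0 z) * leaf_density z) \<le> \<tau>"
proof -
  define X where "X = {I (\<lambda>z. u z * leaf_density z) |u. test_fun u \<and> (\<forall>z\<in>M. 0 \<le> u z \<and> u z \<le> 1)}"
  have X: "bdd_above X"
    using mass unfolding X_def by (auto intro!: bdd_aboveI[of _ \<mu>])
  have "I (\<lambda>z. 0 * leaf_density z) \<in> X"
    unfolding X_def by (intro CollectI exI[of _ "\<lambda>z. 0"]) (simp add: test_fun_0)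
  then have "\<exists>x\<in>X. Sup X - \<tau> < x" using \<open>\<tau> > 0\<close> by (intro less_cSupD) auto
  then obtain u0 where u0: "test_fun u0" "\<And>z. z \<in> M \<Longrightarrow> 0 \<le> u0 z \<and> u0 z \<le> 1"
    "Sup X - \<tau> < I (\<lambda>z. u0 z * leaf_density z)"
    unfolding X_def by auto
  show thesis
  proof (rule that[OF u0(1,2)])
    fix g assume g: "test_fun g" "\<And>z. z \<in> M \<Longrightarrow> 0 \<le> g z \<and> g z \<le> 1"
    have t: "test_fun (\<lambda>z. g z * (1 - u0 z))"
      by (intro test_fun_mult g leaf_smooth_intros test_fun_leaf_smooth u0)
    have "u0 z + g z * (1 - u0 z) \<le> 1" if "z \<in> M" for z
      using g(2)[OF that] u0(2)[OF that] mult_right_mono[of "g z" 1 "1 - u0 z"] by simp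
    moreover have "0 \<le> u0 z + g z * (1 - u0 z)" if "z \<in> M" for z
      using g(2)[OF that] u0(2)[OF that] by simp
    ultimately have "I (\<lambda>z. (u0 z + g z * (1 - u0 z)) * leaf_density z) \<in> X"
      unfolding X_def using test_fun_add[OF u0(1) t]
      by (intro CollectI exI[of _ "\<lambda>z. u0 z + g z * (1 - u0 z)"]) simp
    then have "I (\<lambda>z. (u0 z + g z * (1 - u0 z)) * leaf_density z) \<le> Sup X"
      using X by (rule cSup_upper)
    moreover have "I (\<lambda>z. (u0 z + g z * (1 - u0 z)) * leaf_density z) =
        I (\<lambda>z. u0 z * leaf_density z) + I (\<lambda>z. g z * (1 - u0 z) * leaf_density z)"
      unfolding distrib_right by (intro I_add test_fun_mult[OF t] test_fun_mult[OF u0(1)] leaf_smooth_density)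
    ultimately show "I (\<lambda>z. g z * (1 - u0 z) * leaf_density z) \<le> \<tau>" using u0(3) by simp
  qed
qed

end

section \<open>Cutoffs near a point\<close>

context linear_foliation
begin

text \<open>For positive \<open>\<epsilon>\<close> and \<open>A\<close>, the term with
  \<open>height\<close> keeps the positive part off the hyperplanes, while the term with
  \<open>dist2 x\<close> keeps it near \<open>x\<close> and makes the function
  superharmonic.\<close>

definition cutoff :: "real \<Rightarrow> real \<Rightarrow> real \<Rightarrow> complex^'n \<Rightarrow> complex^'n \<Rightarrow> real" where
  "cutoff a \<epsilon> A x z = a - \<epsilon> * height z - A * dist2 x z"

lemma leaf_smooth_cutoff: "leaf_smooth (cutoff a \<epsilon> A x)"
  unfolding cutoff_def by (intro leaf_smooth_intros leaf_smooth_height leaf_smooth_dist2)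

lemma cutoff_eq: "cutoff a \<epsilon> A x = (\<lambda>z. a + ((- \<epsilon>) * height z + (- A) * dist2 x z))"
  by (simp add: cutoff_def fun_eq_iff)

lemma lap_cutoff: "z \<in> M \<Longrightarrow> lap (cutoff a \<epsilon> A x) z = - 4 * A * leaf_density z"
  by (simp only: cutoff_eq lap_cmult lap_add lap_const leaf_smooth_add leaf_smooth_mult leaf_smooth_const
      leaf_smooth_dist2 leaf_smooth_height) (simp add: lap_height lap_dist2)

lemma leaf_deriv_cutoff:
  assumes "z \<in> M" "d \<in> {1, \<i>}"
  shows "leaf_deriv d (cutoff a \<epsilon> A x) z = - (\<epsilon> * leaf_deriv d height z + A * leaf_deriv d (dist2 x) z)"
  unfolding cutoff_eq
  by (subst leaf_deriv_add leaf_deriv_cmult;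
      (intro leaf_smooth_intros leaf_smooth_height leaf_smooth_dist2 assms)?)+
     (simp add: leaf_deriv_const[OF leaf_smooth_const leaf_smooth_const assms(2,1)])

text \<open>The gradient of \<open>dist2 x\<close> is controlled by the density, that of
  \<open>height\<close> is only a constant; the elementary bounds of a square of a sum separate the
  two from above and from below.\<close>

lemma grad_cutoff:
  fixes \<epsilon> A :: real and x :: "complex^'n"
  assumes z: "z \<in> M"
  defines "\<Lambda> \<equiv> (cmod (\<Sum>j\<in>UNIV. lam $ j))\<^sup>2"
  shows "grad_prod (cutoff a \<epsilon> A x) (cutoff a \<epsilon> A x) z \<le> 2 * \<epsilon>\<^sup>2 * \<Lambda> + 8 * A\<^sup>2 * (dist2 x z * leaf_density z)"
    and "\<epsilon>\<^sup>2 * \<Lambda> / 2 - 4 * A\<^sup>2 * (dist2 x z * leaf_density z) \<le> grad_prod (cutoff a \<epsilon> A x) (cutoff a \<epsilon> A x) z"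
proof -
  define h1 h2 n1 n2 where "h1 = leaf_deriv 1 height z" "h2 = leaf_deriv \<i> height z"
    "n1 = leaf_deriv 1 (dist2 x) z" "n2 = leaf_deriv \<i> (dist2 x) z"
  have h: "h1\<^sup>2 + h2\<^sup>2 = \<Lambda>"
    using grad_height[OF z] by (simp add: grad_prod_def h1_h2_n1_n2_def \<Lambda>_def power2_eq_square)
  have n: "n1\<^sup>2 + n2\<^sup>2 \<le> 4 * (dist2 x z * leaf_density z)"
    using grad_dist2[OF z, of x] by (simp add: grad_prod_def h1_h2_n1_n2_def power2_eq_square mult_ac)
  have g: "grad_prod (cutoff a \<epsilon> A x) (cutoff a \<epsilon> A x) z = (\<epsilon> * h1 + A * n1)\<^sup>2 + (\<epsilon> * h2 + A * n2)\<^sup>2"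
    by (simp only: grad_prod_def leaf_deriv_cutoff[OF z insertI1] leaf_deriv_cutoff[OF z insertI2[OF singletonI]]
        minus_mult_minus h1_h2_n1_n2_def power2_eq_square)
  have up: "(a + b)\<^sup>2 \<le> 2 * a\<^sup>2 + 2 * b\<^sup>2" for a b :: real
    using sum_squares_bound[of a b] by (simp add: power2_sum)
  have lo: "a\<^sup>2 / 2 - b\<^sup>2 \<le> (a + b)\<^sup>2" for a b :: real
    using zero_le_power2[of "a / 2 + b"] zero_le_power2[of a] by (simp add: power2_sum power_divide field_simps)
  have An: "A\<^sup>2 * (n1\<^sup>2 + n2\<^sup>2) \<le> A\<^sup>2 * (4 * (dist2 x z * leaf_density z))"
    using n by (intro mult_left_mono) auto
  have "grad_prod (cutoff a \<epsilon> A x) (cutoff a \<epsilon> A x) z \<le> 2 * (\<epsilon>\<^sup>2 * (h1\<^sup>2 + h2\<^sup>2)) + 2 * (A\<^sup>2 * (n1\<^sup>2 + n2\<^sup>2))"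
    unfolding g using up[of "\<epsilon> * h1" "A * n1"] up[of "\<epsilon> * h2" "A * n2"]
    by (simp add: power_mult_distrib distrib_left)
  then show "grad_prod (cutoff a \<epsilon> A x) (cutoff a \<epsilon> A x) z \<le> 2 * \<epsilon>\<^sup>2 * \<Lambda> + 8 * A\<^sup>2 * (dist2 x z * leaf_density z)"
    using An unfolding h by simp
  have "\<epsilon>\<^sup>2 * (h1\<^sup>2 + h2\<^sup>2) / 2 - A\<^sup>2 * (n1\<^sup>2 + n2\<^sup>2) \<le> grad_prod (cutoff a \<epsilon> A x) (cutoff a \<epsilon> A x) z"
    unfolding g using lo[of "\<epsilon> * h1" "A * n1"] lo[of "\<epsilon> * h2" "A * n2"]
    by (simp add: power_mult_distrib distrib_left add_divide_distrib)
  then show "\<epsilon>\<^sup>2 * \<Lambda> / 2 - 4 * A\<^sup>2 * (dist2 x z * leaf_density z) \<le> grad_prod (cutoff a \<epsilon> A x) (cutoff a \<epsilon> A x) z"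
    using An unfolding h by simp
qed

lemma cutoff_pos_dist:
  assumes "z \<in> M" "cutoff a \<epsilon> A x z > 0" "\<epsilon> > 0"
  shows "A * dist2 x z < a"
  using assms(2) mult_pos_pos[OF assms(3) height_pos[OF assms(1)]] unfolding cutoff_def by linarith

lemma cutoff_pos_ball:
  assumes "z \<in> M" "cutoff a \<epsilon> A x z > 0" "\<epsilon> > 0" "A > 0" "a \<le> A * c0\<^sup>2" "c0 > 0"
  shows "z \<in> cball x c0"
proof -
  have "A * dist2 x z < A * c0\<^sup>2" using cutoff_pos_dist[OF assms(1-3)] assms(5) by simp
  then have "(dist x z)\<^sup>2 < c0\<^sup>2" using assms(4) by (simp add: dist2_eq dist_norm norm_minus_commute)
  then show ?thesis using assms(6) by (simp add: power2_less_imp_less less_imp_le)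
qed

lemma supported_in_cutoff:
  assumes "\<epsilon> > 0" "A > 0" "a \<le> A * c0\<^sup>2" "c0 > 0" "cball x c0 \<subseteq> polydisc 1"
  shows "supported_in M (\<lambda>z. max 0 (cutoff a \<epsilon> A x z))"
proof -
  define K where "K = cball x c0 \<inter> {z. \<forall>j. exp (- (a / \<epsilon>)) \<le> cmod (z $ j)}"
  have "{z. \<forall>j. exp (- (a / \<epsilon>)) \<le> cmod (z $ j)} = (\<Inter>j. {z::complex^'n. exp (- (a / \<epsilon>)) \<le> cmod (z $ j)})" by auto
  moreover have "closed \<dots>" by (intro closed_INT closed_Collect_le ballI continuous_intros)
  ultimately have "compact K" unfolding K_def by (metis compact_Int_closed compact_cball)
  moreover have "K \<subseteq> M"
  proof
    fix z assume z: "z \<in> K"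
    then have "cmod (z $ j) < 1" for j using assms(5) by (auto simp: K_def polydisc_def)
    moreover have "0 < cmod (z $ j)" for j
      using z less_le_trans[OF exp_gt_zero, of "- (a / \<epsilon>)"] by (auto simp only: K_def)
    ultimately show "z \<in> M" by (simp add: punctured_polydisc_def)
  qed
  moreover have "max 0 (cutoff a \<epsilon> A x z) = 0" if z: "z \<in> M - K" for z
  proof (rule ccontr)
    assume "max 0 (cutoff a \<epsilon> A x z) \<noteq> 0"
    then have c: "cutoff a \<epsilon> A x z > 0" by (auto simp: max_def split: if_splits)
    have zM: "z \<in> M" using z by simp
    have "\<epsilon> * height z \<le> a"
      using c mult_nonneg_nonneg[OF less_imp_le[OF assms(2)] dist2_ge_0[of x z]] unfolding cutoff_def by linarith
    then have "height z \<le> a / \<epsilon>" using assms(1) by (simp add: field_simps)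
    then have "exp (- (a / \<epsilon>)) \<le> cmod (z $ j)" for j by (rule cmod_ge_exp_height[OF zM])
    then have "z \<in> K" using cutoff_pos_ball[OF zM c assms(1,2,3,4)] by (simp add: K_def)
    then show False using z by simp
  qed
  ultimately show ?thesis unfolding supported_in_def by blast
qed

lemma test_fun_of_cutoff:
  assumes "supported_in M (\<lambda>z. max 0 (p z))" "leaf_smooth p"
  shows "test_fun (\<lambda>z. hinge (p z))" "test_fun (\<lambda>z. hinge' (p z))" "test_fun (\<lambda>z. hinge'' (p z))"
    "test_fun (\<lambda>z. hinge_weight (p z))"
  unfolding test_fun_def using assms
  by (auto intro: leaf_smooth_hinge leaf_smooth_hinge_weight supported_in_mono simp: max_def split: if_splits)

end

context harmonic_functional
begin

lemma I_mass_le: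
  assumes mass: "\<And>u. test_fun u \<Longrightarrow> (\<And>z. z \<in> M \<Longrightarrow> 0 \<le> u z \<and> u z \<le> 1) \<Longrightarrow> I (\<lambda>z. u z * leaf_density z) \<le> \<mu>"
    and "test_fun u" "c > 0" "\<And>z. z \<in> M \<Longrightarrow> 0 \<le> u z \<and> u z \<le> c"
  shows "I (\<lambda>z. u z * leaf_density z) \<le> c * \<mu>"
  by (rule I_density_le[of M]) (use assms in \<open>auto simp: test_fun_def\<close>)

text \<open>Test with \<open>hinge\<close> of the cutoff \<open>q\<close> that lies one level
  higher. Its gradient squared is at least \<open>\<epsilon>\<^sup>2 * \<Lambda> / 2\<close> up to a
  density term, and \<open>hinge'' (q z)\<close> is bounded below wherever the lower cutoff is
  positive. All density terms are paid by the mass \<open>\<mu>\<close>. The level 2 of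
  \<open>q\<close> explains \<open>2 \<le> A * c0\<^sup>2\<close>.\<close>

lemma cutoff_growth:
  assumes mass: "\<And>u. test_fun u \<Longrightarrow> (\<And>z. z \<in> M \<Longrightarrow> 0 \<le> u z \<and> u z \<le> 1) \<Longrightarrow> I (\<lambda>z. u z * leaf_density z) \<le> \<mu>"
    and \<epsilon>: "\<epsilon> > 0" and A: "A > 0" "2 \<le> A * c0\<^sup>2" and c0: "c0 > 0" "cball x c0 \<subseteq> polydisc 1"
  shows "\<epsilon>\<^sup>2 * (cmod (\<Sum>j\<in>UNIV. lam $ j))\<^sup>2 * I (\<lambda>z. hinge_weight (cutoff 1 \<epsilon> A x z)) \<le> 864 * exp 1 * (220 * A * \<mu>)"
proof -
  define \<Lambda> where "\<Lambda> = (cmod (\<Sum>j\<in>UNIV. lam $ j))\<^sup>2"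
  have \<Lambda>0: "\<Lambda> \<ge> 0" by (simp add: \<Lambda>_def)
  define p q where "p = cutoff 1 \<epsilon> A x" "q = cutoff 2 \<epsilon> A x"
  have qp: "q z = p z + 1" for z by (simp add: p_q_def cutoff_def)
  have sm: "leaf_smooth p" "leaf_smooth q" by (simp_all add: p_q_def leaf_smooth_cutoff)
  have supp: "supported_in M (\<lambda>z. max 0 (p z))" "supported_in M (\<lambda>z. max 0 (q z))"
    unfolding p_q_def using A c0 by (auto intro!: supported_in_cutoff[OF \<epsilon> A(1) _ c0])
  note tp = test_fun_of_cutoff[OF supp(1) sm(1)] and tq = test_fun_of_cutoff[OF supp(2) sm(2)]
  define N where "N z = A * dist2 x z" for z
  have N: "leaf_smooth N" unfolding N_def by (intro leaf_smooth_intros leaf_smooth_dist2)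
  have t1: "test_fun (\<lambda>z. hinge' (q z) * leaf_density z)" and t2: "test_fun (\<lambda>z. (hinge'' (q z) * N z) * leaf_density z)"
    and t3: "test_fun (\<lambda>z. hinge_weight (p z))"
    by (intro test_fun_mult tp tq leaf_smooth_density N)+
  have th: "test_fun (lap (\<lambda>z. hinge (q z)))" by (intro test_fun_lap tq)
  \<comment> \<open>Where \<open>p z > 0\<close> one has 1 < q <= 2, hence
    \<open>hinge'' (q z) \<ge> exp (- 1) / 8\<close>, while \<open>hinge_weight\<close> is at most
    54; and 432 = 54 * 8.\<close>
  have k: "hinge_weight (p z) \<le> 432 * exp 1 * hinge'' (q z)" if z: "z \<in> M" for z
  proof (cases "p z > 0")
    case True
    have q1: "q z > 1" using True qp by simp
    have q2: "q z \<le> 2"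
      using mult_pos_pos[OF \<epsilon> height_pos[OF z]] mult_nonneg_nonneg[OF less_imp_le[OF A(1)] dist2_ge_0[of x z]]
      unfolding p_q_def cutoff_def by linarith
    have "exp (- 1) / 8 \<le> exp (- (1 / q z)) / q z ^ 3"
    proof (rule frac_le)
      show "exp (- 1) \<le> exp (- (1 / q z))" using q1 by simp
      have "q z ^ 3 \<le> 2 ^ 3" using q1 q2 by (intro power_mono) auto
      then show "q z ^ 3 \<le> 8" by simp
    qed (use q1 in auto)
    then have "exp (- 1) / 8 \<le> hinge'' (q z)" using q1 by (simp add: hinge_pos)
    then have "432 * exp 1 * (exp (- 1) / 8) \<le> 432 * exp 1 * hinge'' (q z)" by (intro mult_left_mono) auto
    moreover have "432 * exp 1 * (exp (- 1) / 8) = (54::real)" by (simp add: exp_minus)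
    ultimately show ?thesis using hinge_weight_le[of "p z"] by linarith
  qed simp
  have "I (\<lambda>z. \<epsilon>\<^sup>2 * \<Lambda> / 2 * hinge'' (q z) - 4 * A * (hinge'' (q z) * N z * leaf_density z + hinge' (q z) * leaf_density z))
      \<le> I (lap (\<lambda>z. hinge (q z)))"
  proof (rule I_mono)
    show "test_fun (\<lambda>z. \<epsilon>\<^sup>2 * \<Lambda> / 2 * hinge'' (q z) - 4 * A * (hinge'' (q z) * N z * leaf_density z + hinge' (q z) * leaf_density z))"
      by (intro test_fun_diff test_fun_cmult test_fun_add t1 t2 tq)
    fix z assume z: "z \<in> M"
    have "hinge'' (q z) * (\<epsilon>\<^sup>2 * \<Lambda> / 2 - 4 * A\<^sup>2 * (dist2 x z * leaf_density z)) \<le> hinge'' (q z) * grad_prod q q z"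
      unfolding p_q_def(2) \<Lambda>_def by (intro mult_left_mono grad_cutoff z) simp
    then show "\<epsilon>\<^sup>2 * \<Lambda> / 2 * hinge'' (q z) - 4 * A * (hinge'' (q z) * N z * leaf_density z + hinge' (q z) * leaf_density z)
        \<le> lap (\<lambda>z. hinge (q z)) z"
      unfolding lap_hinge[OF sm(2) z] using lap_cutoff[OF z, of 2 \<epsilon> A x]
      by (simp add: p_q_def(2)[symmetric] N_def algebra_simps power2_eq_square)
  qed (rule th)
  moreover have "I (\<lambda>z. \<epsilon>\<^sup>2 * \<Lambda> / 2 * hinge'' (q z) - 4 * A * (hinge'' (q z) * N z * leaf_density z + hinge' (q z) * leaf_density z))
      = \<epsilon>\<^sup>2 * \<Lambda> / 2 * I (\<lambda>z. hinge'' (q z)) - 4 * A * (I (\<lambda>z. hinge'' (q z) * N z * leaf_density z) + I (\<lambda>z. hinge' (q z) * leaf_density z))"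
    by (simp only: I_diff[OF test_fun_cmult[OF tq(3)] test_fun_cmult[OF test_fun_add[OF t2 t1]]]
        I_cmult[OF tq(3)] I_cmult[OF test_fun_add[OF t2 t1]] I_add[OF t2 t1])
  moreover have m1: "I (\<lambda>z. hinge' (q z) * leaf_density z) \<le> 1 * \<mu>"
    by (rule I_mass_le[OF mass tq(2)]) (simp_all add: hinge'_le_1)
  moreover have m2: "I (\<lambda>z. hinge'' (q z) * N z * leaf_density z) \<le> 54 * \<mu>"
  proof (rule I_mass_le[OF mass test_fun_mult[OF tq(3) N]])
    fix z assume z: "z \<in> M"
    show "0 \<le> hinge'' (q z) * N z \<and> hinge'' (q z) * N z \<le> 54"
    proof (cases "q z > 0")
      case True
      then have "N z \<le> 2" "0 \<le> N z"
        using cutoff_pos_dist[OF z _ \<epsilon>, of 2 A x] dist2_ge_0[of x z] A(1) by (simp_all add: p_q_def N_def)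
      then show ?thesis using hinge''_le[of "q z"] mult_mono[of "hinge'' (q z)" 27 "N z" 2] by simp
    qed simp
  qed simp_all
  moreover have "4 * A * (I (\<lambda>z. hinge'' (q z) * N z * leaf_density z) + I (\<lambda>z. hinge' (q z) * leaf_density z)) \<le>
      4 * A * (54 * \<mu> + 1 * \<mu>)"
    using A(1) by (intro mult_left_mono add_mono m1 m2) simp
  ultimately have 1: "\<epsilon>\<^sup>2 * \<Lambda> / 2 * I (\<lambda>z. hinge'' (q z)) \<le> 4 * A * (54 * \<mu> + 1 * \<mu>)"
    using I_lap[OF tq(1)] by linarith
  have "I (\<lambda>z. hinge_weight (p z)) \<le> I (\<lambda>z. 432 * exp 1 * hinge'' (q z))"
    by (rule I_mono[OF tp(4) test_fun_cmult[OF tq(3)] k])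
  then have "\<epsilon>\<^sup>2 * \<Lambda> * I (\<lambda>z. hinge_weight (p z)) \<le> \<epsilon>\<^sup>2 * \<Lambda> * (432 * exp 1 * I (\<lambda>z. hinge'' (q z)))"
    unfolding I_cmult[OF tq(3)] using \<Lambda>0 by (intro mult_left_mono) auto
  also have "\<dots> = 864 * exp 1 * (\<epsilon>\<^sup>2 * \<Lambda> / 2 * I (\<lambda>z. hinge'' (q z)))" by simp
  also have "\<dots> \<le> 864 * exp 1 * (4 * A * (54 * \<mu> + 1 * \<mu>))" by (intro mult_left_mono 1) auto
  also have "\<dots> = 864 * exp 1 * (220 * A * \<mu>)" by simp
  finally show ?thesis unfolding \<Lambda>_def p_q_def .
qed

end

section \<open>The logarithmic potential of a ball\<close>

context linear_foliation
begin

definition ball_potential :: "real \<Rightarrow> real \<Rightarrow> complex^'n \<Rightarrow> complex^'n \<Rightarrow> real" where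
  "ball_potential B \<eta> x z = (ln B - ln (dist2 x z + \<eta>)) / 2"

text \<open>In the Laplacian of the logarithm of \<open>f = dist2 x + \<eta>\<close> the gradient
  term uses up only the part \<open>dist2 x\<close> of \<open>f\<close>; the remaining
  \<open>\<eta>\<close> makes \<open>- lap\<close> of order density / \<open>\<eta>\<close> on the
  ball of radius sqrt \<open>\<eta>\<close>. The fourth bound is ln y <= y with y = sqrt (B /
  f).\<close>

lemma ball_potential:
  assumes \<eta>: "0 < \<eta>" "\<eta> < 1" and B: "\<forall>z\<in>M. dist2 x z + 1 \<le> B" "B > 0"
  shows "leaf_smooth (ball_potential B \<eta> x)"
    and "z \<in> M \<Longrightarrow> 0 < ball_potential B \<eta> x z"
    and "z \<in> M \<Longrightarrow> lap (ball_potential B \<eta> x) z \<le> - (2 * \<eta> * leaf_density z / (dist2 x z + \<eta>)\<^sup>2)"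
    and "z \<in> M \<Longrightarrow> (ball_potential B \<eta> x z)\<^sup>2 * dist2 x z \<le> B"
    and "z \<in> M \<Longrightarrow> ball_potential B \<eta> x z \<le> (ln B - ln \<eta>) / 2"
proof -
  define f where "f z = dist2 x z + \<eta>" for z
  have f: "leaf_smooth f" "\<And>z. f z > 0"
    using \<eta> dist2_ge_0[of x] unfolding f_def
    by (auto intro!: leaf_smooth_add leaf_smooth_dist2 add_nonneg_pos)
  have lnf: "leaf_smooth (\<lambda>z. ln (f z))" by (rule leaf_smooth_ln[OF f(1)]) (rule f(2))
  have eq: "ball_potential B \<eta> x = (\<lambda>z. (1 / 2) * ln B + (- 1 / 2) * ln (f z))"
    by (simp add: ball_potential_def f_def fun_eq_iff diff_divide_distrib)
  show "leaf_smooth (ball_potential B \<eta> x)"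
    unfolding eq by (intro leaf_smooth_intros lnf)
  {
    assume z: "z \<in> M"
    have fB: "f z < B" using B(1) z \<eta> by (force simp: f_def)
    have "ln (f z) < ln B" using fB f(2)[of z] by simp
    then show pos: "0 < ball_potential B \<eta> x z" by (simp add: ball_potential_def f_def)
    have df: "leaf_deriv d f z = leaf_deriv d (dist2 x) z" if "d \<in> {1, \<i>}" for d
      using leaf_deriv_diff_const[OF leaf_smooth_dist2 that z, of x "- \<eta>"] by (simp add: f_def[abs_def])
    have lapf: "lap f z = 4 * leaf_density z"
      using lap_diff_const[OF leaf_smooth_dist2 z, of x "- \<eta>"] lap_dist2[OF z] by (simp add: f_def[abs_def])
    have gf: "grad_prod f f z \<le> 4 * leaf_density z * dist2 x z"
      using grad_dist2[OF z, of x] df by (simp add: grad_prod_def)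
    have lapln: "lap (\<lambda>z. ln (f z)) z = inverse (f z) * lap f z - inverse ((f z)\<^sup>2) * grad_prod f f z"
    proof -
      have d1: "(ln has_real_derivative inverse (f z)) (at (f z))" for z
        by (rule DERIV_ln[OF f(2)])
      have d2: "(inverse has_real_derivative - (inverse ((f z)\<^sup>2))) (at (f z))"
        using DERIV_inverse[of "f z"] f(2)[of z] by (simp add: power2_eq_square numeral_2_eq_2)
      show ?thesis using lap_compose[of f z ln inverse, OF f(1) z d1 d2] by simp
    qed
    have "lap (ball_potential B \<eta> x) z = (- 1 / 2) * lap (\<lambda>z. ln (f z)) z"
      unfolding eq using z by (simp only: lap_add lap_cmult lap_const leaf_smooth_const leaf_smooth_mult lnf)
    also have "\<dots> = - (f z * lap f z - grad_prod f f z) / (2 * (f z)\<^sup>2)"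
      unfolding lapln using f(2)[of z] by (simp add: field_simps power2_eq_square)
    also have "\<dots> \<le> - (4 * leaf_density z * \<eta>) / (2 * (f z)\<^sup>2)"
      using gf by (intro divide_right_mono) (simp_all add: lapf f_def algebra_simps)
    finally show "lap (ball_potential B \<eta> x) z \<le> - (2 * \<eta> * leaf_density z / (dist2 x z + \<eta>)\<^sup>2)"
      by (simp add: f_def mult_ac)
    define y where "y = sqrt (B / f z)"
    have y: "y > 0" using f(2)[of z] B(2) by (simp add: y_def)
    have "ball_potential B \<eta> x z = ln y"
      using f(2)[of z] B(2) by (simp add: ball_potential_def y_def ln_sqrt ln_div f_def)
    also have "\<dots> \<le> y" using ln_less_self[OF y] by simp
    finally have "(ball_potential B \<eta> x z)\<^sup>2 \<le> y\<^sup>2" using pos by (intro power_mono) auto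
    then have "(ball_potential B \<eta> x z)\<^sup>2 * dist2 x z \<le> y\<^sup>2 * dist2 x z"
      by (intro mult_right_mono dist2_ge_0)
    also have "\<dots> = B * (dist2 x z / f z)"
      using f(2)[of z] B(2) by (simp add: y_def)
    also have "\<dots> \<le> B * 1"
      using f(2)[of z] B(2) \<eta> by (intro mult_left_mono) (simp_all add: f_def)
    finally show "(ball_potential B \<eta> x z)\<^sup>2 * dist2 x z \<le> B" by simp
    have "ln \<eta> \<le> ln (f z)" using \<eta> dist2_ge_0[of x z] by (simp add: f_def)
    then show "ball_potential B \<eta> x z \<le> (ln B - ln \<eta>) / 2" by (simp add: ball_potential_def f_def)
  }
qed

end

context harmonic_functional
begin

text \<open>\<open>H\<close> is a smooth minimum of the logarithmic potential of the ball, of \<open>W\<close>, which makes it small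
  where \<open>u0\<close> carries the mass, and of \<open>V\<close>, which makes it small at infinity.\<close>

lemma lelong_step:
  fixes R \<mu> B c0 \<omega> \<tau> :: real
  assumes mass: "\<And>u. test_fun u \<Longrightarrow> (\<And>z. z \<in> M \<Longrightarrow> 0 \<le> u z \<and> u z \<le> 1) \<Longrightarrow> I (\<lambda>z. u z * leaf_density z) \<le> \<mu>"
    and c0: "c0 > 0" "cball x c0 \<subseteq> polydisc 1"
    and R: "R > 0" "ln B \<le> 2 * R" "2 / c0\<^sup>2 * (exp (- R))\<^sup>2 \<le> 1 / 4"
    and B: "B \<ge> 2" "\<And>z. z \<in> M \<Longrightarrow> dist2 x z + 1 \<le> B"
    and W: "leaf_smooth W" "\<And>z. z \<in> M \<Longrightarrow> W z > 0" "\<And>z. z \<in> M \<Longrightarrow> z \<in> cball x c0 \<Longrightarrow> lap W z \<le> 0"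
      "\<And>z. z \<in> M \<Longrightarrow> z \<in> ball x (exp (- R)) \<Longrightarrow> R \<le> W z"
    and V: "\<And>n. leaf_smooth (V n)" "\<And>n z. z \<in> M \<Longrightarrow> V n z > 0"
      "\<And>n z. z \<in> M \<Longrightarrow> z \<in> cball x c0 \<Longrightarrow> lap (V n) z \<le> 0"
      "\<And>K. compact K \<Longrightarrow> K \<subseteq> M \<Longrightarrow> \<exists>n::nat. \<forall>z\<in>K. 1 \<le> V n z"
      "\<And>n \<kappa>. \<kappa> > 0 \<Longrightarrow> \<exists>C. \<forall>z\<in>M \<inter> cball x c0. V n z \<le> \<kappa> + C * leaf_density z"
    and u0: "test_fun u0" "\<And>z. z \<in> M \<Longrightarrow> 0 \<le> u0 z \<and> u0 z \<le> 1"
      "\<And>z. z \<in> M \<Longrightarrow> u0 z \<noteq> 0 \<Longrightarrow> W z \<le> \<omega>"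
      "\<And>g. test_fun g \<Longrightarrow> (\<And>z. z \<in> M \<Longrightarrow> 0 \<le> g z \<and> g z \<le> 1) \<Longrightarrow>
        I (\<lambda>z. g z * (1 - u0 z) * leaf_density z) \<le> \<tau>"
    and \<omega>: "0 < \<omega>" "\<omega> \<le> 1"
    and u: "leaf_smooth u" "supported_in (ball x (exp (- R)) \<inter> M) u" "\<And>z. z \<in> M \<Longrightarrow> 0 \<le> u z \<and> u z \<le> 1"
  shows "hinge (1 / 2) / (32 * (exp (- R))\<^sup>2) * I (\<lambda>z. u z * leaf_density z) \<le>
    8 * (2 / c0\<^sup>2)\<^sup>2 * (486 * sqrt \<omega> * B * \<mu> + 2916 * B * \<tau>)"
proof (rule field_le_epsilon)
  \<comment> \<open>\<open>\<kappa>\<close> is spent in two halves on the terms that come from the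
    gradient of \<open>height\<close>: one made small by \<open>\<delta>\<close>, the other by
    \<open>\<epsilon>\<close>.\<close>
  fix \<kappa> :: real assume \<kappa>: "\<kappa> > 0"
  define \<Lambda> where "\<Lambda> = (cmod (\<Sum>j\<in>UNIV. lam $ j))\<^sup>2"
  define A where "A = 2 / c0\<^sup>2"
  have A: "A > 0" "2 \<le> A * c0\<^sup>2" "1 \<le> A * c0\<^sup>2" using c0 by (simp_all add: A_def)
  define \<eta> where "\<eta> = (exp (- R))\<^sup>2"
  have \<eta>: "0 < \<eta>" "\<eta> < 1" "ln \<eta> = - 2 * R"
    using R by (simp_all add: \<eta>_def power_less_one_iff flip: exp_of_nat_mult)
  have B0: "B > 0" using B by simp
  have \<mu>0: "0 \<le> \<mu>" using mass[OF test_fun_0] by (simp add: I_0)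
  define U where "U = ball_potential B \<eta> x"
  have "\<forall>z\<in>M. dist2 x z + 1 \<le> B" using B(2) by blast
  note bp = ball_potential[OF \<eta>(1,2) this B0, folded U_def]
  have U2R: "U z \<le> 2 * R" if "z \<in> M" for z using bp(5)[OF that] \<eta>(3) R(2) by simp

  obtain Ku where Ku: "compact Ku" "Ku \<subseteq> ball x (exp (- R)) \<inter> M" "\<And>z. z \<in> M - Ku \<Longrightarrow> u z = 0"
    using u(2) unfolding supported_in_def by blast
  then obtain n where n: "\<And>z. z \<in> Ku \<Longrightarrow> 1 \<le> V n z" using V(4)[of Ku] by blast
  \<comment> \<open>\<open>2 * R\<close> bounds \<open>U\<close> on \<open>M\<close>, so on
    \<open>Ku\<close>, where \<open>V n \<ge> 1\<close>, including \<open>V'\<close> lowers the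
    harmonic mean only by a bounded factor.\<close>
  define V' where "V' z = (2 * R) * V n z" for z
  have V': "leaf_smooth V'" "\<And>z. z \<in> M \<Longrightarrow> V' z > 0"
    unfolding V'_def using V(1,2) R by (auto intro!: leaf_smooth_intros)
  have V'lap: "lap V' z \<le> 0" if "z \<in> M" "z \<in> cball x c0" for z
    unfolding V'_def using lap_cmult[OF V(1) that(1), of "2 * R" n] V(3)[OF that, of n] R
    by (simp add: mult_nonneg_nonpos)
  define G where "G = hmean U W"
  have G: "leaf_smooth G" "\<And>z. z \<in> M \<Longrightarrow> G z > 0"
    unfolding G_def using bp W by (auto intro!: leaf_smooth_hmean hmean_pos)
  define H where "H = hmean G V'"
  have H: "leaf_smooth H" "\<And>z. z \<in> M \<Longrightarrow> H z > 0"
    unfolding H_def using G V' by (auto intro!: leaf_smooth_hmean hmean_pos)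
  have HG: "H z \<le> G z" "H z \<le> V' z" and GU: "G z \<le> U z" "G z \<le> W z" if "z \<in> M" for z
    using that hmean_le G V' bp(2) W unfolding H_def G_def by auto
  have HU: "H z \<le> U z" "H z \<le> W z" if "z \<in> M" for z
    using HG[OF that] GU[OF that] by auto
  have lapU: "lap U z \<le> 0" if "z \<in> M" for z
  proof -
    have "0 \<le> 2 * \<eta> * leaf_density z / (dist2 x z + \<eta>)\<^sup>2" using \<eta> leaf_density_pos[OF that] by simp
    then show ?thesis using bp(3)[OF that] by linarith
  qed
  have lapH: "lap H z \<le> (H z / U z)\<^sup>2 * lap U z" if z: "z \<in> M" "z \<in> cball x c0" for z
  proof -
    have "lap G z \<le> (G z / U z)\<^sup>2 * lap U z + (G z / W z)\<^sup>2 * lap W z"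
      unfolding G_def by (rule lap_hmean_le[OF bp(1,2) W(1,2) z(1)])
    also have "\<dots> \<le> (G z / U z)\<^sup>2 * lap U z"
      using W(3)[OF z] by (simp add: mult_nonneg_nonpos)
    finally have g: "lap G z \<le> (G z / U z)\<^sup>2 * lap U z" .
    have "lap H z \<le> (H z / G z)\<^sup>2 * lap G z + (H z / V' z)\<^sup>2 * lap V' z"
      unfolding H_def by (rule lap_hmean_le[OF G V' z(1)])
    also have "\<dots> \<le> (H z / G z)\<^sup>2 * lap G z"
      using V'lap[OF z] by (simp add: mult_nonneg_nonpos)
    also have "\<dots> \<le> (H z / G z)\<^sup>2 * ((G z / U z)\<^sup>2 * lap U z)"
      by (intro mult_left_mono g) simp
    also have "\<dots> = (H z / U z)\<^sup>2 * lap U z"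
      using G(2)[OF z(1)] by (simp add: power_divide)
    finally show ?thesis .
  qed
  have lapH0: "lap H z \<le> 0" if z: "z \<in> M" "z \<in> cball x c0" for z
    using lapH[OF z] lapU[OF z(1)] mult_nonneg_nonpos[of "(H z / U z)\<^sup>2" "lap U z"] by simp

  text \<open>\<open>\<delta>\<close> and then \<open>\<epsilon>\<close> are chosen to make the contribution of the cutoff at infinity negligible.\<close>
  define Q where "Q = (2 * sqrt (2 * R) + 1)\<^sup>2"
  have "2 * sqrt (2 * R) + 1 > 0" using R(1) by (intro add_nonneg_pos) auto
  then have Q: "Q > 0" unfolding Q_def by (rule zero_less_power)
  define C2 where "C2 = 864 * exp 1 * (220 * A * \<mu>)"
  have C2: "C2 \<ge> 0" using A \<mu>0 by (simp add: C2_def)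
  define \<delta> where "\<delta> = \<kappa> / (8 * Q * (C2 + 1))"
  have \<delta>: "\<delta> > 0" using \<kappa> Q C2 by (simp add: \<delta>_def)
  have \<delta>\<kappa>: "4 * Q * \<delta> * C2 \<le> \<kappa> / 2"
  proof -
    have "8 * Q * (C2 + 1) \<noteq> 0" using Q C2 by simp
    then have "\<delta> * (8 * Q * (C2 + 1)) = \<kappa>" using nonzero_eq_divide_eq[THEN iffD1, OF _ \<delta>_def] by blast
    then have "4 * Q * \<delta> * (C2 + 1) = \<kappa> / 2" by (simp add: algebra_simps)
    moreover have "4 * Q * \<delta> * C2 \<le> 4 * Q * \<delta> * (C2 + 1)" using Q \<delta> by (intro mult_left_mono) auto
    ultimately show ?thesis by simp
  qed
  have "2 * \<delta>\<^sup>2 / R > 0" using \<delta> R by simp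
  from V(5)[OF this, of n] obtain C where "\<forall>z\<in>M \<inter> cball x c0. V n z \<le> 2 * \<delta>\<^sup>2 / R + C * leaf_density z" ..
  then have C: "\<And>z. z \<in> M \<Longrightarrow> z \<in> cball x c0 \<Longrightarrow> V n z \<le> 2 * \<delta>\<^sup>2 / R + C * leaf_density z"
    by blast
  define C3 where "C3 = Q * (R / (2 * \<delta>) * \<bar>C\<bar>)"
  have C3: "C3 \<ge> 0" using Q R \<delta> by (simp add: C3_def)
  \<comment> \<open>\<open>H\<close> is at most \<open>V' = 2 * R * V n\<close>. The constant
    \<open>2 * \<delta>\<^sup>2 / R\<close> in the bound of \<open>V n\<close> is tuned so that
    \<open>H / (4 * \<delta>)\<close> contributes just one more \<open>\<delta>\<close>. Only the
    constant part will be integrated against the area, the rest against the mass.\<close>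
  have wH: "weight (H z) \<le> 2 * Q * \<delta> + C3 * leaf_density z" if z: "z \<in> M" "z \<in> cball x c0" for z
  proof -
    have H0: "0 \<le> H z" "H z \<le> 2 * R" using H(2)[OF z(1)] HU(1)[OF z(1)] U2R[OF z(1)] by auto
    have "H z \<le> 2 * R * V n z" using HG(2)[OF z(1)] by (simp add: V'_def)
    also have "\<dots> \<le> 2 * R * (2 * \<delta>\<^sup>2 / R + \<bar>C\<bar> * leaf_density z)"
    proof (intro mult_left_mono)
      have "C * leaf_density z \<le> \<bar>C\<bar> * leaf_density z"
        using leaf_density_pos[OF z(1)] by (intro mult_right_mono) auto
      then show "V n z \<le> 2 * \<delta>\<^sup>2 / R + \<bar>C\<bar> * leaf_density z" using C[OF z] by simp
    qed (use R in simp)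
    also have "\<dots> = 4 * \<delta> * (\<delta> + R / (2 * \<delta>) * \<bar>C\<bar> * leaf_density z)"
      using R \<delta> by (simp add: field_simps power2_eq_square)
    finally have "H z / (4 * \<delta>) \<le> \<delta> + R / (2 * \<delta>) * \<bar>C\<bar> * leaf_density z"
      using \<delta> by (simp add: divide_le_eq mult.commute)
    then have "Q * (\<delta> + H z / (4 * \<delta>)) \<le> Q * (\<delta> + (\<delta> + R / (2 * \<delta>) * \<bar>C\<bar> * leaf_density z))"
      using Q by (intro mult_left_mono) auto
    moreover have "weight (H z) \<le> Q * (\<delta> + H z / (4 * \<delta>))"
      unfolding Q_def by (rule weight_le_linear[OF H0 \<delta>])
    ultimately have "weight (H z) \<le> Q * (\<delta> + (\<delta> + R / (2 * \<delta>) * \<bar>C\<bar> * leaf_density z))" by (rule order_trans[rotated])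
    then show ?thesis by (simp add: C3_def algebra_simps)
  qed
  have "bounded (height ` Ku)"
    using Ku leaf_smooth_continuous_on[OF leaf_smooth_height]
    by (intro compact_imp_bounded compact_continuous_image) (auto intro: continuous_on_subset)
  then obtain h where h: "h > 0" "\<And>z. z \<in> Ku \<Longrightarrow> height z \<le> h"
    unfolding bounded_pos by (metis abs_le_D1 imageI real_norm_def)
  define C4 where "C4 = 2 * \<Lambda> * C3 * (54 * \<mu>)"
  have C4: "C4 \<ge> 0" using C3 \<mu>0 by (simp add: C4_def \<Lambda>_def)
  define \<epsilon> where "\<epsilon> = min 1 (min (\<kappa> / (2 * (C4 + 1))) (1 / (4 * h)))"
  have \<epsilon>: "\<epsilon> > 0" "\<epsilon> \<le> 1" "\<epsilon> \<le> \<kappa> / (2 * (C4 + 1))" "\<epsilon> \<le> 1 / (4 * h)"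
  proof -
    show "\<epsilon> > 0" using \<kappa> C4 h(1) by (simp add: \<epsilon>_def)
    show "\<epsilon> \<le> 1" "\<epsilon> \<le> \<kappa> / (2 * (C4 + 1))" "\<epsilon> \<le> 1 / (4 * h)"
      unfolding \<epsilon>_def by (meson min.cobounded1 min.cobounded2 order_trans)+
  qed
  have \<epsilon>C4: "\<epsilon>\<^sup>2 * C4 \<le> \<kappa> / 2"
  proof -
    have "\<epsilon>\<^sup>2 \<le> \<epsilon>" using \<epsilon>(1,2) by (simp add: power2_eq_square mult_left_le)
    then have "\<epsilon>\<^sup>2 * C4 \<le> \<kappa> / (2 * (C4 + 1)) * (C4 + 1)"
      using \<epsilon>(3) C4 \<kappa> by (intro mult_mono) auto
    also have "\<dots> = \<kappa> / 2" using C4 by (simp add: field_simps)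
    finally show ?thesis .
  qed
  define p where "p = cutoff 1 \<epsilon> A x"
  have psm: "leaf_smooth p" unfolding p_def by (rule leaf_smooth_cutoff)
  have psupp: "supported_in M (\<lambda>z. max 0 (p z))"
    unfolding p_def by (rule supported_in_cutoff[OF \<epsilon>(1) A(1,3) c0])
  have pball: "z \<in> cball x c0" if "z \<in> M" "p z > 0" for z
    using cutoff_pos_ball[OF that(1) that(2)[unfolded p_def] \<epsilon>(1) A(1,3) c0(1)] .
  have lapp: "lap p z \<le> 0" if "z \<in> M" for z
    unfolding p_def lap_cutoff[OF that] using A leaf_density_pos[OF that] by simp
  note tw = test_fun_of_cutoff(4)[OF psupp psm]
  have sw: "leaf_smooth (\<lambda>z. weight (H z))" using leaf_smooth_weight[OF H] .
  define N where "N = dist2 x"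
  have N: "leaf_smooth N" "\<And>z. N z \<ge> 0" unfolding N_def using leaf_smooth_dist2 dist2_ge_0 by auto
  define k where "k z = hinge_weight (p z)" for z
  have k: "test_fun k" "\<And>z. 0 \<le> k z" "\<And>z. k z \<le> 54"
    using tw hinge_weight_le by (simp_all add: k_def[abs_def])
  have w0: "0 \<le> weight (H z)" if "z \<in> M" for z
    using weight_ge_0[of "H z"] H(2)[OF that] by simp

  \<comment> \<open>The error that remains when \<open>\<epsilon>\<close> is small. It is bounded
    independently of \<open>R\<close>, because H^2 times the squared distance is at most U^2 times
    it, hence at most \<open>B\<close>.\<close>
  define F where "F z = k z * weight (H z) * N z" for z
  have F: "test_fun F" unfolding F_def by (intro test_fun_mult k sw N)
  have F0: "0 \<le> F z" "F z \<le> 2916 * B" if z: "z \<in> M" for z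
  proof -
    show "0 \<le> F z" using k N w0[OF z] by (simp add: F_def)
    have "weight (H z) * N z \<le> 27 * (1 + (H z)\<^sup>2) * N z"
      using weight_le[of "H z"] H(2)[OF z] N by (intro mult_right_mono) auto
    also have "\<dots> = 27 * (N z + (H z)\<^sup>2 * N z)" by (simp add: algebra_simps)
    also have "(H z)\<^sup>2 * N z \<le> (U z)\<^sup>2 * N z"
      using HU(1)[OF z] H(2)[OF z] N by (intro mult_right_mono power_mono) auto
    also have "(U z)\<^sup>2 * N z \<le> B" using bp(4)[OF z] by (simp add: N_def)
    also have "N z \<le> B" using B(2)[OF z] by (simp add: N_def)
    finally have *: "weight (H z) * N z \<le> 54 * B" by simp
    have "F z = k z * (weight (H z) * N z)" by (simp add: F_def)
    also have "\<dots> \<le> 54 * (54 * B)" by (rule mult_mono) (use k * w0[OF z] N B0 in auto)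
    finally show "F z \<le> 2916 * B" by simp
  qed
  \<comment> \<open>Split by \<open>u0\<close>. On its support \<open>W\<close>, hence
    \<open>H\<close>, is at most \<open>\<omega>\<close>, and 486 = 54 * 9; the mass missed by
    \<open>u0\<close> is at most \<open>\<tau>\<close>, against the bound \<open>2916 * B\<close>
    with 2916 = 54 * 54.\<close>
  have IF: "I (\<lambda>z. F z * leaf_density z) \<le> 486 * sqrt \<omega> * B * \<mu> + 2916 * B * \<tau>"
  proof -
    have t1: "test_fun (\<lambda>z. (F z * u0 z) * leaf_density z)" and t2: "test_fun (\<lambda>z. F z * (1 - u0 z) * leaf_density z)"
      by (intro test_fun_mult F leaf_smooth_density leaf_smooth_intros test_fun_leaf_smooth[OF u0(1)])+
    have "I (\<lambda>z. F z * leaf_density z) = I (\<lambda>z. (F z * u0 z) * leaf_density z + F z * (1 - u0 z) * leaf_density z)"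
      by (rule arg_cong[of _ _ I]) (simp add: fun_eq_iff algebra_simps)
    also have "\<dots> = I (\<lambda>z. (F z * u0 z) * leaf_density z) + I (\<lambda>z. F z * (1 - u0 z) * leaf_density z)"
      by (rule I_add[OF t1 t2])
    also have "I (\<lambda>z. (F z * u0 z) * leaf_density z) \<le> (486 * sqrt \<omega> * B) * \<mu>"
    proof (rule I_mass_le[OF mass])
      show "test_fun (\<lambda>z. F z * u0 z)" by (intro test_fun_mult F test_fun_leaf_smooth u0)
      show "0 < 486 * sqrt \<omega> * B" using \<omega> B0 by simp
      fix z assume z: "z \<in> M"
      have "F z * u0 z \<le> 486 * sqrt \<omega> * B"
      proof (cases "u0 z = 0")
        case False
        have "weight (H z) \<le> 9 * sqrt \<omega>"
          using HU(2)[OF z] u0(3)[OF z False] H(2)[OF z] \<omega>(2) by (intro weight_le_small) auto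
        then have "k z * weight (H z) * N z \<le> 54 * (9 * sqrt \<omega>) * B"
          using k(2)[of z] k(3)[of z] N B(2)[OF z] w0[OF z] \<omega> by (intro mult_mono) (auto simp: N_def)
        moreover have "F z * u0 z \<le> F z" using F0(1)[OF z] u0(2)[OF z] by (simp add: mult_left_le)
        ultimately show ?thesis by (simp add: F_def)
      qed (use \<omega> B0 in simp)
      then show "0 \<le> F z * u0 z \<and> F z * u0 z \<le> 486 * sqrt \<omega> * B" using F0(1)[OF z] u0(2)[OF z] by simp
    qed
    also have "I (\<lambda>z. F z * (1 - u0 z) * leaf_density z) \<le> 2916 * B * \<tau>"
    proof -
      have "I (\<lambda>z. (1 / (2916 * B) * F z) * (1 - u0 z) * leaf_density z) \<le> \<tau>"
        using F0 B0 by (intro u0(4) test_fun_cmult F) (auto simp: field_simps)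
      then have "1 / (2916 * B) * I (\<lambda>z. F z * (1 - u0 z) * leaf_density z) \<le> \<tau>"
        using I_cmult[OF t2, of "1 / (2916 * B)"] by (simp add: mult.assoc)
      then show ?thesis using B0 by (simp add: field_simps)
    qed
    finally show ?thesis by simp
  qed
  \<comment> \<open>This is bounded but not small as \<open>\<epsilon>\<close> decreases, so in
    \<open>E1\<close> the smallness has to come from \<open>\<delta>\<close>.\<close>
  have Ik: "\<epsilon>\<^sup>2 * \<Lambda> * I k \<le> C2"
    unfolding k_def[abs_def] p_def \<Lambda>_def C2_def
  proof (rule cutoff_growth[OF _ \<epsilon>(1) A(1,2) c0])
    show "I (\<lambda>z. u z * leaf_density z) \<le> \<mu>"
      if "test_fun u" "\<And>z. z \<in> M \<Longrightarrow> 0 \<le> u z \<and> u z \<le> 1" for u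
      by (rule mass[OF that])
  qed
  have Ikd: "I (\<lambda>z. k z * leaf_density z) \<le> 54 * \<mu>"
    by (rule I_mass_le[OF mass k(1)]) (simp_all add: k)
  have tkd: "test_fun (\<lambda>z. k z * leaf_density z)" by (intro test_fun_mult k leaf_smooth_density)
  have Fd: "test_fun (\<lambda>z. F z * leaf_density z)" by (intro test_fun_mult F leaf_smooth_density)
  define E where "E z = 2 * \<epsilon>\<^sup>2 * \<Lambda> * (2 * Q * \<delta>) * k z + 2 * \<epsilon>\<^sup>2 * \<Lambda> * C3 * (k z * leaf_density z) +
      8 * A\<^sup>2 * (F z * leaf_density z)" for z
  have tE: "test_fun E" unfolding E_def by (intro test_fun_add test_fun_cmult k tkd Fd)
  have IE: "I E = 2 * \<epsilon>\<^sup>2 * \<Lambda> * (2 * Q * \<delta>) * I k + 2 * \<epsilon>\<^sup>2 * \<Lambda> * C3 * I (\<lambda>z. k z * leaf_density z) +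
      8 * A\<^sup>2 * I (\<lambda>z. F z * leaf_density z)"
    unfolding E_def[abs_def]
    by (simp only: I_add[OF test_fun_add[OF test_fun_cmult[OF k(1)] test_fun_cmult[OF tkd]] test_fun_cmult[OF Fd]]
        I_add[OF test_fun_cmult[OF k(1)] test_fun_cmult[OF tkd]] I_cmult[OF k(1)] I_cmult[OF tkd] I_cmult[OF Fd])
  have "2 * \<epsilon>\<^sup>2 * \<Lambda> * (2 * Q * \<delta>) * I k = 4 * Q * \<delta> * (\<epsilon>\<^sup>2 * \<Lambda> * I k)" by simp
  also have "\<dots> \<le> 4 * Q * \<delta> * C2" using Q \<delta> by (intro mult_left_mono Ik) auto
  also have "\<dots> \<le> \<kappa> / 2" by (rule \<delta>\<kappa>)
  finally have E1: "2 * \<epsilon>\<^sup>2 * \<Lambda> * (2 * Q * \<delta>) * I k \<le> \<kappa> / 2" .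
  have "2 * \<epsilon>\<^sup>2 * \<Lambda> * C3 * I (\<lambda>z. k z * leaf_density z) \<le> 2 * \<epsilon>\<^sup>2 * \<Lambda> * C3 * (54 * \<mu>)"
    using C3 by (intro mult_left_mono Ikd) (auto simp: \<Lambda>_def)
  also have "\<dots> = \<epsilon>\<^sup>2 * C4" by (simp add: C4_def)
  also note \<epsilon>C4
  finally have E2: "2 * \<epsilon>\<^sup>2 * \<Lambda> * C3 * I (\<lambda>z. k z * leaf_density z) \<le> \<kappa> / 2" .
  have E3: "8 * A\<^sup>2 * I (\<lambda>z. F z * leaf_density z) \<le> 8 * A\<^sup>2 * (486 * sqrt \<omega> * B * \<mu> + 2916 * B * \<tau>)"
    by (intro mult_left_mono IF) simp

  define c where "c = hinge (1 / 2) / (32 * \<eta>)"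
  have tu: "test_fun (\<lambda>z. u z * leaf_density z)"
    using u Ku unfolding test_fun_def supported_in_def
    by (auto intro!: leaf_smooth_mult leaf_smooth_density)
  have th: "test_fun (\<lambda>z. hinge (p z) * - lap H z)"
    by (intro test_fun_mult test_fun_of_cutoff[OF psupp psm] leaf_smooth_minus leaf_smooth_lap H)
  have "c * I (\<lambda>z. u z * leaf_density z) = I (\<lambda>z. c * (u z * leaf_density z))"
    by (rule I_cmult[OF tu, symmetric])
  also have "\<dots> \<le> I (\<lambda>z. hinge (p z) * - lap H z)"
  proof (rule I_mono[OF test_fun_cmult[OF tu] th])
    fix z assume z: "z \<in> M"
    have nn: "0 \<le> hinge (p z) * - lap H z"
      using lapH0[OF z pball[OF z]] by (cases "p z > 0") (simp_all add: mult_nonneg_nonpos)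
    show "c * (u z * leaf_density z) \<le> hinge (p z) * - lap H z"
    proof (cases "z \<in> Ku")
      case False
      then show ?thesis using nn Ku(3)[of z] z by simp
    next
      case True
      then have zb: "z \<in> ball x (exp (- R))" using Ku by auto
      have dz: "dist2 x z \<le> \<eta>"
        using zb by (simp add: dist2_eq \<eta>_def dist_norm norm_minus_commute power_mono)
      \<comment> \<open>Each of the two terms subtracted in the cutoff is at most 1/4 on
        \<open>Ku\<close>, which is the origin of \<open>hinge (1 / 2)\<close>.\<close>
      have "\<epsilon> * height z \<le> 1 / (4 * h) * h"
        using \<epsilon> h height_pos[OF z] True by (intro mult_mono) auto
      moreover have "A * dist2 x z \<le> A * \<eta>" using A dz by (intro mult_left_mono) auto
      moreover have "A * \<eta> \<le> 1 / 4" using R(3) by (simp add: A_def \<eta>_def)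
      ultimately have p12: "1 / 2 \<le> p z" using h(1) by (simp add: p_def cutoff_def)
      then have zc: "z \<in> cball x c0" by (intro pball[OF z]) simp
      have Uz: "U z > 0" "U z \<le> 2 * R" using bp(2)[OF z] U2R[OF z] by auto
      \<comment> \<open>With \<open>U \<le> 2 * R\<close>, \<open>W \<ge> R\<close> and
        \<open>V' \<ge> 2 * R\<close> one gets U / H <= 1 + 2 + 1. The constant 32 of the statement
        is 4^2 times the 2 in \<open>leaf_density z / (2 * \<eta>)\<close>.\<close>
      have "inverse (H z) = inverse (U z) + inverse (W z) + inverse (V' z)"
        by (simp add: H_def G_def hmean_def)
      also have "inverse (W z) \<le> inverse R" using W(4)[OF z zb] R(1) by (simp add: le_imp_inverse_le)
      also have "inverse (V' z) \<le> inverse (2 * R)"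
        using n[OF True] R(1) by (intro le_imp_inverse_le) (simp_all add: V'_def)
      finally have "U z * inverse (H z) \<le> U z * (inverse (U z) + inverse R + inverse (2 * R))"
        using Uz by (intro mult_left_mono) auto
      also have "\<dots> = 1 + U z / R + U z / (2 * R)" using Uz R(1) by (simp add: field_simps)
      also have "\<dots> \<le> 1 + 2 + 1" using Uz R(1) by (intro add_mono) (auto simp: divide_le_eq)
      finally have "U z \<le> 4 * H z" using H(2)[OF z] by (simp add: field_simps)
      then have "1 / 4 \<le> H z / U z" using Uz by (simp add: field_simps)
      then have "(1 / 4)\<^sup>2 \<le> (H z / U z)\<^sup>2" by (intro power_mono) auto
      then have HU16: "1 / 16 \<le> (H z / U z)\<^sup>2" by (simp add: power2_eq_square)
      have "leaf_density z / (2 * \<eta>) = 2 * \<eta> * leaf_density z / (\<eta> + \<eta>)\<^sup>2"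
        using \<eta> by (simp add: power2_eq_square field_simps)
      also have "\<dots> \<le> 2 * \<eta> * leaf_density z / (dist2 x z + \<eta>)\<^sup>2"
        using dz \<eta> dist2_ge_0[of x z] leaf_density_pos[OF z]
        by (intro divide_left_mono power_mono mult_pos_pos) auto
      also have "\<dots> \<le> - lap U z" using bp(3)[OF z] by simp
      finally have "1 / 16 * (leaf_density z / (2 * \<eta>)) \<le> (H z / U z)\<^sup>2 * - lap U z"
        using HU16 \<eta> leaf_density_pos[OF z] by (intro mult_mono) auto
      also have "\<dots> \<le> - lap H z" using lapH[OF z zc] by simp
      finally have l: "leaf_density z / (32 * \<eta>) \<le> - lap H z" by simp
      have "c * (u z * leaf_density z) \<le> c * (1 * leaf_density z)"
        using u(3)[OF z] leaf_density_pos[OF z] \<eta> by (intro mult_left_mono mult_right_mono) (auto simp: c_def)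
      also have "\<dots> = hinge (1 / 2) * (leaf_density z / (32 * \<eta>))" by (simp add: c_def)
      also have "\<dots> \<le> hinge (p z) * - lap H z"
        using hinge_mono(1)[OF p12] l leaf_density_pos[OF z] \<eta> by (intro mult_mono) auto
      finally show ?thesis .
    qed
  qed
  also have "\<dots> \<le> I (\<lambda>z. hinge_weight (p z) * weight (H z) * grad_prod p p z)"
    by (rule superharmonic_test[OF H psm psupp]) (use lapH0 pball lapp in auto)
  also have "\<dots> \<le> I E"
  proof (rule I_mono[OF _ tE])
    show "test_fun (\<lambda>z. hinge_weight (p z) * weight (H z) * grad_prod p p z)"
      by (intro test_fun_mult tw sw leaf_smooth_grad_prod psm)
    fix z assume z: "z \<in> M"
    show "hinge_weight (p z) * weight (H z) * grad_prod p p z \<le> E z"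
    proof (cases "p z > 0")
      case True
      have "k z * weight (H z) * grad_prod p p z \<le>
          k z * weight (H z) * (2 * \<epsilon>\<^sup>2 * \<Lambda> + 8 * A\<^sup>2 * (dist2 x z * leaf_density z))"
        unfolding p_def \<Lambda>_def using k w0[OF z] by (intro mult_left_mono grad_cutoff z) auto
      also have "\<dots> = 2 * \<epsilon>\<^sup>2 * \<Lambda> * k z * weight (H z) + 8 * A\<^sup>2 * (F z * leaf_density z)"
        by (simp add: F_def N_def algebra_simps)
      also have "2 * \<epsilon>\<^sup>2 * \<Lambda> * k z * weight (H z) \<le> 2 * \<epsilon>\<^sup>2 * \<Lambda> * k z * (2 * Q * \<delta> + C3 * leaf_density z)"
        using k by (intro mult_left_mono wH z pball True) (auto simp: \<Lambda>_def)
      also have "2 * \<epsilon>\<^sup>2 * \<Lambda> * k z * (2 * Q * \<delta> + C3 * leaf_density z) + 8 * A\<^sup>2 * (F z * leaf_density z) = E z"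
        by (simp add: E_def algebra_simps)
      finally show ?thesis by (simp add: k_def)
    next
      case False
      then have "k z = 0" "F z = 0" by (simp_all add: k_def F_def)
      then show ?thesis using False by (simp add: E_def)
    qed
  qed
  also have "\<dots> \<le> 8 * A\<^sup>2 * (486 * sqrt \<omega> * B * \<mu> + 2916 * B * \<tau>) + \<kappa>"
    unfolding IE using E1 E2 E3 by linarith
  finally show "hinge (1 / 2) / (32 * (exp (- R))\<^sup>2) * I (\<lambda>z. u z * leaf_density z) \<le>
      8 * (2 / c0\<^sup>2)\<^sup>2 * (486 * sqrt \<omega> * B * \<mu> + 2916 * B * \<tau>) + \<kappa>"
    by (simp add: c_def \<eta>_def A_def)
qed

end

section \<open>Barrier functions at the origin\<close>

context linear_foliation
begin

definition depth :: "'n \<Rightarrow> complex^'n \<Rightarrow> real" where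
  "depth j z = - ln (cmod (z $ j))"

lemma depth_pos: "z \<in> M \<Longrightarrow> depth j z > 0"
  by (auto simp: depth_def punctured_polydisc_def)

lemma leaf_smooth_depth: "leaf_smooth (depth j)"
  unfolding depth_def by (intro leaf_smooth_minus leaf_smooth_ln_cmod)

lemma leaf_deriv_depth:
  assumes "z \<in> M" "d \<in> {1, \<i>}"
  shows "leaf_deriv d (depth j) z = - Re (lam $ j * d)"
proof -
  have "leaf_deriv d (depth j) z = leaf_deriv d (\<lambda>z. - 1 * ln (cmod (z $ j))) z"
    by (simp add: depth_def[abs_def])
  also have "\<dots> = - 1 * Re (lam $ j * d)"
    unfolding leaf_deriv_cmult[OF leaf_smooth_ln_cmod assms(2,1)] leaf_deriv_ln_cmod[OF assms(1)] ..
  finally show ?thesis by simp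
qed

lemma grad_depth: "z \<in> M \<Longrightarrow> grad_prod (depth i) (depth j) z = Re (lam $ i * cnj (lam $ j))"
  by (simp add: grad_prod_def leaf_deriv_depth)

lemma grad_depth_self: "z \<in> M \<Longrightarrow> grad_prod (depth j) (depth j) z = (cmod (lam $ j))\<^sup>2"
  unfolding grad_depth by (simp add: cmod_power2) (simp add: power2_eq_square)

lemma lap_depth: "z \<in> M \<Longrightarrow> lap (depth j) z = 0"
  unfolding depth_def by (simp add: lap_minus[OF leaf_smooth_ln_cmod] lap_ln_cmod)

lemma depth_ge:
  assumes "z \<in> M" "z \<in> ball x (exp (- R))" "x $ j = 0"
  shows "R \<le> depth j z"
proof -
  have "cmod (z $ j) \<le> dist x z" using dist_vec_nth_le[of z j x] assms(3) by (simp add: dist_commute)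
  also have "\<dots> < exp (- R)" using assms(2) by simp
  finally have "ln (cmod (z $ j)) \<le> ln (exp (- R))"
    using assms(1) by (subst ln_le_cancel_iff) (auto simp: punctured_polydisc_def)
  then show ?thesis by (simp add: depth_def)
qed

lemma bounded_on_compact:
  assumes "compact K" "K \<subseteq> M" "leaf_smooth u"
  obtains b where "b > 0" "\<And>z. z \<in> K \<Longrightarrow> \<bar>u z\<bar> \<le> b"
proof -
  have "bounded (u ` K)"
    by (intro compact_imp_bounded compact_continuous_image assms(1)
        continuous_on_subset[OF leaf_smooth_continuous_on[OF assms(3)] assms(2)])
  then show thesis using that unfolding bounded_pos by auto
qed

lemma cmod_depth: "z \<in> M \<Longrightarrow> cmod (z $ j) = exp (- depth j z)"
  by (auto simp: depth_def punctured_polydisc_def)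

text \<open>On a leaf the two depths are linear coordinates in which the leaf is part of a sector of angle
  less than \<open>\<pi>\<close>, so there is a positive superharmonic function of homogeneity \<open>2a > 1\<close>.\<close>

lemma powr_barrier:
  assumes kl: "\<bar>Re (lam $ k * cnj (lam $ l))\<bar> < cmod (lam $ k) * cmod (lam $ l)"
  obtains a where "1 < 2 * a"
    "leaf_smooth (\<lambda>z. (depth k z * depth l z) powr a)"
    "\<And>z. z \<in> M \<Longrightarrow> lap (\<lambda>z. (depth k z * depth l z) powr a) z \<le> 0"
proof -
  define m where "m = cmod (lam $ k) * cmod (lam $ l)"
  define g where "g = Re (lam $ k * cnj (lam $ l))"
  have m: "m > 0" "\<bar>g\<bar> < m" using kl lam_nz by (simp_all add: m_def g_def)
  \<comment> \<open>Determined by \<open>a * \<bar>g\<bar> = (1 - a) * m\<close>: the cross term of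
    the Laplacian is then exactly covered by AM-GM. It exceeds 1/2 because
    \<open>\<bar>g\<bar> < m\<close>, which says that the ratio of the two eigenvalues is not
    real.\<close>
  define a where "a = m / (m + \<bar>g\<bar>)"
  have den: "m + \<bar>g\<bar> > 0" using m by simp
  have a: "1 < 2 * a" "a \<le> 1" "a > 0" "a * \<bar>g\<bar> = (1 - a) * m"
    using m den by (simp_all add: a_def field_simps)
  define q where "q z = depth k z * depth l z" for z
  have q: "leaf_smooth q" "\<And>z. z \<in> M \<Longrightarrow> q z > 0"
    unfolding q_def using depth_pos by (auto intro!: leaf_smooth_mult leaf_smooth_depth)
  have "lap (\<lambda>z. q z powr a) z \<le> 0" if z: "z \<in> M" for z
  proof -
    define s t where "s = depth k z" and "t = depth l z"
    have st: "s > 0" "t > 0" "q z = s * t" using depth_pos[OF z] by (simp_all add: s_def t_def q_def)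
    define \<alpha> \<beta> where "\<alpha> = cmod (lam $ k)" and "\<beta> = cmod (lam $ l)"
    have d1: "((\<lambda>x. x powr a) has_real_derivative a * q z powr (a - 1)) (at (q z))" if "z \<in> M" for z
      using q(2)[OF that] by (auto intro!: derivative_eq_intros)
    have d2: "((\<lambda>x. a * x powr (a - 1)) has_real_derivative a * (a - 1) * q z powr (a - 2)) (at (q z))"
      using q(2)[OF z] by (auto intro!: derivative_eq_intros simp: algebra_simps)
    have lapq: "lap q z = 2 * g"
      unfolding q_def lap_mult[OF leaf_smooth_depth leaf_smooth_depth z] lap_depth[OF z] grad_depth[OF z] g_def by simp
    have dq: "leaf_deriv d q z = leaf_deriv d (depth k) z * t + leaf_deriv d (depth l) z * s" if "d \<in> {1, \<i>}" for d
      unfolding q_def leaf_deriv_mult[OF leaf_smooth_depth leaf_smooth_depth that z] s_def t_def ..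
    have gq: "grad_prod q q z = t\<^sup>2 * \<alpha>\<^sup>2 + s\<^sup>2 * \<beta>\<^sup>2 + 2 * (s * t * g)"
    proof -
      have "grad_prod q q z = t\<^sup>2 * grad_prod (depth k) (depth k) z + s\<^sup>2 * grad_prod (depth l) (depth l) z +
          2 * (s * t * grad_prod (depth k) (depth l) z)"
        unfolding grad_prod_def dq[OF insertI1] dq[OF insertI2[OF singletonI]] by (simp add: algebra_simps power2_eq_square)
      then show ?thesis unfolding grad_depth_self[OF z] grad_depth[OF z] \<alpha>_def \<beta>_def g_def .
    qed
    have p1: "q z powr (a - 1) = q z powr (a - 2) * (s * t)"
    proof -
      have "q z powr (a - 1) = q z powr (a - 2 + 1)" by simp
      also have "\<dots> = q z powr (a - 2) * q z powr 1" by (rule powr_add)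
      finally show ?thesis using st by simp
    qed
    have "lap (\<lambda>z. q z powr a) z = a * q z powr (a - 1) * lap q z + a * (a - 1) * q z powr (a - 2) * grad_prod q q z"
      by (rule lap_compose[OF q(1) z d1 d2])
    also have "\<dots> = a * q z powr (a - 2) * (2 * (s * t * (a * g)) - (1 - a) * (t\<^sup>2 * \<alpha>\<^sup>2 + s\<^sup>2 * \<beta>\<^sup>2))"
      unfolding p1 lapq gq by (simp add: algebra_simps)
    also have "\<dots> \<le> 0"
    proof (rule mult_nonneg_nonpos)
      have "s * t * (a * g) \<le> s * t * (a * \<bar>g\<bar>)" using st a by (intro mult_left_mono) auto
      also have "\<dots> = (1 - a) * (s * t * m)" by (simp add: a(4))
      finally have 1: "2 * (s * t * (a * g)) \<le> (1 - a) * (2 * (s * t * m))" by simp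
      have "2 * (s * t * m) \<le> t\<^sup>2 * \<alpha>\<^sup>2 + s\<^sup>2 * \<beta>\<^sup>2"
        using sum_squares_bound[of "t * \<alpha>" "s * \<beta>"] by (simp add: m_def \<alpha>_def \<beta>_def power_mult_distrib mult_ac)
      then have "(1 - a) * (2 * (s * t * m)) \<le> (1 - a) * (t\<^sup>2 * \<alpha>\<^sup>2 + s\<^sup>2 * \<beta>\<^sup>2)"
        using a by (intro mult_left_mono) auto
      then show "2 * (s * t * (a * g)) - (1 - a) * (t\<^sup>2 * \<alpha>\<^sup>2 + s\<^sup>2 * \<beta>\<^sup>2) \<le> 0" using 1 by simp
    qed (use a in simp)
    finally show ?thesis .
  qed
  then show thesis
    using that[of a] a(1) leaf_smooth_powr[OF q] by (simp add: q_def)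
qed

text \<open>The function is \<open>2 Re (m / (m + w))\<close>, where \<open>w = A depth k + B depth l\<close> is a leafwise holomorphic
  coordinate with positive real part.\<close>

lemma decaying_barrier:
  assumes kl: "Im (lam $ k * cnj (lam $ l)) \<noteq> 0"
  obtains V :: "nat \<Rightarrow> complex^'n \<Rightarrow> real" where
    "\<And>n. leaf_smooth (V n)" "\<And>n z. z \<in> M \<Longrightarrow> V n z > 0" "\<And>n z. z \<in> M \<Longrightarrow> lap (V n) z \<le> 0"
    "\<And>K. compact K \<Longrightarrow> K \<subseteq> M \<Longrightarrow> \<exists>n. \<forall>z\<in>K. 1 \<le> V n z"
    "\<And>n \<kappa>. \<kappa> > 0 \<Longrightarrow> \<exists>C. \<forall>z\<in>M. V n z \<le> \<kappa> + C * leaf_density z"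
proof -
  define \<alpha> \<beta> where "\<alpha> = cmod (lam $ k)" and "\<beta> = cmod (lam $ l)"
  have ab: "\<alpha> > 0" "\<beta> > 0" using lam_nz by (simp_all add: \<alpha>_def \<beta>_def)
  define g where "g = Re (lam $ k * cnj (lam $ l))"
  \<comment> \<open>The difference of the unit vectors of the two eigenvalues has a positive scalar
    product with one and a negative one with the other, hence \<open>Re A > 0\<close> and
    \<open>Re B > 0\<close>. The relation \<open>A * cnj (lam $ k) + B * cnj (lam $ l) = 0\<close>
    makes \<open>A * depth k + B * depth l\<close> holomorphic in time.\<close>
  define e where "e = lam $ l / of_real \<beta> - lam $ k / of_real \<alpha>"
  define A B where "A = e * cnj (lam $ l)" and "B = - e * cnj (lam $ k)"
  define w where "w = lam $ k * cnj (lam $ l)"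
  have g: "g < \<alpha> * \<beta>"
  proof -
    have "Im w \<noteq> 0" using kl by (simp only: w_def not_False_eq_True)
    then have "(Re w)\<^sup>2 < (cmod w)\<^sup>2" by (simp add: cmod_power2)
    then have "Re w < cmod w" by (rule power2_less_imp_less) simp
    then show ?thesis by (simp only: g_def w_def norm_mult complex_mod_cnj \<alpha>_def \<beta>_def)
  qed
  have sq: "lam $ l * cnj (lam $ l) = of_real \<beta> * of_real \<beta>" "lam $ k * cnj (lam $ k) = of_real \<alpha> * of_real \<alpha>"
    by (simp_all add: \<alpha>_def \<beta>_def complex_norm_square[symmetric] flip: power2_eq_square)
  have A: "Re A > 0" and B: "Re B > 0"
  proof -
    have "A = lam $ l * cnj (lam $ l) / of_real \<beta> - w / of_real \<alpha>"
      by (simp add: A_def e_def w_def left_diff_distrib)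
    then have "Re A = \<beta> - g / \<alpha>" unfolding sq using ab by (simp add: g_def w_def)
    moreover have "g / \<alpha> < \<beta>" using g ab by (simp add: divide_less_eq mult.commute)
    ultimately show "Re A > 0" by simp
    have "B = lam $ k * cnj (lam $ k) / of_real \<alpha> - lam $ l * cnj (lam $ k) / of_real \<beta>"
      by (simp add: B_def e_def left_diff_distrib minus_mult_left[symmetric])
    moreover have "Re (lam $ l * cnj (lam $ k)) = g" by (simp add: g_def)
    ultimately have "Re B = \<alpha> - g / \<beta>" unfolding sq using ab by simp
    moreover have "g / \<beta> < \<alpha>" using g ab by (simp add: divide_less_eq)
    ultimately show "Re B > 0" by simp
  qed
  define X Y where "X z = Re A * depth k z + Re B * depth l z" and "Y z = Im A * depth k z + Im B * depth l z" for z
  have XY: "leaf_smooth X" "leaf_smooth Y"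
    unfolding X_def Y_def by (intro leaf_smooth_intros leaf_smooth_depth)+
  have X0: "X z > 0" "X z \<ge> Re A * depth k z" if "z \<in> M" for z
    using A B depth_pos[OF that] by (simp_all add: X_def add_pos_pos less_imp_le)
  define \<Delta> where "\<Delta> = Im (lam $ k) * Re (lam $ l) - Im (lam $ l) * Re (lam $ k)"
  \<comment> \<open>These four values contain the Cauchy-Riemann equations for
    \<open>X + \<i> * Y\<close>.\<close>
  have dXY: "leaf_deriv 1 X z = \<Delta> * Im e" "leaf_deriv \<i> X z = \<Delta> * Re e"
      "leaf_deriv 1 Y z = - \<Delta> * Re e" "leaf_deriv \<i> Y z = \<Delta> * Im e" if z: "z \<in> M" for z
  proof -
    have D: "leaf_deriv d (\<lambda>z. a * depth k z + b * depth l z) z = - (a * Re (lam $ k * d) + b * Re (lam $ l * d))"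
      if "d \<in> {1, \<i>}" for a b d
      by (subst leaf_deriv_add leaf_deriv_cmult; (intro leaf_smooth_intros leaf_smooth_depth z that)?)+
         (simp add: leaf_deriv_depth[OF z that] algebra_simps)
    note D1 = D[of 1, OF insertI1] and Di = D[of \<i>, OF insertI2[OF singletonI]]
    show "leaf_deriv 1 X z = \<Delta> * Im e" "leaf_deriv \<i> X z = \<Delta> * Re e"
      "leaf_deriv 1 Y z = - \<Delta> * Re e" "leaf_deriv \<i> Y z = \<Delta> * Im e"
      unfolding X_def Y_def D1 Di by (simp_all add: A_def B_def \<Delta>_def algebra_simps)
  qed
  have lapXY: "lap X z = 0" "lap Y z = 0" if z: "z \<in> M" for z
    unfolding X_def Y_def using z
    by (simp_all only: lap_add lap_cmult leaf_smooth_mult leaf_smooth_const leaf_smooth_depth lap_depth)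
  define V where "V n z = (2 * real (Suc n)) * ((X z + real (Suc n)) * inverse ((X z + real (Suc n)) * (X z + real (Suc n)) + Y z * Y z))"
    for n z
  have main: "leaf_smooth (V n)" "z \<in> M \<Longrightarrow> lap (V n) z = 0" for n z
  proof -
    define m where "m = real (Suc n)"
    define f where "f z = X z + m" for z
    define D where "D z = f z * f z + Y z * Y z" for z
    have f: "leaf_smooth f" "\<And>z. z \<in> M \<Longrightarrow> f z > 0"
    proof -
      show "leaf_smooth f" unfolding f_def by (intro leaf_smooth_intros XY)
      show "f z > 0" if "z \<in> M" for z using X0(1)[OF that] by (simp add: f_def m_def)
    qed
    have D: "leaf_smooth D" "\<And>z. z \<in> M \<Longrightarrow> D z > 0"
      unfolding D_def using f by (auto intro!: leaf_smooth_intros XY add_pos_nonneg)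
    have iD: "leaf_smooth (\<lambda>z. inverse (D z))" by (rule leaf_smooth_inverse[OF D(1)]) (rule D(2))
    have V: "V n = (\<lambda>z. (2 * m) * (f z * inverse (D z)))"
      by (simp add: V_def fun_eq_iff D_def f_def m_def)
    show "leaf_smooth (V n)" unfolding V by (intro leaf_smooth_intros f iD)
    assume z: "z \<in> M"
    define \<gamma> where "\<gamma> = \<Delta>\<^sup>2 * ((Re e)\<^sup>2 + (Im e)\<^sup>2)"
    have df: "leaf_deriv d f z = leaf_deriv d X z" if "d \<in> {1, \<i>}" for d
      using leaf_deriv_diff_const[OF XY(1) that z, of "- m"] by (simp add: f_def[abs_def])
    have lapf: "lap f z = 0" using lap_diff_const[OF XY(1) z, of "- m"] lapXY[OF z] by (simp add: f_def[abs_def])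
    have gff: "grad_prod f f z = \<gamma>" and gYY: "grad_prod Y Y z = \<gamma>"
      unfolding grad_prod_def df[OF insertI1] df[OF insertI2[OF singletonI]] dXY[OF z] \<gamma>_def
      by (simp_all add: power2_eq_square algebra_simps)
    have lapD: "lap D z = 4 * \<gamma>"
      unfolding D_def using z
      by (simp only: lap_add[OF leaf_smooth_mult[OF f(1) f(1)] leaf_smooth_mult[OF XY(2) XY(2)]]
          lap_mult[OF f(1) f(1)] lap_mult[OF XY(2) XY(2)] lapf lapXY gff gYY)
    have dD: "leaf_deriv d D z = 2 * (f z * leaf_deriv d f z + Y z * leaf_deriv d Y z)" if "d \<in> {1, \<i>}" for d
      unfolding D_def leaf_deriv_add[OF leaf_smooth_mult[OF f(1) f(1)] leaf_smooth_mult[OF XY(2) XY(2)] that z]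
        leaf_deriv_mult[OF f(1) f(1) that z] leaf_deriv_mult[OF XY(2) XY(2) that z] by simp
    have gDD: "grad_prod D D z = 4 * (D z * \<gamma>)" and gfD: "grad_prod f D z = 2 * (f z * \<gamma>)"
      unfolding grad_prod_def dD[OF insertI1] dD[OF insertI2[OF singletonI]] df[OF insertI1] df[OF insertI2[OF singletonI]]
        dXY[OF z] \<gamma>_def D_def
      by (simp_all add: power2_eq_square algebra_simps)
    have Dz: "D z > 0" by (rule D(2)[OF z])
    have lapiD: "lap (\<lambda>z. inverse (D z)) z = 4 * \<gamma> / (D z)\<^sup>2"
      using lap_inverse[OF D(1) _ z] D(2) Dz unfolding lapD gDD
      by (simp add: field_simps power2_eq_square power3_eq_cube)
    have giD: "grad_prod f (\<lambda>z. inverse (D z)) z = - (2 * (f z * \<gamma>)) / (D z)\<^sup>2"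
    proof -
      have "leaf_deriv d (\<lambda>z. inverse (D z)) z = - leaf_deriv d D z / (D z)\<^sup>2" if "d \<in> {1, \<i>}" for d
        using leaf_deriv_inverse[OF D(1) _ z that] D(2) by blast
      then have "grad_prod f (\<lambda>z. inverse (D z)) z = - grad_prod f D z / (D z)\<^sup>2"
        by (simp add: grad_prod_def add_divide_distrib diff_divide_distrib)
      then show ?thesis unfolding gfD .
    qed
    have "lap (V n) z = (2 * m) * (f z * (4 * \<gamma> / (D z)\<^sup>2) + inverse (D z) * 0 + 2 * (- (2 * (f z * \<gamma>)) / (D z)\<^sup>2))"
      unfolding V lap_cmult[OF leaf_smooth_mult[OF f(1) iD] z] lap_mult[OF f(1) iD z] lapf lapiD giD ..
    then show "lap (V n) z = 0" by simp
  qed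
  have Vpos: "V n z > 0" "V n z \<le> 2" "V n z * X z \<le> 2 * real (Suc n)" if z: "z \<in> M" for n z
  proof -
    define m where "m = real (Suc n)"
    have m: "m > 0" by (simp add: m_def)
    define f where "f = X z + m"
    have f: "f > 0" "m \<le> f" "X z \<le> f" using X0[OF z] m by (simp_all add: f_def)
    have V: "V n z = 2 * m * (f / (f * f + Y z * Y z))" by (simp add: V_def f_def m_def divide_inverse)
    have D: "f * f + Y z * Y z > 0" using f by (simp add: add_pos_nonneg)
    show "V n z > 0" unfolding V using m f D by simp
    have "m * f \<le> f * f + Y z * Y z" using f mult_right_mono[of m f f] zero_le_square[of "Y z"] by linarith
    then show "V n z \<le> 2" unfolding V using D by (simp add: divide_le_eq)
    have "f * X z \<le> f * f + Y z * Y z"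
      using f mult_left_mono[of "X z" f f] zero_le_square[of "Y z"] by linarith
    then have "f * X z / (f * f + Y z * Y z) \<le> 1" using D by (simp add: divide_le_eq)
    then have "2 * m * (f * X z / (f * f + Y z * Y z)) \<le> 2 * m * 1" using m by (intro mult_left_mono) auto
    then show "V n z * X z \<le> 2 * real (Suc n)" unfolding V by (simp add: m_def)
  qed
  show thesis
  proof (rule that[of V])
    show "leaf_smooth (V n)" "z \<in> M \<Longrightarrow> V n z > 0" "z \<in> M \<Longrightarrow> lap (V n) z \<le> 0" for n z
      using main Vpos by simp_all
    show "\<exists>n. \<forall>z\<in>K. 1 \<le> V n z" if K: "compact K" "K \<subseteq> M" for K
    proof -
      obtain b c where b: "b > 0" "\<And>z. z \<in> K \<Longrightarrow> \<bar>X z\<bar> \<le> b" and c: "c > 0" "\<And>z. z \<in> K \<Longrightarrow> \<bar>Y z\<bar> \<le> c"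
        using bounded_on_compact[OF K XY(1)] bounded_on_compact[OF K XY(2)] by metis
      obtain n where n: "b + c < real n" using reals_Archimedean2 by blast
      have "1 \<le> V n z" if z: "z \<in> K" for z
      proof -
        define m where "m = real (Suc n)"
        have m: "m > b + c" using n by (simp add: m_def)
        have zM: "z \<in> M" using z K by auto
        define f where "f = X z + m"
        have f: "f > 0" using X0[OF zM] m b c by (simp add: f_def)
        have V: "V n z = 2 * m * (f / (f * f + Y z * Y z))" by (simp add: V_def f_def m_def divide_inverse)
        have D: "f * f + Y z * Y z > 0" using f by (simp add: add_pos_nonneg)
        \<comment> \<open>\<open>V n z \<ge> 1\<close> amounts to X^2 + Y^2 <= m^2, and this is why
          \<open>m > b + c\<close> was required.\<close>
        have "X z * X z + Y z * Y z \<le> (b + c) * (b + c)"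
        proof -
          have "X z * X z \<le> b * b" "Y z * Y z \<le> c * c"
            using b(2)[OF z] c(2)[OF z] b(1) c(1) abs_le_square_iff[of "X z" b] abs_le_square_iff[of "Y z" c]
            by (simp_all add: power2_eq_square)
          then show ?thesis using mult_pos_pos[OF b(1) c(1)] by (simp add: algebra_simps)
        qed
        also have "\<dots> \<le> m * m" using m b c by (intro mult_mono) auto
        finally have "f * f + Y z * Y z \<le> 2 * m * f" by (simp add: f_def algebra_simps)
        then show ?thesis unfolding V using D by (simp add: le_divide_eq)
      qed
      then show ?thesis by blast
    qed
    show "\<exists>C. \<forall>z\<in>M. V n z \<le> \<kappa> + C * leaf_density z" if \<kappa>: "\<kappa> > 0" for n \<kappa>
    proof -
      \<comment> \<open>For \<open>depth k z \<ge> S\<close> the bounds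
        \<open>V n z * X z \<le> 2 * real (Suc n)\<close> and
        \<open>X z \<ge> Re A * depth k z\<close> give \<open>V n z \<le> \<kappa>\<close>.
        Otherwise |z_k| is at least exp (- S), so the density is at least \<open>b\<close>, and
        \<open>V n z \<le> 2\<close> suffices.\<close>
      define S where "S = 2 * real (Suc n) / (Re A * \<kappa>)"
      define b where "b = (\<alpha> * exp (- S))\<^sup>2"
      have b: "b > 0" using ab by (simp add: b_def)
      have "V n z \<le> \<kappa> + 2 / b * leaf_density z" if z: "z \<in> M" for z
      proof (cases "S \<le> depth k z")
        case True
        have "Re A * S \<le> X z"
          by (rule order_trans[OF mult_left_mono[OF True] X0(2)[OF z]]) (use A in simp)
        then have "V n z * (Re A * S) \<le> V n z * X z" using Vpos(1)[OF z, of n] by (intro mult_left_mono) auto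
        also have "\<dots> \<le> 2 * real (Suc n)" by (rule Vpos(3)[OF z])
        also have "\<dots> = \<kappa> * (Re A * S)" using A \<kappa> by (simp add: S_def)
        finally have "V n z * (Re A * S) \<le> \<kappa> * (Re A * S)" .
        moreover have "Re A * S > 0" using A \<kappa> by (simp add: S_def)
        ultimately have "V n z \<le> \<kappa>" by (rule mult_right_le_imp_le)
        moreover have "0 \<le> 2 / b * leaf_density z" using b leaf_density_pos[OF z] by simp
        ultimately show ?thesis by linarith
      next
        case False
        then have "\<alpha> * exp (- S) \<le> cmod (lam $ k * z $ k)"
          using ab by (simp add: norm_mult \<alpha>_def cmod_depth[OF z])
        then have "b \<le> (cmod (lam $ k * z $ k))\<^sup>2" unfolding b_def using ab by (intro power_mono) auto
        also have "\<dots> \<le> leaf_density z" unfolding leaf_density_def by (rule member_le_sum) auto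
        finally have "2 / b * b \<le> 2 / b * leaf_density z" using b by (intro mult_left_mono) auto
        then have "2 \<le> 2 / b * leaf_density z" using b by simp
        then show ?thesis using Vpos(2)[OF z, of n] \<kappa> by linarith
      qed
      then show ?thesis by blast
    qed
  qed
qed

end

context linear_foliation
begin

lemma dist2_le:
  assumes "z \<in> M" "x \<in> polydisc 1"
  shows "dist2 x z + 1 \<le> 4 * real CARD('n) + 2"
proof -
  have "sq_dist x j z \<le> 2\<^sup>2" for j
  proof -
    have "cmod (z $ j - x $ j) \<le> cmod (z $ j) + cmod (x $ j)" by (rule norm_triangle_ineq4)
    also have "\<dots> \<le> 1 + 1"
      using assms by (intro add_mono) (auto simp: punctured_polydisc_def polydisc_def less_imp_le)
    finally show ?thesis unfolding sq_dist_def by (intro power_mono) auto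
  qed
  then have "dist2 x z \<le> (\<Sum>j\<in>(UNIV::'n set). 2\<^sup>2)" unfolding dist2_def by (rule sum_mono)
  then show ?thesis by simp
qed

end

section \<open>Smallness of the mass of small balls\<close>

context harmonic_functional
begin

text \<open>The order of choices matters: \<open>t\<close> from \<open>\<tau>\<close>, then a
  near-maximal \<open>u0\<close> for \<open>t\<close>, and only then \<open>R\<close> so large that
  \<open>W R \<le> t\<^sup>2\<close> on the support of \<open>u0\<close>. With
  \<open>\<omega> = t\<^sup>2\<close> both error terms of \<open>lelong_step\<close> are linear in
  \<open>t\<close>.\<close>

lemma lelong_estimate:
  fixes W :: "real \<Rightarrow> complex^'n \<Rightarrow> real" and V :: "nat \<Rightarrow> complex^'n \<Rightarrow> real"
  assumes mass: "\<And>u. test_fun u \<Longrightarrow> (\<And>z. z \<in> M \<Longrightarrow> 0 \<le> u z \<and> u z \<le> 1) \<Longrightarrow> I (\<lambda>z. u z * leaf_density z) \<le> \<mu>"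
    and c0: "c0 > 0" "cball x c0 \<subseteq> polydisc 1"
    and W: "\<And>R. R > 0 \<Longrightarrow> leaf_smooth (W R)" "\<And>R z. R > 0 \<Longrightarrow> z \<in> M \<Longrightarrow> W R z > 0"
      "\<And>R z. R > 0 \<Longrightarrow> z \<in> M \<Longrightarrow> z \<in> cball x c0 \<Longrightarrow> lap (W R) z \<le> 0"
      "\<And>R z. R > 0 \<Longrightarrow> z \<in> M \<Longrightarrow> z \<in> ball x (exp (- R)) \<Longrightarrow> R \<le> W R z"
      "\<And>K. compact K \<Longrightarrow> K \<subseteq> M \<Longrightarrow> \<forall>\<omega>>0. \<exists>R1. \<forall>R\<ge>R1. \<forall>z\<in>K. W R z \<le> \<omega>"
    and V: "\<And>n. leaf_smooth (V n)" "\<And>n z. z \<in> M \<Longrightarrow> V n z > 0"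
      "\<And>n z. z \<in> M \<Longrightarrow> z \<in> cball x c0 \<Longrightarrow> lap (V n) z \<le> 0"
      "\<And>K. compact K \<Longrightarrow> K \<subseteq> M \<Longrightarrow> \<exists>n::nat. \<forall>z\<in>K. 1 \<le> V n z"
      "\<And>n \<kappa>. \<kappa> > 0 \<Longrightarrow> \<exists>C. \<forall>z\<in>M \<inter> cball x c0. V n z \<le> \<kappa> + C * leaf_density z"
    and \<tau>: "\<tau> > 0"
  shows "\<exists>R1. \<forall>R\<ge>R1. \<forall>u. leaf_smooth u \<longrightarrow> supported_in (ball x (exp (- R)) \<inter> M) u \<longrightarrow>
    (\<forall>z\<in>M. 0 \<le> u z \<and> u z \<le> 1) \<longrightarrow> I (\<lambda>z. u z * leaf_density z) \<le> \<tau> * (exp (- R))\<^sup>2"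
proof -
  define B where "B = 4 * real CARD('n) + 2"
  have B2: "B \<ge> 2" by (simp add: B_def)
  have "x \<in> polydisc 1" using c0 by auto
  then have B: "dist2 x z + 1 \<le> B" if "z \<in> M" for z
    using dist2_le[OF that] by (simp add: B_def)
  have \<mu>0: "0 \<le> \<mu>" using mass[OF test_fun_0] by (simp add: I_0)
  define A where "A = 2 / c0\<^sup>2"
  have A: "A > 0" using c0 by (simp add: A_def)
  define h where "h = hinge (1 / 2)"
  have h: "h > 0" by (simp add: h_def hinge_gt_0)
  define D where "D = 32 / h * (8 * A\<^sup>2 * (2916 * B * (\<mu> + 1)))"
  have D: "D > 0" using h A B2 \<mu>0 by (simp add: D_def)
  define t where "t = min 1 (\<tau> / D)"
  have t: "t > 0" "t \<le> 1" "D * t \<le> \<tau>"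
    using \<tau> D by (simp_all add: t_def min_def field_simps)
  obtain u0 where u0: "test_fun u0" "\<And>z. z \<in> M \<Longrightarrow> 0 \<le> u0 z \<and> u0 z \<le> 1"
    "\<And>g. test_fun g \<Longrightarrow> (\<And>z. z \<in> M \<Longrightarrow> 0 \<le> g z \<and> g z \<le> 1) \<Longrightarrow>
      I (\<lambda>z. g z * (1 - u0 z) * leaf_density z) \<le> t"
    using near_maximal_test_fun[OF mass t(1)] by blast
  obtain K where K: "compact K" "K \<subseteq> M" "\<And>z. z \<in> M - K \<Longrightarrow> u0 z = 0"
    using u0(1) unfolding test_fun_def supported_in_def by blast
  have t2: "t\<^sup>2 > 0" "t\<^sup>2 \<le> 1" using t by (simp_all add: power_le_one)
  obtain R1 where R1: "\<And>R z. R \<ge> R1 \<Longrightarrow> z \<in> K \<Longrightarrow> W R z \<le> t\<^sup>2"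
    using W(5)[OF K(1,2)] t2(1) by blast
  define R2 where "R2 = max (max R1 1) (max (ln B / 2) (4 * A))"
  show ?thesis
  proof (intro exI[of _ R2] allI impI)
    fix R u
    assume "R2 \<le> R" and u: "leaf_smooth u" "supported_in (ball x (exp (- R)) \<inter> M) u" "\<forall>z\<in>M. 0 \<le> u z \<and> u z \<le> 1"
    then have R: "R1 \<le> R" "R > 0" "ln B \<le> 2 * R" "4 * A \<le> R" by (auto simp: R2_def)
    have AR: "A * (exp (- R))\<^sup>2 \<le> 1 / 4"
    proof -
      have "R \<le> exp R" using exp_ge_add_one_self[of R] by linarith
      also have "exp R \<le> exp (2 * R)" using R(2) by simp
      finally have "4 * A \<le> exp (2 * R)" using R(4) by simp
      then have "4 * A * exp (- (2 * R)) \<le> exp (2 * R) * exp (- (2 * R))" by (intro mult_right_mono) auto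
      then have "4 * A * exp (- (2 * R)) \<le> 1" by (simp flip: exp_add)
      moreover have "(exp (- R))\<^sup>2 = exp (- (2 * R))" by (simp flip: exp_of_nat_mult)
      ultimately show ?thesis by simp
    qed
    have "h / (32 * (exp (- R))\<^sup>2) * I (\<lambda>z. u z * leaf_density z) \<le>
        8 * A\<^sup>2 * (486 * sqrt (t\<^sup>2) * B * \<mu> + 2916 * B * t)"
      unfolding h_def A_def
    proof (rule lelong_step[where W = "W R" and V = V and ?u0.0 = u0])
      show "W R z \<le> t\<^sup>2" if "z \<in> M" "u0 z \<noteq> 0" for z
        using R1[OF R(1), of z] K(3)[of z] that by blast
      show "I (\<lambda>z. u z * leaf_density z) \<le> \<mu>" if "test_fun u" "\<And>z. z \<in> M \<Longrightarrow> 0 \<le> u z \<and> u z \<le> 1" for u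
        by (rule mass[OF that])
      show "I (\<lambda>z. g z * (1 - u0 z) * leaf_density z) \<le> t"
        if "test_fun g" "\<And>z. z \<in> M \<Longrightarrow> 0 \<le> g z \<and> g z \<le> 1" for g
        by (rule u0(3)[OF that])
    qed (use c0 R B2 B W(1-4) V u0(1,2) t2 u AR in \<open>auto simp: A_def\<close>)
    also have "\<dots> \<le> 8 * A\<^sup>2 * (2916 * B * (\<mu> + 1) * t)"
    proof (intro mult_left_mono)
      have "486 * (t * B * \<mu>) \<le> 2916 * (t * B * \<mu>)" using t B2 \<mu>0 by (intro mult_right_mono) auto
      then show "486 * sqrt (t\<^sup>2) * B * \<mu> + 2916 * B * t \<le> 2916 * B * (\<mu> + 1) * t"
        using t by (simp add: algebra_simps)
    qed simp
    finally have "h / (32 * (exp (- R))\<^sup>2) * I (\<lambda>z. u z * leaf_density z) \<le> 8 * A\<^sup>2 * (2916 * B * (\<mu> + 1) * t)" .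
    then have "I (\<lambda>z. u z * leaf_density z) \<le> (exp (- R))\<^sup>2 * (D * t)"
      using h by (simp add: D_def field_simps)
    also have "\<dots> \<le> (exp (- R))\<^sup>2 * \<tau>" using t by (intro mult_left_mono) auto
    finally show "I (\<lambda>z. u z * leaf_density z) \<le> \<tau> * (exp (- R))\<^sup>2" by (simp add: mult.commute)
  qed
qed

text \<open>At the origin all depths are at least \<open>R\<close> on the small ball, and the two
  barriers built from the nonreal ratio apply. At any other \<open>x\<close> some coordinate is
  nonzero, the density is bounded below near \<open>x\<close>, and \<open>dist2 x\<close> is
  subharmonic enough to compensate the Laplacian of a squared depth.\<close>

lemma lelong_estimate_hyperplanes:
  assumes kl: "\<exists>l k. l \<noteq> k \<and> lam $ k / lam $ l \<notin> \<real>"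
    and mass: "\<And>u. test_fun u \<Longrightarrow> (\<And>z. z \<in> M \<Longrightarrow> 0 \<le> u z \<and> u z \<le> 1) \<Longrightarrow> I (\<lambda>z. u z * leaf_density z) \<le> \<mu>"
    and x: "x \<in> polydisc 1" "x $ i = 0" and \<tau>: "\<tau> > 0"
  shows "\<exists>R1. \<forall>R\<ge>R1. \<forall>u. leaf_smooth u \<longrightarrow> supported_in (ball x (exp (- R)) \<inter> M) u \<longrightarrow>
    (\<forall>z\<in>M. 0 \<le> u z \<and> u z \<le> 1) \<longrightarrow> I (\<lambda>z. u z * leaf_density z) \<le> \<tau> * (exp (- R))\<^sup>2"
proof -
  have "polydisc 1 = (\<Inter>j. {z::complex^'n. cmod (z $ j) < 1})" by (auto simp: polydisc_def)
  moreover have "open \<dots>" by (intro open_INT open_Collect_less ballI continuous_intros) auto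
  ultimately have "open (polydisc 1 :: (complex^'n) set)" by simp
  then obtain c1 where c1: "c1 > 0" "cball x c1 \<subseteq> polydisc 1"
    using x(1) open_contains_cball by blast
  show ?thesis
  proof (cases "x = 0")
    case True
    obtain l k where "lam $ k / lam $ l \<notin> \<real>" using kl by blast
    moreover have "lam $ k / lam $ l = lam $ k * cnj (lam $ l) / of_real ((cmod (lam $ l))\<^sup>2)"
      by (rule complex_div_cnj)
    ultimately have im: "Im (lam $ k * cnj (lam $ l)) \<noteq> 0"
      using lam_nz[of l] by (metis Reals_divide Reals_of_real complex_is_Real_iff)
    define w where "w = lam $ k * cnj (lam $ l)"
    have "\<bar>Re w\<bar> < cmod w"
    proof -
      have "\<bar>Re w\<bar>\<^sup>2 < (cmod w)\<^sup>2" using im by (simp add: cmod_power2 flip: w_def)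
      then show ?thesis by (rule power2_less_imp_less) simp
    qed
    then have "\<bar>Re (lam $ k * cnj (lam $ l))\<bar> < cmod (lam $ k) * cmod (lam $ l)"
      by (simp only: w_def norm_mult complex_mod_cnj)
    from powr_barrier[OF this] obtain a where a: "1 < 2 * a"
      "leaf_smooth (\<lambda>z. (depth k z * depth l z) powr a)"
      "\<And>z. z \<in> M \<Longrightarrow> lap (\<lambda>z. (depth k z * depth l z) powr a) z \<le> 0" by blast
    from decaying_barrier[OF im] obtain V :: "nat \<Rightarrow> complex^'n \<Rightarrow> real" where V:
      "\<And>n. leaf_smooth (V n)" "\<And>n z. z \<in> M \<Longrightarrow> V n z > 0" "\<And>n z. z \<in> M \<Longrightarrow> lap (V n) z \<le> 0"
      "\<And>K. compact K \<Longrightarrow> K \<subseteq> M \<Longrightarrow> \<exists>n. \<forall>z\<in>K. 1 \<le> V n z"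
      "\<And>n \<kappa>. \<kappa> > 0 \<Longrightarrow> \<exists>C. \<forall>z\<in>M. V n z \<le> \<kappa> + C * leaf_density z" by blast
    \<comment> \<open>Since \<open>R powr (1 - 2 * a) * (R * R) powr a = R\<close>, this is at least
      \<open>R\<close> where both depths are; the negative exponent \<open>1 - 2 * a\<close> sends
      it to 0 on compact sets.\<close>
    define W where "W R z = R powr (1 - 2 * a) * (depth k z * depth l z) powr a" for R z
    show ?thesis
    proof (rule lelong_estimate[where W = W and V = V and ?c0.0 = c1, OF _ c1])
      show "I (\<lambda>z. u z * leaf_density z) \<le> \<mu>" if "test_fun u" "\<And>z. z \<in> M \<Longrightarrow> 0 \<le> u z \<and> u z \<le> 1" for u
        by (rule mass[OF that])
      show "leaf_smooth (W R)" if "R > 0" for R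
        unfolding W_def by (intro leaf_smooth_intros a(2))
      show "W R z > 0" if "R > 0" "z \<in> M" for R z
        using that depth_pos[OF that(2)] by (simp add: W_def less_imp_neq[THEN not_sym])
      show "lap (W R) z \<le> 0" if "R > 0" "z \<in> M" "z \<in> cball x c1" for R z
        unfolding W_def lap_cmult[OF a(2) that(2)] by (intro mult_nonneg_nonpos a(3) that) simp
      show "R \<le> W R z" if R: "R > 0" and z: "z \<in> M" "z \<in> ball x (exp (- R))" for R z
      proof -
        have d: "R \<le> depth j z" for j by (rule depth_ge[OF z]) (simp add: True)
        have "R * R \<le> depth k z * depth l z"
          using d[of k] d[of l] R depth_pos[OF z(1), of k] by (intro mult_mono) auto
        then have "(R * R) powr a \<le> (depth k z * depth l z) powr a"
          using R a(1) by (intro powr_mono2) auto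
        moreover have "R powr (1 - 2 * a) * (R * R) powr a = R"
          using R by (simp add: powr_mult flip: powr_add)
        ultimately show ?thesis unfolding W_def using R
          by (metis mult_left_mono powr_ge_zero)
      qed
      show "\<forall>\<omega>>0. \<exists>R1. \<forall>R\<ge>R1. \<forall>z\<in>K. W R z \<le> \<omega>" if K: "compact K" "K \<subseteq> M" for K
      proof -
        obtain b where b: "b > 0" "\<And>z. z \<in> K \<Longrightarrow> \<bar>(depth k z * depth l z) powr a\<bar> \<le> b"
          using bounded_on_compact[OF K a(2)] by metis
        have "\<exists>R1. \<forall>R\<ge>R1. \<forall>z\<in>K. W R z \<le> \<omega>" if \<omega>: "\<omega> > 0" for \<omega>
        proof -
          have "((\<lambda>R. R powr (1 - 2 * a) * b) \<longlongrightarrow> 0 * b) at_top"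
            using a(1) by (intro tendsto_mult tendsto_const tendsto_neg_powr filterlim_ident) auto
          then have "eventually (\<lambda>R. R powr (1 - 2 * a) * b < \<omega>) at_top"
            using \<omega> by (intro order_tendstoD(2)) auto
          then obtain R1 where R1: "\<And>R. R \<ge> R1 \<Longrightarrow> R powr (1 - 2 * a) * b < \<omega>"
            by (auto simp: eventually_at_top_linorder)
          have "W R z \<le> \<omega>" if "R \<ge> R1" "z \<in> K" for R z
          proof -
            have "W R z \<le> R powr (1 - 2 * a) * b"
              unfolding W_def using b(2)[OF that(2)] by (intro mult_left_mono) auto
            then show ?thesis using R1[OF that(1)] by simp
          qed
          then show ?thesis by blast
        qed
        then show ?thesis by blast
      qed
      show "\<exists>C. \<forall>z\<in>M \<inter> cball x c1. V n z \<le> \<kappa> + C * leaf_density z" if "\<kappa> > 0" for n \<kappa>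
        using V(5)[OF that, of n] by blast
    qed (use V(1-4) \<tau> in auto)
  next
    case False
    then obtain l where l: "x $ l \<noteq> 0" by (auto simp: vec_eq_iff)
    define c0 where "c0 = min c1 (cmod (x $ l) / 2)"
    have c0: "c0 > 0" "c0 \<le> c1" "c0 \<le> cmod (x $ l) / 2" using c1 l by (auto simp: c0_def)
    have cb: "cball x c0 \<subseteq> polydisc 1" using c1(2) c0(2) by (meson subset_cball subset_trans)
    define \<beta> where "\<beta> = (cmod (lam $ l) * (cmod (x $ l) / 2))\<^sup>2"
    have \<beta>: "\<beta> > 0" using lam_nz l by (simp add: \<beta>_def)
    have dens: "\<beta> \<le> leaf_density z" if "z \<in> cball x c0" for z
    proof -
      have "dist (x $ l) (z $ l) \<le> c0" using that dist_vec_nth_le[of x l z] by simp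
      then have "cmod (x $ l) - cmod (z $ l) \<le> cmod (x $ l) / 2"
        using norm_triangle_ineq2[of "x $ l" "z $ l"] c0(3) by (simp add: dist_norm)
      then have "cmod (x $ l) / 2 \<le> cmod (z $ l)" by simp
      then have "\<beta> \<le> (cmod (lam $ l * z $ l))\<^sup>2"
        unfolding \<beta>_def norm_mult by (intro power_mono mult_left_mono) auto
      also have "\<dots> \<le> leaf_density z" unfolding leaf_density_def by (rule member_le_sum) auto
      finally show ?thesis .
    qed
    define B where "B = 4 * real CARD('n) + 2"
    have B: "dist2 x z + 1 \<le> B" if "z \<in> M" for z using dist2_le[OF that x(1)] by (simp add: B_def)
    \<comment> \<open>The Laplacian of \<open>depth i * depth i\<close> is 2 |lam_i|^2, that of
      \<open>dist2 x\<close> is four times the density, which is at least \<open>\<beta>\<close>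
      near \<open>x\<close>; so subtracting \<open>C * dist2 x\<close> gives a superharmonic
      function, and adding \<open>C * B\<close> keeps it positive.\<close>
    define C where "C = (cmod (lam $ i))\<^sup>2 / \<beta>"
    have C: "C \<ge> 0" using \<beta> by (simp add: C_def)
    define W where "W R z = (1 / R) * (depth i z * depth i z + (C * B + (- C) * dist2 x z))" for R z
    have sm: "leaf_smooth (\<lambda>z. depth i z * depth i z + (C * B + (- C) * dist2 x z))"
      by (intro leaf_smooth_intros leaf_smooth_depth leaf_smooth_dist2)
    have pos: "depth i z * depth i z \<le> depth i z * depth i z + (C * B + (- C) * dist2 x z)" if "z \<in> M" for z
      using mult_left_mono[of "dist2 x z" B C] B[OF that] C by simp
    show ?thesis
    proof (rule lelong_estimate[where W = W and V = "\<lambda>n z. 1" and ?c0.0 = c0, OF _ c0(1) cb])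
      show "I (\<lambda>z. u z * leaf_density z) \<le> \<mu>" if "test_fun u" "\<And>z. z \<in> M \<Longrightarrow> 0 \<le> u z \<and> u z \<le> 1" for u
        by (rule mass[OF that])
      show "leaf_smooth (W R)" if "R > 0" for R
        unfolding W_def by (intro leaf_smooth_intros sm)
      show "W R z > 0" if "R > 0" "z \<in> M" for R z
        using pos[OF that(2)] that mult_pos_pos[OF depth_pos depth_pos, OF that(2) that(2), of i i] by (simp add: W_def)
      show "lap (W R) z \<le> 0" if R: "R > 0" and z: "z \<in> M" "z \<in> cball x c0" for R z
      proof -
        have "lap (W R) z = 1 / R * (2 * (cmod (lam $ i))\<^sup>2 + (- C) * (4 * leaf_density z))"
          unfolding W_def lap_cmult[OF sm z(1)] using z(1)
          by (simp add: lap_add lap_mult[OF leaf_smooth_depth leaf_smooth_depth] lap_depth grad_depth_self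
              lap_minus lap_cmult leaf_smooth_add leaf_smooth_mult leaf_smooth_depth leaf_smooth_dist2
              leaf_smooth_minus lap_dist2 del: mult_minus_left add_uminus_conv_diff)
        also have "\<dots> \<le> 0"
        proof (rule mult_nonneg_nonpos)
          have "(cmod (lam $ i))\<^sup>2 = C * \<beta>" using \<beta> by (simp add: C_def)
          also have "\<dots> \<le> C * leaf_density z" using dens[OF z(2)] C by (intro mult_left_mono)
          finally have "(cmod (lam $ i))\<^sup>2 \<le> C * leaf_density z" .
          moreover have "0 \<le> C * leaf_density z" using C leaf_density_pos[OF z(1)] by simp
          moreover have "(- C) * (4 * leaf_density z) = - 4 * (C * leaf_density z)" by simp
          ultimately show "2 * (cmod (lam $ i))\<^sup>2 + (- C) * (4 * leaf_density z) \<le> 0" by linarith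
        qed (use R in simp)
        finally show ?thesis .
      qed
      show "R \<le> W R z" if R: "R > 0" and z: "z \<in> M" "z \<in> ball x (exp (- R))" for R z
      proof -
        have "R \<le> depth i z" by (rule depth_ge[OF z x(2)])
        then have "R * R \<le> depth i z * depth i z" using R by (intro mult_mono) auto
        then have "1 / R * (R * R) \<le> W R z"
          unfolding W_def using R pos[OF z(1)] by (intro mult_left_mono) auto
        then show ?thesis using R by simp
      qed
      show "\<forall>\<omega>>0. \<exists>R1. \<forall>R\<ge>R1. \<forall>z\<in>K. W R z \<le> \<omega>" if K: "compact K" "K \<subseteq> M" for K
      proof -
        obtain b where b: "b > 0" "\<And>z. z \<in> K \<Longrightarrow> \<bar>depth i z * depth i z + (C * B + (- C) * dist2 x z)\<bar> \<le> b"
          using bounded_on_compact[OF K sm] by metis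
        have "W R z \<le> \<omega>" if \<omega>: "\<omega> > 0" and R: "R \<ge> b / \<omega>" and z: "z \<in> K" for \<omega> R z
        proof -
          have R0: "R > 0" using R b \<omega> by (meson divide_pos_pos less_le_trans)
          have "W R z \<le> 1 / R * b" unfolding W_def using b(2)[OF z] R0 by (intro mult_left_mono) auto
          also have "\<dots> \<le> \<omega>" using R R0 \<omega> by (simp add: field_simps)
          finally show ?thesis .
        qed
        then show ?thesis by blast
      qed
      show "\<exists>C. \<forall>z\<in>M \<inter> cball x c0. (1::real) \<le> \<kappa> + C * leaf_density z" if "\<kappa> > 0" for \<kappa> :: real
      proof (intro exI[of _ "1 / \<beta>"] ballI)
        fix z assume "z \<in> M \<inter> cball x c0"
        then have "1 \<le> 1 / \<beta> * leaf_density z" using dens[of z] \<beta> by (simp add: field_simps)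
        then show "1 \<le> \<kappa> + 1 / \<beta> * leaf_density z" using that by simp
      qed
    qed (use \<tau> in auto)
  qed
qed

end

subsection \<open>Currents directed by the foliation as functionals\<close>

lemma has_vector_derivative_of_real_iff:
  fixes v :: "real \<Rightarrow> real"
  shows "((\<lambda>s. of_real (v s) :: complex) has_vector_derivative of_real a) F \<longleftrightarrow> (v has_real_derivative a) F"
proof
  assume "((\<lambda>s. of_real (v s) :: complex) has_vector_derivative of_real a) F"
  from bounded_linear.has_vector_derivative[OF bounded_linear_Re this]
  show "(v has_real_derivative a) F" by (simp add: has_real_derivative_iff_has_vector_derivative)
next
  assume "(v has_real_derivative a) F"
  then have "(v has_vector_derivative a) F" by (simp add: has_real_derivative_iff_has_vector_derivative)
  from bounded_linear.has_vector_derivative[OF bounded_linear_of_real this]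
  show "((\<lambda>s. of_real (v s) :: complex) has_vector_derivative of_real a) F" .
qed

section \<open>Derivatives in flow boxes and along the flow\<close>

context linear_foliation
begin

abbreviation field_foliation :: "'n flow_box set" where
  "field_foliation \<equiv> foliation_of_field M (linear_field lam)"

context
  fixes U \<phi> k
  assumes box: "(U, \<phi>, k) \<in> field_foliation"
begin

lemma box_facts:
  shows "open U" "U \<subseteq> M" "inj_on \<phi> U" "open (\<phi> ` U)" "continuous_on U \<phi>" "continuous_on (\<phi> ` U) (inv_into U \<phi>)"
    "holomorphic_map_on \<phi> U" "holomorphic_map_on (inv_into U \<phi>) (\<phi> ` U)"
proof -
  have fb: "is_flow_box M (U, \<phi>, k)" using box by (simp add: foliation_of_field_def)
  then show h: "open U" "U \<subseteq> M" "inj_on \<phi> U" "holomorphic_map_on \<phi> U" "holomorphic_map_on (inv_into U \<phi>) (\<phi> ` U)"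
    by (auto simp: is_flow_box_def)
  show "open (\<phi> ` U)" by (rule is_flow_box_open_image[OF fb])
  show "continuous_on U \<phi>" "continuous_on (\<phi> ` U) (inv_into U \<phi>)"
    using h by (auto intro!: continuous_at_imp_continuous_on differentiable_imp_continuous_within
        simp: holomorphic_map_on_def)
qed

text \<open>On a plaque the inverse chart solves the linear differential equation of the field,
  because its derivative maps \<open>axis k d\<close> to \<open>d\<close> times the field.
  Multiplying the j-th coordinate by the integrating factor exp (- lam_j d s) gives a function with
  zero derivative.\<close>

lemma plaque_flow:
  assumes z: "z \<in> U"
  shows "eventually (\<lambda>s::real. \<phi> z + s *\<^sub>R axis k d \<in> \<phi> ` U \<and>
    inv_into U \<phi> (\<phi> z + s *\<^sub>R axis k d) = flow (of_real s * d) z) (nhds 0)"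
proof -
  let ?\<psi> = "inv_into U \<phi>"
  obtain \<rho> where \<rho>: "\<rho> > 0" "ball (\<phi> z) \<rho> \<subseteq> \<phi> ` U"
    using box_facts(4) z by (meson imageI open_contains_ball)
  define r where "r = \<rho> / (norm d + 1)"
  have nd: "norm d + 1 > 0" by (simp add: add_nonneg_pos)
  have r: "r > 0" using \<rho>(1) nd by (simp add: r_def)
  define p where "p s = \<phi> z + s *\<^sub>R axis k d" for s :: real
  have pin: "p s \<in> \<phi> ` U" if s: "s \<in> {-r<..<r}" for s
  proof -
    have "norm (axis k d :: complex^'n) = norm d" by (simp add: norm_eq_sqrt_inner inner_axis_axis)
    then have "dist (\<phi> z) (p s) = \<bar>s\<bar> * norm d" by (simp add: p_def dist_norm)
    also have "\<dots> \<le> \<bar>s\<bar> * (norm d + 1)" by (intro mult_left_mono) auto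
    also have "\<dots> < r * (norm d + 1)" using s nd by (intro mult_strict_right_mono) auto
    also have "\<dots> = \<rho>" using nd by (simp add: r_def)
    finally show ?thesis using \<rho>(2) by auto
  qed
  have psi0: "?\<psi> (p 0) = z" using z box_facts(3) by (simp add: p_def)
  have "?\<psi> (p s) = flow (of_real s * d) z" if s: "s \<in> {-r<..<r}" for s
  proof -
    have "?\<psi> (p s) $ j = z $ j * exp (lam $ j * (of_real s * d))" for j
    proof -
      define y where "y s = ?\<psi> (p s) $ j * exp (- (lam $ j * d) * of_real s)" for s :: real
      have "(y has_vector_derivative 0) (at s within {-r<..<r})" if s: "s \<in> {-r<..<r}" for s
      proof -
        define q where "q = ?\<psi> (p s)"
        have q: "q \<in> U" "\<phi> q = p s" using pin[OF s] by (auto simp: q_def inv_into_into f_inv_into_f)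
        have 1: "(p has_derivative (\<lambda>h. h *\<^sub>R axis k d)) (at s)"
          unfolding p_def by (auto intro!: derivative_eq_intros)
        have 2: "(?\<psi> has_derivative frechet_derivative ?\<psi> (at (p s))) (at (p s))"
          using holomorphic_map_on_has_derivative[OF box_facts(8)] pin[OF s] by simp
        have "((\<lambda>s. ?\<psi> (p s)) has_derivative (\<lambda>h. frechet_derivative ?\<psi> (at (p s)) (h *\<^sub>R axis k d))) (at s)"
          using diff_chain_at[OF 1 2] by (simp add: o_def)
        moreover have "frechet_derivative ?\<psi> (at (p s)) (h *\<^sub>R axis k d) = h *\<^sub>R (d *s linear_field lam q)" for h
          using foliation_of_field_inverse_derivative[OF box q(1), of d] q(2)
            linear_cmul[OF has_derivative_linear[OF 2]] by simp
        ultimately have "((\<lambda>s. ?\<psi> (p s)) has_vector_derivative d *s linear_field lam q) (at s)"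
          by (simp add: has_vector_derivative_def)
        from bounded_linear.has_vector_derivative[OF bounded_linear_vec_nth this, of j]
        have 3: "((\<lambda>s. ?\<psi> (p s) $ j) has_vector_derivative d * (lam $ j * q $ j)) (at s)"
          by (simp add: linear_field_def)
        have "((\<lambda>x. exp (- (lam $ j * d) * x)) has_field_derivative
            exp (- (lam $ j * d) * of_real s) * - (lam $ j * d)) (at (of_real s))"
          by (rule derivative_eq_intros refl | simp)+
        then have 4: "((\<lambda>s. exp (- (lam $ j * d) * of_real s)) has_vector_derivative
            exp (- (lam $ j * d) * of_real s) * - (lam $ j * d)) (at s)"
          by (rule has_vector_derivative_real_field)
        from has_vector_derivative_mult[OF 3 4]
        have "(y has_vector_derivative 0) (at s)"
          unfolding y_def[abs_def] by (simp add: q_def algebra_simps)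
        then show ?thesis by (rule has_vector_derivative_at_within)
      qed
      then obtain c where c: "\<And>s. s \<in> {-r<..<r} \<Longrightarrow> y s = c"
        using has_vector_derivative_zero_constant[of "{-r<..<r}" y] by auto
      have "y s = y 0" using c[OF s] c[of 0] r by simp
      also have "y 0 = z $ j" by (simp add: y_def psi0)
      finally have "?\<psi> (p s) $ j = z $ j * exp (lam $ j * d * of_real s)"
        by (simp add: y_def exp_minus field_simps)
      then show ?thesis by (simp add: mult_ac)
    qed
    then show ?thesis by (simp add: vec_eq_iff flow_def)
  qed
  moreover have "eventually (\<lambda>s. s \<in> {-r<..<r}) (nhds (0::real))"
    using r by (intro eventually_nhds_in_open) auto
  ultimately show ?thesis using pin by (auto elim!: eventually_mono simp: p_def)
qed

lemma plaque_has_deriv_iff: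
  fixes g :: "complex^'n \<Rightarrow> complex"
  assumes z: "z \<in> U" and g: "\<And>w. w \<in> \<phi> ` U \<Longrightarrow> g w = of_real (u (inv_into U \<phi> w))"
  shows "((\<lambda>s::real. g (\<phi> z + s *\<^sub>R axis k d)) has_vector_derivative of_real a) (at 0) \<longleftrightarrow> has_leaf_deriv d u a z"
proof -
  have ev: "eventually (\<lambda>s::real. g (\<phi> z + s *\<^sub>R axis k d) = of_real (u (flow (of_real s * d) z))) (nhds 0)"
    using plaque_flow[OF z, of d] by eventually_elim (auto simp: g)
  have "((\<lambda>s::real. g (\<phi> z + s *\<^sub>R axis k d)) has_vector_derivative of_real a) (at 0) \<longleftrightarrow>
      ((\<lambda>s::real. of_real (u (flow (of_real s * d) z)) :: complex) has_vector_derivative of_real a) (at 0)"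
  proof (rule has_vector_derivative_cong_ev)
    show "\<forall>\<^sub>F s in nhds 0. s \<in> UNIV \<longrightarrow> g (\<phi> z + s *\<^sub>R axis k d) = of_real (u (flow (of_real s * d) z))"
      using ev by simp
  qed (rule eventually_nhds_x_imp_x[OF ev])
  then show ?thesis by (simp add: has_vector_derivative_of_real_iff)
qed

lemma plaque_deriv_eq:
  assumes "z \<in> U" "\<And>w. w \<in> \<phi> ` U \<Longrightarrow> g w = of_real (u (inv_into U \<phi> w))" "has_leaf_deriv d u a z"
  shows "plaque_deriv k d g (\<phi> z) = of_real a"
  unfolding plaque_deriv_def
  by (rule vector_derivative_at) (rule plaque_has_deriv_iff[where g = g and u = u, OF assms(1,2), THEN iffD2], assumption, rule assms(3))

lemma plaque_derivs_of_leaf_smooth: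
  assumes u: "leaf_smooth u" and g: "\<And>w. w \<in> \<phi> ` U \<Longrightarrow> g w = of_real (u (inv_into U \<phi> w))"
    and ds: "ds \<in> lists {1, \<i>}" and w: "w \<in> \<phi> ` U"
  shows "plaque_derivs k ds g w = of_real (foldr leaf_deriv ds u (inv_into U \<phi> w))"
  using ds w
proof (induction arbitrary: w)
  case Nil
  then show ?case by (simp add: plaque_derivs_def g)
next
  case (Cons d ds)
  then obtain z where z: "z \<in> U" "w = \<phi> z" by blast
  have "\<exists>a. has_leaf_deriv d (foldr leaf_deriv ds u) a z"
    using u Cons.hyps z box_facts(2) unfolding leaf_smooth_def by blast
  then obtain a where a: "has_leaf_deriv d (foldr leaf_deriv ds u) a z" by blast
  have "plaque_deriv k d (plaque_derivs k ds g) (\<phi> z) = of_real a"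
    by (rule plaque_deriv_eq[OF z(1) _ a]) (rule Cons.IH)
  then show ?case using leaf_derivI[OF a] z box_facts(3) by (simp add: plaque_derivs_def)
qed

lemma plaque_smooth_of_leaf_smooth:
  assumes u: "leaf_smooth u" and g: "\<And>w. w \<in> \<phi> ` U \<Longrightarrow> g w = of_real (u (inv_into U \<phi> w))"
  shows "plaque_smooth_on k (\<phi> ` U) g"
  unfolding plaque_smooth_on_def
proof (intro ballI conjI)
  fix ds :: "complex list" assume ds: "ds \<in> lists {1, \<i>}"
  have eq: "plaque_derivs k ds g w = of_real (foldr leaf_deriv ds u (inv_into U \<phi> w))" if "w \<in> \<phi> ` U" for w
    by (rule plaque_derivs_of_leaf_smooth[OF u g ds that])
  have "continuous_on M (foldr leaf_deriv ds u)" using u ds unfolding leaf_smooth_def by blast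
  moreover have "inv_into U \<phi> ` \<phi> ` U \<subseteq> M" using box_facts(2,3) by (auto simp: inv_into_into)
  ultimately have "continuous_on (\<phi> ` U) (\<lambda>w. of_real (foldr leaf_deriv ds u (inv_into U \<phi> w)) :: complex)"
    by (intro continuous_intros continuous_on_compose2[OF _ box_facts(6)])
  then show "continuous_on (\<phi> ` U) (plaque_derivs k ds g)"
    by (rule continuous_on_cong[THEN iffD1, OF refl, rotated]) (simp add: eq)
  fix d w assume d: "d \<in> {1, \<i> :: complex}" and "w \<in> \<phi> ` U"
  then obtain z where z: "z \<in> U" "w = \<phi> z" by blast
  obtain a where a: "has_leaf_deriv d (foldr leaf_deriv ds u) a z"
    using u ds d z box_facts(2) unfolding leaf_smooth_def by blast
  have "((\<lambda>s::real. plaque_derivs k ds g (\<phi> z + s *\<^sub>R axis k d)) has_vector_derivative of_real a) (at 0)"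
    by (rule plaque_has_deriv_iff[where g = "plaque_derivs k ds g" and u = "foldr leaf_deriv ds u", OF z(1) eq, THEN iffD2])
       (assumption, rule a)
  then show "(\<lambda>s::real. plaque_derivs k ds g (w + s *\<^sub>R axis k d)) differentiable at 0"
    unfolding z(2) by (rule differentiableI_vector)
qed

lemma has_leaf_deriv_of_plaque:
  fixes g :: "complex^'n \<Rightarrow> complex"
  assumes z: "z \<in> U" and g: "\<And>w. w \<in> \<phi> ` U \<Longrightarrow> g w = of_real (u (inv_into U \<phi> w))"
    and "(\<lambda>s::real. g (\<phi> z + s *\<^sub>R axis k d)) differentiable at 0"
  shows "\<exists>a. has_leaf_deriv d u a z"
proof -
  obtain D where "((\<lambda>s::real. g (\<phi> z + s *\<^sub>R axis k d)) has_vector_derivative D) (at 0)"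
    using assms(3) vector_derivative_works by blast
  from bounded_linear.has_vector_derivative[OF bounded_linear_Re this]
  have D: "((\<lambda>s::real. Re (g (\<phi> z + s *\<^sub>R axis k d))) has_real_derivative Re D) (at 0)"
    by (simp add: has_real_derivative_iff_has_vector_derivative)
  have "eventually (\<lambda>s::real. Re (g (\<phi> z + s *\<^sub>R axis k d)) = u (flow (of_real s * d) z)) (nhds 0)"
    using plaque_flow[OF z, of d] by eventually_elim (auto simp: g)
  from DERIV_cong_ev[OF refl this refl] D show ?thesis by blast
qed

text \<open>In contrast to \<open>plaque_derivs_of_leaf_smooth\<close>, the derivative along the
  flow is not given: each induction step takes differentiability from
  \<open>plaque_smooth_on\<close> and transfers it through the induction hypothesis.\<close>

lemma leaf_derivs_of_plaque_smooth:
  assumes g: "\<And>w. w \<in> \<phi> ` U \<Longrightarrow> g w = of_real (u (inv_into U \<phi> w))" and smooth: "plaque_smooth_on k (\<phi> ` U) g"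
    and ds: "ds \<in> lists {1, \<i>}" and w: "w \<in> \<phi> ` U"
  shows "plaque_derivs k ds g w = of_real (foldr leaf_deriv ds u (inv_into U \<phi> w))"
  using ds w
proof (induction arbitrary: w)
  case Nil
  then show ?case by (simp add: plaque_derivs_def g)
next
  case (Cons d ds)
  then obtain z where z: "z \<in> U" "w = \<phi> z" by blast
  have "(\<lambda>s::real. plaque_derivs k ds g (\<phi> z + s *\<^sub>R axis k d)) differentiable at 0"
    using smooth Cons.hyps z unfolding plaque_smooth_on_def by blast
  from has_leaf_deriv_of_plaque[OF z(1) Cons.IH this]
  obtain a where a: "has_leaf_deriv d (foldr leaf_deriv ds u) a z" by blast
  have "plaque_deriv k d (plaque_derivs k ds g) (\<phi> z) = of_real a"
    by (rule plaque_deriv_eq[OF z(1) Cons.IH a])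
  then show ?case using leaf_derivI[OF a] z box_facts(3) by (simp add: plaque_derivs_def)
qed

end

lemma box_at:
  assumes "z \<in> M"
  obtains U \<phi> k where "(U, \<phi>, k) \<in> field_foliation" "z \<in> U"
proof -
  have "\<forall>j. z $ j \<noteq> 0" if "z \<in> M" for z using that by (auto simp: punctured_polydisc_def)
  from foliation_of_field_covers[OF open_punctured_polydisc assms this, of lam] lam_nz
  obtain b where "b \<in> field_foliation" "z \<in> fst b" by blast
  then show thesis using that by (cases b) auto
qed

lemma leaf_smooth_of_leaf_functions:
  assumes f: "f \<in> leaf_functions field_foliation V" and real: "\<And>z. f z = of_real (u z)"
  shows "leaf_smooth u" "supported_in V u"
proof -
  show "supported_in V u"
    using f unfolding leaf_functions_def supported_in_def by (auto simp: real)
  show "leaf_smooth u"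
    unfolding leaf_smooth_def
  proof (intro ballI conjI)
    fix ds :: "complex list" assume ds: "ds \<in> lists {1, \<i>}"
    have *: "plaque_smooth_on k (\<phi> ` U) (f \<circ> inv_into U \<phi>) \<and>
        (\<forall>z\<in>U. plaque_derivs k ds (f \<circ> inv_into U \<phi>) (\<phi> z) = of_real (foldr leaf_deriv ds u z))"
      if b: "(U, \<phi>, k) \<in> field_foliation" for U \<phi> k
    proof -
      have s: "plaque_smooth_on k (\<phi> ` U) (f \<circ> inv_into U \<phi>)"
        using f b unfolding leaf_functions_def by blast
      show ?thesis
        using s leaf_derivs_of_plaque_smooth[OF b _ s ds, of u] box_facts(3)[OF b] by (auto simp: real)
    qed
    have "isCont (foldr leaf_deriv ds u) z" if z: "z \<in> M" for z
    proof -
      obtain U \<phi> k where b: "(U, \<phi>, k) \<in> field_foliation" "z \<in> U" using box_at[OF z] .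
      have c: "continuous_on (\<phi> ` U) (plaque_derivs k ds (f \<circ> inv_into U \<phi>))"
        using *[OF b(1)] ds unfolding plaque_smooth_on_def by blast
      have "continuous_on U (\<lambda>z. Re (plaque_derivs k ds (f \<circ> inv_into U \<phi>) (\<phi> z)))"
        by (rule continuous_on_Re[OF continuous_on_compose2[OF c box_facts(5)[OF b(1)] subset_refl]])
      then have "continuous_on U (foldr leaf_deriv ds u)"
        by (rule continuous_on_cong[THEN iffD1, OF refl, rotated]) (simp add: *[OF b(1)])
      then show ?thesis using box_facts(1)[OF b(1)] b(2) continuous_on_eq_continuous_at by blast
    qed
    then show "continuous_on M (foldr leaf_deriv ds u)" by (simp add: continuous_at_imp_continuous_on)
    fix d z assume d: "d \<in> {1, \<i> :: complex}" and z: "z \<in> M"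
    obtain U \<phi> k where b: "(U, \<phi>, k) \<in> field_foliation" "z \<in> U" using box_at[OF z] .
    have "(\<lambda>s::real. plaque_derivs k ds (f \<circ> inv_into U \<phi>) (\<phi> z + s *\<^sub>R axis k d)) differentiable at 0"
      using *[OF b(1)] ds d b(2) unfolding plaque_smooth_on_def by blast
    moreover have "plaque_derivs k ds (f \<circ> inv_into U \<phi>) w = of_real (foldr leaf_deriv ds u (inv_into U \<phi> w))"
      if "w \<in> \<phi> ` U" for w
      using *[OF b(1)] that by (metis (no_types) f_inv_into_f inv_into_into)
    ultimately show "\<exists>a. has_leaf_deriv d (foldr leaf_deriv ds u) a z"
      using has_leaf_deriv_of_plaque[OF b] by blast
  qed
qed

lemma leaf_functions_of_leaf_smooth:
  assumes u: "leaf_smooth u" and supp: "supported_in V u" and V: "V \<subseteq> M"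
  shows "(\<lambda>z. of_real (if z \<in> M then u z else 0)) \<in> leaf_functions field_foliation V"
proof -
  obtain K where K: "compact K" "K \<subseteq> V" "\<And>z. z \<in> M - K \<Longrightarrow> u z = 0"
    using supp unfolding supported_in_def by blast
  have "plaque_smooth_on k (\<phi> ` U) ((\<lambda>z. of_real (if z \<in> M then u z else 0)) \<circ> inv_into U \<phi>)"
    if b: "(U, \<phi>, k) \<in> field_foliation" for U \<phi> k
    using box_facts(2)[OF b]
    by (intro plaque_smooth_of_leaf_smooth[OF b u]) (auto simp: inv_into_into subset_iff)
  then show ?thesis
    using K V unfolding leaf_functions_def by (auto intro!: exI[of _ K])
qed

section \<open>Leafwise forms, currents and measures in terms of functions\<close>

lemma leaf_tangent_eq:
  assumes z: "z \<in> M"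
  shows "leaf_tangent field_foliation z = range (\<lambda>c. c *s linear_field lam z)"
proof (intro equalityI subsetI)
  fix v assume "v \<in> leaf_tangent field_foliation z"
  then obtain U \<phi> k where b: "(U, \<phi>, k) \<in> field_foliation" "z \<in> U"
    and t: "transversal_part k (frechet_derivative \<phi> (at z) v) = 0"
    unfolding leaf_tangent_def by blast
  let ?\<psi> = "inv_into U \<phi>"
  define c where "c = frechet_derivative \<phi> (at z) v $ k"
  have "frechet_derivative \<phi> (at z) v = axis k c"
    using t by (auto simp: vec_eq_iff transversal_part_def axis_def c_def split: if_splits)
  have 1: "(\<phi> has_derivative frechet_derivative \<phi> (at z)) (at z)"
    using holomorphic_map_on_has_derivative[OF box_facts(7)[OF b(1)] b(2)] .
  have 2: "(?\<psi> has_derivative frechet_derivative ?\<psi> (at (\<phi> z))) (at (\<phi> z))"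
    using holomorphic_map_on_has_derivative[OF box_facts(8)[OF b(1)]] b(2) by simp
  have "((\<lambda>z. z) has_derivative (\<lambda>v. frechet_derivative ?\<psi> (at (\<phi> z)) (frechet_derivative \<phi> (at z) v))) (at z)"
  proof (rule has_derivative_transform_within_open[OF _ box_facts(1)[OF b(1)] b(2)])
    show "((\<lambda>x. ?\<psi> (\<phi> x)) has_derivative (\<lambda>v. frechet_derivative ?\<psi> (at (\<phi> z)) (frechet_derivative \<phi> (at z) v))) (at z)"
      using diff_chain_at[OF 1 2] by (simp add: o_def)
  qed (simp add: box_facts(3)[OF b(1)])
  then have "(\<lambda>v. frechet_derivative ?\<psi> (at (\<phi> z)) (frechet_derivative \<phi> (at z) v)) = (\<lambda>v. v)"
    using has_derivative_unique has_derivative_ident by blast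
  then have "v = frechet_derivative ?\<psi> (at (\<phi> z)) (axis k c)"
    using \<open>frechet_derivative \<phi> (at z) v = axis k c\<close> by metis
  then have "v = c *s linear_field lam z"
    using foliation_of_field_inverse_derivative[OF b] by simp
  then show "v \<in> range (\<lambda>c. c *s linear_field lam z)" by (rule range_eqI)
next
  fix v assume "v \<in> range (\<lambda>c. c *s linear_field lam z)"
  then obtain c where v: "v = c *s linear_field lam z" by blast
  obtain U \<phi> k where b: "(U, \<phi>, k) \<in> field_foliation" "z \<in> U" using box_at[OF z] .
  have "frechet_derivative \<phi> (at z) v = c *s axis k 1"
    using b box_facts(7)[OF b(1)] unfolding v holomorphic_map_on_def foliation_of_field_def by auto
  then have "transversal_part k (frechet_derivative \<phi> (at z) v) = 0"
    by (simp add: transversal_part_def vec_eq_iff axis_def)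
  then show "v \<in> leaf_tangent field_foliation z" unfolding leaf_tangent_def using b by blast
qed

lemma leaf_tangent_empty:
  assumes "z \<notin> M"
  shows "leaf_tangent field_foliation z = {}"
  using assms box_facts(2) unfolding leaf_tangent_def by fast

lemma plaque_area_field:
  assumes b: "(U, \<phi>, k) \<in> field_foliation" "z \<in> U"
  shows "plaque_area (U, \<phi>, k) z (c *s linear_field lam z) (d *s linear_field lam z) = of_real (Im (cnj c * d))"
proof -
  have "frechet_derivative \<phi> (at z) (c *s linear_field lam z) = c *s axis k 1" for c
    using b box_facts(7)[OF b(1)] unfolding holomorphic_map_on_def foliation_of_field_def by auto
  then show ?thesis by (simp add: plaque_area_def axis_def)
qed

lemma hermitian_form_field:
  "hermitian_form z (c *s linear_field lam z) (d *s linear_field lam z) = of_real (leaf_density z * Im (cnj c * d))"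
proof -
  have "Im (cnj (c * (lam $ j * z $ j)) * (d * (lam $ j * z $ j))) = (cmod (lam $ j * z $ j))\<^sup>2 * Im (cnj c * d)" for j
  proof -
    have "cnj (c * (lam $ j * z $ j)) * (d * (lam $ j * z $ j)) =
        (lam $ j * z $ j) * cnj (lam $ j * z $ j) * (cnj c * d)" by (simp add: mult_ac)
    also have "\<dots> = of_real ((cmod (lam $ j * z $ j))\<^sup>2) * (cnj c * d)"
      by (simp only: complex_norm_square)
    finally have e: "cnj (c * (lam $ j * z $ j)) * (d * (lam $ j * z $ j)) = of_real ((cmod (lam $ j * z $ j))\<^sup>2) * (cnj c * d)" .
    have "Im (of_real a * w) = a * Im w" for a w by simp
    then show ?thesis unfolding e .
  qed
  then show ?thesis by (simp add: hermitian_form_def linear_field_def leaf_density_def sum_distrib_right)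
qed

text \<open>The leafwise form whose value on the field \<open>X\<close> and \<open>i X\<close> is \<open>u\<close>.\<close>

definition leaf_form :: "(complex^'n \<Rightarrow> real) \<Rightarrow> 'n two_form" where
  "leaf_form u = (\<lambda>p v w. of_real (u p / leaf_density p) * leaf_restrict field_foliation hermitian_form p v w)"

lemma leaf_form_field:
  assumes "z \<in> M"
  shows "leaf_form u z (c *s linear_field lam z) (d *s linear_field lam z) = of_real (u z * Im (cnj c * d))"
proof -
  have "c *s linear_field lam z \<in> leaf_tangent field_foliation z" for c
    unfolding leaf_tangent_eq[OF assms] by (rule range_eqI[OF refl])
  then have "leaf_form u z (c *s linear_field lam z) (d *s linear_field lam z) =
      of_real (u z / leaf_density z * (leaf_density z * Im (cnj c * d)))"
    by (simp only: leaf_form_def leaf_restrict_def simp_thms if_True hermitian_form_field of_real_mult)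
  then show ?thesis using leaf_density_pos[OF assms] by simp
qed

lemma leaf_form_not_tangent:
  "v \<notin> leaf_tangent field_foliation z \<or> w \<notin> leaf_tangent field_foliation z \<Longrightarrow> leaf_form u z v w = 0"
  by (auto simp: leaf_form_def leaf_restrict_def)

lemma plaque_coeff_leaf_form:
  assumes b: "(U, \<phi>, k) \<in> field_foliation" and w: "w \<in> \<phi> ` U"
  shows "plaque_coeff (U, \<phi>, k) (leaf_form u) w = of_real (u (inv_into U \<phi> w))"
proof -
  obtain z where z: "z \<in> U" "w = \<phi> z" using w by blast
  then have "z \<in> M" "inv_into U \<phi> w = z" using box_facts(2,3)[OF b] by auto
  then show ?thesis
    using foliation_of_field_inverse_derivative[OF b z(1)] leaf_form_field[of z u 1 \<i>] z
    by (simp add: plaque_coeff_def)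
qed

lemma leaf_form_mem:
  assumes u: "test_fun u"
  shows "leaf_form u \<in> leaf_forms field_foliation M"
proof -
  obtain K where K: "compact K" "K \<subseteq> M" "\<And>z. z \<in> M - K \<Longrightarrow> u z = 0"
    using u unfolding test_fun_def supported_in_def by blast
  have "leaf_form u p v w = 0" if "p \<notin> K" for p v w
    using that K(3)[of p] leaf_tangent_empty[of p] leaf_form_not_tangent[of v p w u]
    by (cases "p \<in> M") (auto simp: leaf_form_def)
  moreover have "plaque_smooth_on k (\<phi> ` U) (plaque_coeff (U, \<phi>, k) (leaf_form u)) \<and>
      (\<forall>p\<in>U. \<forall>v\<in>leaf_tangent field_foliation p. \<forall>w\<in>leaf_tangent field_foliation p.
        leaf_form u p v w = plaque_coeff (U, \<phi>, k) (leaf_form u) (\<phi> p) * plaque_area (U, \<phi>, k) p v w)"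
    if b: "(U, \<phi>, k) \<in> field_foliation" for U \<phi> k
  proof (intro conjI ballI)
    show "plaque_smooth_on k (\<phi> ` U) (plaque_coeff (U, \<phi>, k) (leaf_form u))"
      by (rule plaque_smooth_of_leaf_smooth[OF b test_fun_leaf_smooth[OF u]]) (rule plaque_coeff_leaf_form[OF b])
    fix p v w assume p: "p \<in> U" and vw: "v \<in> leaf_tangent field_foliation p" "w \<in> leaf_tangent field_foliation p"
    have pM: "p \<in> M" using p box_facts(2)[OF b] by blast
    obtain c d where "v = c *s linear_field lam p" "w = d *s linear_field lam p"
      using vw unfolding leaf_tangent_eq[OF pM] by blast
    then show "leaf_form u p v w = plaque_coeff (U, \<phi>, k) (leaf_form u) (\<phi> p) * plaque_area (U, \<phi>, k) p v w"
      using plaque_coeff_leaf_form[OF b, of "\<phi> p" u] p box_facts(3)[OF b] leaf_form_field[OF pM]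
        plaque_area_field[OF b p] by simp
  qed
  ultimately show ?thesis
    using K(1,2) leaf_form_not_tangent[where u = u] unfolding leaf_forms_def by blast
qed

text \<open>Which flow box the choice operator picks is irrelevant: in every box around the point
  the plaque derivatives are the derivatives along the flow.\<close>

lemma ddc_eq_leaf_form:
  assumes u: "leaf_smooth u" and f: "\<And>z. z \<in> M \<Longrightarrow> f z = of_real (u z)"
  shows "ddc field_foliation f = leaf_form (\<lambda>z. 1 / (2 * pi) * lap u z)"
proof (intro ext)
  fix p v w
  show "ddc field_foliation f p v w = leaf_form (\<lambda>z. 1 / (2 * pi) * lap u z) p v w"
  proof (cases "v \<in> leaf_tangent field_foliation p \<and> w \<in> leaf_tangent field_foliation p")
    case True
    then have pM: "p \<in> M" using leaf_tangent_empty[of p] by blast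
    define b where "b = (SOME b. b \<in> field_foliation \<and> p \<in> fst b)"
    obtain b' where "b' \<in> field_foliation \<and> p \<in> fst b'" using box_at[OF pM] by (metis fst_conv)
    then have "b \<in> field_foliation \<and> p \<in> fst b" unfolding b_def by (rule someI)
    then obtain U \<phi> k where b: "b = (U, \<phi>, k)" "(U, \<phi>, k) \<in> field_foliation" "p \<in> U" by (cases b) auto
    have g: "(f \<circ> inv_into U \<phi>) w = of_real (u (inv_into U \<phi> w))" if "w \<in> \<phi> ` U" for w
      using that box_facts(2)[OF b(2)] f by (simp add: inv_into_into subset_iff)
    have "plaque_derivs k [d, d] (f \<circ> inv_into U \<phi>) (\<phi> p) = of_real (leaf_deriv d (leaf_deriv d u) p)"
      if "d \<in> {1, \<i>}" for d
      using plaque_derivs_of_leaf_smooth[where g = "f \<circ> inv_into U \<phi>", OF b(2) u g, of "[d, d]" "\<phi> p"]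
        that b(3) box_facts(3)[OF b(2)] by simp
    then have D: "plaque_derivs k [1, 1] (f \<circ> inv_into U \<phi>) (\<phi> p) + plaque_derivs k [\<i>, \<i>] (f \<circ> inv_into U \<phi>) (\<phi> p) =
        of_real (lap u p)"
      by (simp add: lap_def)
    obtain c d where vw: "v = c *s linear_field lam p" "w = d *s linear_field lam p"
      using True unfolding leaf_tangent_eq[OF pM] by blast
    have "ddc field_foliation f p v w = of_real (1 / (2 * pi)) * of_real (lap u p) * plaque_area (U, \<phi>, k) p v w"
      using True D unfolding ddc_def leaf_restrict_def b_def[symmetric] b(1) by (simp add: Let_def)
    then show ?thesis unfolding vw plaque_area_field[OF b(2,3)] leaf_form_field[OF pM] by simp
  next
    case False
    then show ?thesis using leaf_form_not_tangent by (auto simp: ddc_def leaf_restrict_def)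
  qed
qed

lemma harmonic_functional_of_current:
  assumes "directed_current field_foliation M T" "positive_current field_foliation M T"
    "harmonic_current field_foliation M T"
  shows "harmonic_functional lam (\<lambda>u. Re (T (leaf_form u)))"
proof
  fix u v :: "complex^'n \<Rightarrow> real" and c :: real
  assume u: "test_fun u"
  note u' = leaf_form_mem[OF u]
  show "Re (T (leaf_form (\<lambda>z. u z + v z))) = Re (T (leaf_form u)) + Re (T (leaf_form v))" if v: "test_fun v"
  proof -
    have "leaf_form (\<lambda>z. u z + v z) = (\<lambda>p x y. leaf_form u p x y + leaf_form v p x y)"
      by (simp add: leaf_form_def fun_eq_iff add_divide_distrib distrib_right)
    then show ?thesis using assms(1) u' leaf_form_mem[OF v] by (simp add: directed_current_def)
  qed
  have scale: "T (leaf_form (\<lambda>z. c * u z)) = of_real c * T (leaf_form u)" if u: "test_fun u" for c u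
  proof -
    have "leaf_form (\<lambda>z. c * u z) = (\<lambda>p x y. of_real c * leaf_form u p x y)"
      by (simp add: leaf_form_def fun_eq_iff)
    then show ?thesis using assms(1) leaf_form_mem[OF u] by (simp add: directed_current_def)
  qed
  show "Re (T (leaf_form (\<lambda>z. c * u z))) = c * Re (T (leaf_form u))"
    by (simp add: scale[OF u])
  show "0 \<le> Re (T (leaf_form u))" if nn: "\<And>z. z \<in> M \<Longrightarrow> 0 \<le> u z"
  proof -
    have "positive_leaf_form field_foliation (leaf_form u)"
      unfolding positive_leaf_form_def
    proof clarify
      fix U \<phi> k x assume b: "(U, \<phi>, k) \<in> field_foliation" and x: "x \<in> U"
      then show "plaque_coeff (U, \<phi>, k) (leaf_form u) (\<phi> x) \<in> \<real>\<^sub>\<ge>\<^sub>0"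
        using plaque_coeff_leaf_form[OF b, of "\<phi> x" u] box_facts(2,3)[OF b] nn by auto
    qed
    then have "T (leaf_form u) \<in> \<real>\<^sub>\<ge>\<^sub>0" using assms(2) u' by (simp add: positive_current_def)
    then show ?thesis by (auto simp: complex_nonneg_Reals_iff)
  qed
  show "Re (T (leaf_form (lap u))) = 0"
  proof -
    define f :: "complex^'n \<Rightarrow> complex" where "f = (\<lambda>z. of_real (if z \<in> M then u z else 0))"
    have "f \<in> leaf_functions field_foliation M"
      unfolding f_def using u unfolding test_fun_def by (intro leaf_functions_of_leaf_smooth) auto
    then have "T (ddc field_foliation f) = 0" using assms(3) by (simp add: harmonic_current_def)
    moreover have "ddc field_foliation f = leaf_form (\<lambda>z. 1 / (2 * pi) * lap u z)"
      by (rule ddc_eq_leaf_form[OF test_fun_leaf_smooth[OF u]]) (simp add: f_def)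
    ultimately show ?thesis using scale[OF test_fun_lap[OF u], of "1 / (2 * pi)"] by simp
  qed
qed

text \<open>Extension by zero off \<open>M\<close> and taking real parts translate the two kinds of
  test functions into each other. The factor \<open>c\<close> serves both measures: 1 for the mass
  and 2 / pi for the Lelong number.\<close>

lemma wedge_measure_open_eq:
  assumes V: "V \<subseteq> M" and \<alpha>: "leaf_restrict field_foliation \<alpha> = leaf_form (\<lambda>z. c * leaf_density z)"
  shows "wedge_measure_open field_foliation T \<alpha> V =
    (SUP u\<in>{u. leaf_smooth u \<and> supported_in V u \<and> (\<forall>z\<in>M. 0 \<le> u z \<and> u z \<le> 1)}.
      ennreal (Re (T (leaf_form (\<lambda>z. c * (u z * leaf_density z))))))"
proof -
  have form: "(\<lambda>p v w. of_real (u p) * leaf_restrict field_foliation \<alpha> p v w) = leaf_form (\<lambda>z. c * (u z * leaf_density z))" for u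
    unfolding \<alpha> by (simp add: leaf_form_def fun_eq_iff)
  have form_cong: "leaf_form (\<lambda>z. c * ((if z \<in> M then u z else 0) * leaf_density z)) = leaf_form (\<lambda>z. c * (u z * leaf_density z))" for u
    using leaf_tangent_empty by (auto simp: leaf_form_def fun_eq_iff leaf_restrict_def)
  show ?thesis
    unfolding wedge_measure_open_def
  proof (intro antisym SUP_mono)
    fix f assume f: "f \<in> {f \<in> leaf_functions field_foliation V. \<forall>z. f z \<in> of_real ` {0..1}}"
    define u where "u z = Re (f z)" for z
    have fu: "f z = of_real (u z)" "0 \<le> u z" "u z \<le> 1" for z
    proof -
      obtain a where "a \<in> {0..1::real}" "f z = of_real a" using f by blast
      then show "f z = of_real (u z)" "0 \<le> u z" "u z \<le> 1" by (simp_all add: u_def)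
    qed
    have "leaf_smooth u" "supported_in V u"
      using leaf_smooth_of_leaf_functions[of f V u] f fu(1) by auto
    then show "\<exists>u\<in>{u. leaf_smooth u \<and> supported_in V u \<and> (\<forall>z\<in>M. 0 \<le> u z \<and> u z \<le> 1)}.
        ennreal (Re (T (\<lambda>p v w. f p * leaf_restrict field_foliation \<alpha> p v w))) \<le>
        ennreal (Re (T (leaf_form (\<lambda>z. c * (u z * leaf_density z)))))"
      using fu form[of u] by (intro bexI[of _ u]) auto
  next
    fix u assume u: "u \<in> {u. leaf_smooth u \<and> supported_in V u \<and> (\<forall>z\<in>M. 0 \<le> u z \<and> u z \<le> 1)}"
    define f :: "complex^'n \<Rightarrow> complex" where "f z = of_real (if z \<in> M then u z else 0)" for z
    have "f \<in> leaf_functions field_foliation V"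
      unfolding f_def using u V by (intro leaf_functions_of_leaf_smooth) auto
    moreover have "f z \<in> of_real ` {0..1}" for z using u by (auto simp: f_def)
    moreover have "(\<lambda>p v w. f p * leaf_restrict field_foliation \<alpha> p v w) = leaf_form (\<lambda>z. c * (u z * leaf_density z))"
      unfolding f_def form form_cong ..
    ultimately show "\<exists>f\<in>{f \<in> leaf_functions field_foliation V. \<forall>z. f z \<in> of_real ` {0..1}}.
        ennreal (Re (T (leaf_form (\<lambda>z. c * (u z * leaf_density z))))) \<le>
        ennreal (Re (T (\<lambda>p v w. f p * leaf_restrict field_foliation \<alpha> p v w)))"
      by (intro bexI[of _ f]) auto
  qed
qed

lemma hermitian_leaf_form: "leaf_restrict field_foliation hermitian_form = leaf_form (\<lambda>z. 1 * leaf_density z)"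
proof (intro ext)
  fix p v w
  show "leaf_restrict field_foliation hermitian_form p v w = leaf_form (\<lambda>z. 1 * leaf_density z) p v w"
    using leaf_density_pos[of p] leaf_tangent_empty[of p]
    by (cases "p \<in> M") (auto simp: leaf_form_def leaf_restrict_def)
qed

lemma ddc_norm_leaf_form:
  "leaf_restrict field_foliation (ddc field_foliation (\<lambda>z. of_real ((norm z)\<^sup>2))) = leaf_form (\<lambda>z. 2 / pi * leaf_density z)"
proof -
  have "ddc field_foliation (\<lambda>z. of_real ((norm z)\<^sup>2)) = leaf_form (\<lambda>z. 1 / (2 * pi) * lap (dist2 0) z)"
    by (rule ddc_eq_leaf_form[OF leaf_smooth_dist2]) (simp add: dist2_eq)
  moreover have "leaf_form (\<lambda>z. 1 / (2 * pi) * lap (dist2 0) z) p v w = leaf_form (\<lambda>z. 2 / pi * leaf_density z) p v w" for p v w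
    using leaf_tangent_empty[of p] lap_dist2[of p 0]
    by (cases "p \<in> M") (auto simp: leaf_form_def leaf_restrict_def)
  ultimately have "ddc field_foliation (\<lambda>z. of_real ((norm z)\<^sup>2)) = leaf_form (\<lambda>z. 2 / pi * leaf_density z)"
    by (simp add: fun_eq_iff)
  then show ?thesis using leaf_form_not_tangent by (fastforce simp: leaf_restrict_def fun_eq_iff)
qed

end

lemma SUP_ennreal_finite_bound:
  fixes F :: "'b \<Rightarrow> real"
  assumes "(SUP u\<in>A. ennreal (F u)) < \<infinity>"
  shows "\<exists>m\<ge>0. \<forall>u\<in>A. F u \<le> m"
proof -
  obtain m where m: "m \<ge> 0" "(SUP u\<in>A. ennreal (F u)) = ennreal m"
    using assms by (cases "SUP u\<in>A. ennreal (F u)") auto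
  have "F u \<le> m" if "u \<in> A" for u
    using SUP_upper[OF that, of "\<lambda>u. ennreal (F u)"] m by (simp add: ennreal_le_iff)
  then show ?thesis using m by blast
qed

context linear_foliation
begin

lemma wedge_measure_le:
  assumes "open V" "V \<subseteq> M" "S \<inter> M \<subseteq> V" "leaf_restrict field_foliation \<alpha> = leaf_form (\<lambda>z. c * leaf_density z)"
    and "harmonic_functional lam (\<lambda>u. Re (T (leaf_form u)))"
    and "c \<ge> 0" "\<And>u. leaf_smooth u \<Longrightarrow> supported_in V u \<Longrightarrow> \<forall>z\<in>M. 0 \<le> u z \<and> u z \<le> 1 \<Longrightarrow>
      Re (T (leaf_form (\<lambda>z. u z * leaf_density z))) \<le> m"
  shows "wedge_measure field_foliation M T \<alpha> S \<le> ennreal (c * m)"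
proof -
  interpret harmonic_functional lam "\<lambda>u. Re (T (leaf_form u))" by fact
  have "wedge_measure field_foliation M T \<alpha> S \<le> wedge_measure_open field_foliation T \<alpha> V"
    unfolding wedge_measure_def using assms(1-3) by (intro INF_lower) auto
  also have "\<dots> \<le> ennreal (c * m)"
    unfolding wedge_measure_open_eq[OF assms(2,4)]
  proof (intro SUP_least ennreal_leI)
    fix u assume "u \<in> {u. leaf_smooth u \<and> supported_in V u \<and> (\<forall>z\<in>M. 0 \<le> u z \<and> u z \<le> 1)}"
    then have u: "leaf_smooth u" "supported_in V u" "\<forall>z\<in>M. 0 \<le> u z \<and> u z \<le> 1" by auto
    have "test_fun (\<lambda>z. u z * leaf_density z)"
      using u assms(2) by (intro test_fun_mult leaf_smooth_density) (auto simp: test_fun_def intro: supported_in_mono)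
    then have "Re (T (leaf_form (\<lambda>z. c * (u z * leaf_density z)))) = c * Re (T (leaf_form (\<lambda>z. u z * leaf_density z)))"
      by (rule I_cmult)
    also have "\<dots> \<le> c * m" using assms(6,7) u by (intro mult_left_mono) auto
    finally show "Re (T (leaf_form (\<lambda>z. c * (u z * leaf_density z)))) \<le> c * m" .
  qed
  finally show ?thesis .
qed

end

theorem theorem1p2:
  fixes lam :: "complex^'n"
    and T :: "'n two_form \<Rightarrow> complex"
    and \<F> \<F>' :: "'n flow_box set"
    and \<Z> M :: "(complex^'n) set"
    and r :: real
  assumes "CARD('n) \<ge> 2"
    and "\<forall>j. lam $ j \<noteq> 0"
    and "\<exists>l k. l \<noteq> k \<and> lam $ k / lam $ l \<notin> \<real>"
    and "\<F> = foliation_of_field (polydisc 1 - {0}) (linear_field lam)"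
    and "\<Z> = polydisc 1 \<inter> coordinate_hyperplanes"
    and "M = polydisc 1 - \<Z>"
    and "\<F>' = restrict_foliation \<F> M"
    and "directed_current \<F>' M T"
    and "positive_current \<F>' M T"
    and "harmonic_current \<F>' M T"
    and "0 < r" and "r < 1"
    and "current_mass \<F>' M T (polydisc 1 - polydisc r) < \<infinity>"
  shows "current_mass \<F>' M T (polydisc 1) < \<infinity> \<and>
         (\<forall>x\<in>\<Z>. lelong_number \<F>' M T x = 0)"
proof -
  interpret linear_foliation lam by unfold_locales (use assms(2) in blast)
  have M: "M = punctured_polydisc"
    unfolding assms(5,6) by (auto simp: polydisc_def coordinate_hyperplanes_def punctured_polydisc_def)
  have "0 \<notin> (punctured_polydisc :: (complex^'n) set)" by (simp add: punctured_polydisc_def)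
  then have "M \<subseteq> polydisc 1 - {0}" unfolding M by (auto simp: polydisc_def punctured_polydisc_def)
  then have F: "\<F>' = field_foliation"
    unfolding assms(7,4) M by (auto simp: restrict_foliation_def foliation_of_field_def is_flow_box_def)
  note T = assms(8-10)[unfolded F M]
  have hf: "harmonic_functional lam (\<lambda>u. Re (T (leaf_form u)))"
    by (rule harmonic_functional_of_current[OF T])
  interpret harmonic_functional lam "\<lambda>u. Re (T (leaf_form u))" by (rule hf)
  have "wedge_measure field_foliation punctured_polydisc T hermitian_form (polydisc 1 - polydisc r) < \<infinity>"
    using assms(13) by (simp only: current_mass_def F M)
  \<comment> \<open>The mass of a set is an infimum over open neighbourhoods in \<open>M\<close>, so
    finiteness provides an open \<open>V\<close> of finite mass around the outer region.\<close>
  then obtain V where V: "open V" "(polydisc 1 - polydisc r) \<inter> punctured_polydisc \<subseteq> V" "V \<subseteq> punctured_polydisc"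
    "wedge_measure_open field_foliation T hermitian_form V < \<infinity>"
    unfolding wedge_measure_def by (auto simp: INF_less_iff)
  obtain m where m: "\<And>u. leaf_smooth u \<Longrightarrow> supported_in V u \<Longrightarrow> \<forall>z\<in>punctured_polydisc. 0 \<le> u z \<and> u z \<le> 1 \<Longrightarrow>
      Re (T (leaf_form (\<lambda>z. u z * leaf_density z))) \<le> m"
    using SUP_ennreal_finite_bound[OF V(4)[unfolded wedge_measure_open_eq[OF V(3) hermitian_leaf_form]]] by auto
  have "\<exists>C. \<forall>u. test_fun u \<longrightarrow> (\<forall>z\<in>punctured_polydisc. 0 \<le> u z \<and> u z \<le> 1) \<longrightarrow>
      Re (T (leaf_form (\<lambda>z. u z * leaf_density z))) \<le> C"
  proof (rule mass_finite[OF assms(11,12) V(3)])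
    show "z \<in> V" if "z \<in> punctured_polydisc" "r \<le> cmod (z $ j)" for z j
    proof -
      have "z \<in> polydisc 1 - polydisc r"
        using that by (auto simp: polydisc_def punctured_polydisc_def not_less)
      then show ?thesis using that(1) V(2) by blast
    qed
    show "Re (T (leaf_form (\<lambda>z. u z * leaf_density z))) \<le> m"
      if "leaf_smooth u" "supported_in V u" "\<And>z. z \<in> punctured_polydisc \<Longrightarrow> 0 \<le> u z \<and> u z \<le> 1" for u
      using m that by blast
  qed
  then obtain \<mu> where \<mu>: "\<And>u. test_fun u \<Longrightarrow> (\<And>z. z \<in> punctured_polydisc \<Longrightarrow> 0 \<le> u z \<and> u z \<le> 1) \<Longrightarrow>
      Re (T (leaf_form (\<lambda>z. u z * leaf_density z))) \<le> \<mu>"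
    by blast
  have "wedge_measure field_foliation punctured_polydisc T hermitian_form (polydisc 1) \<le> ennreal (1 * \<mu>)"
    by (rule wedge_measure_le[OF open_punctured_polydisc subset_refl Int_lower2 hermitian_leaf_form hf])
       (auto intro!: \<mu> simp: test_fun_def)
  also have "\<dots> < \<infinity>" by simp
  finally have 1: "current_mass \<F>' M T (polydisc 1) < \<infinity>" by (simp only: current_mass_def F M)
  have 2: "lelong_number \<F>' M T x = 0" if x: "x \<in> \<Z>" for x
  proof -
    define \<alpha> where "\<alpha> = ddc field_foliation (\<lambda>z. of_real ((norm z)\<^sup>2))"
    have \<alpha>: "leaf_restrict field_foliation \<alpha> = leaf_form (\<lambda>z. 2 / pi * leaf_density z)"
      unfolding \<alpha>_def by (rule ddc_norm_leaf_form)
    have x1: "x \<in> polydisc 1" and "\<exists>i. x $ i = 0" using x by (auto simp: assms(5) coordinate_hyperplanes_def)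
    then obtain i where xi: "x $ i = 0" by blast
    have "lelong_number \<F>' M T x \<le> 0"
    proof (rule ennreal_le_epsilon)
      fix e :: real assume e: "e > 0"
      \<comment> \<open>Solves \<open>2 / pi * (\<tau> * s\<^sup>2) = e * (pi * s\<^sup>2)\<close>,
        where 2 / pi is the density factor of the leafwise form of |z|^2.\<close>
      define \<tau> where "\<tau> = e * pi\<^sup>2 / 2"
      have \<tau>: "\<tau> > 0" using e by (simp add: \<tau>_def)
      obtain R1 where R1: "\<And>R u. R \<ge> R1 \<Longrightarrow> leaf_smooth u \<Longrightarrow> supported_in (ball x (exp (- R)) \<inter> punctured_polydisc) u \<Longrightarrow>
          \<forall>z\<in>punctured_polydisc. 0 \<le> u z \<and> u z \<le> 1 \<Longrightarrow> Re (T (leaf_form (\<lambda>z. u z * leaf_density z))) \<le> \<tau> * (exp (- R))\<^sup>2"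
        using lelong_estimate_hyperplanes[OF assms(3) \<mu> x1 xi \<tau>] by blast
      have "Limsup (at_right 0) (\<lambda>r. wedge_measure field_foliation punctured_polydisc T \<alpha> (ball x r) / ennreal (pi * r\<^sup>2)) \<le> ennreal e"
      proof (rule Limsup_bounded)
        have "eventually (\<lambda>r. r \<in> {0<..<exp (- R1)}) (at_right (0::real))"
          by (rule eventually_at_right_real) simp
        then show "eventually (\<lambda>r. wedge_measure field_foliation punctured_polydisc T \<alpha> (ball x r) / ennreal (pi * r\<^sup>2) \<le> ennreal e) (at_right 0)"
        proof eventually_elim
          fix s :: real assume "s \<in> {0<..<exp (- R1)}"
          then have s: "0 < s" "s < exp (- R1)" by auto
          define R where "R = - ln s"
          have R: "exp (- R) = s" "R \<ge> R1"
          proof -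
            show "exp (- R) = s" using s by (simp add: R_def)
            have "ln s \<le> - R1" using s by (metis exp_le_cancel_iff exp_ln less_imp_le)
            then show "R \<ge> R1" by (simp add: R_def)
          qed
          have "wedge_measure field_foliation punctured_polydisc T \<alpha> (ball x s) \<le> ennreal (2 / pi * (\<tau> * s\<^sup>2))"
          proof (rule wedge_measure_le[where V = "ball x s \<inter> punctured_polydisc", OF _ Int_lower2 subset_refl \<alpha> hf])
            show "open (ball x s \<inter> punctured_polydisc)" by (intro open_Int open_ball open_punctured_polydisc)
            show "Re (T (leaf_form (\<lambda>z. u z * leaf_density z))) \<le> \<tau> * s\<^sup>2"
              if "leaf_smooth u" "supported_in (ball x s \<inter> punctured_polydisc) u" "\<forall>z\<in>punctured_polydisc. 0 \<le> u z \<and> u z \<le> 1" for u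
              using R1[OF R(2), of u] that unfolding R(1) by blast
          qed simp
          also have "2 / pi * (\<tau> * s\<^sup>2) = e * (pi * s\<^sup>2)" by (simp add: \<tau>_def power2_eq_square)
          finally have "wedge_measure field_foliation punctured_polydisc T \<alpha> (ball x s) / ennreal (pi * s\<^sup>2) \<le>
              ennreal (e * (pi * s\<^sup>2)) / ennreal (pi * s\<^sup>2)"
            by (rule divide_right_mono_ennreal)
          also have "\<dots> = ennreal e" using s e by (simp add: divide_ennreal)
          finally show "wedge_measure field_foliation punctured_polydisc T \<alpha> (ball x s) / ennreal (pi * s\<^sup>2) \<le> ennreal e" .
        qed
      qed
      then show "lelong_number \<F>' M T x \<le> 0 + ennreal e"
        by (simp add: lelong_number_def F M \<alpha>_def)
    qed
    then show ?thesis by simp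
  qed
  show ?thesis using 1 2 by blast
qed

end
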